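(* Let $\mathbf{k}$ be an algebraically closed field and let $\mathcal{C}$ be a symmetric tensor category over $\mathbf{k}$ with finitely many simple objects. Let $A=\bigoplus_{i\ge 0}A_i$ be a $\mathbb{Z}_{+}$-graded finitely generated commutative algebra in $\mathcal{C}$ (i.e. in $\mathrm{Ind}(\mathcal{C})$, with $A_i\in\mathcal{C}$) with $A_0=\mathbf{1}$, and let $f(z)=\sum_{i\ge 0}\mathrm{FPdim}(A_i)z^i$. Then $f(z)$ has radius of convergence $1$ unless it is a polynomial.
   Context: A tensor category over $\mathbf{k}$ is a $\mathbf{k}$-linear abelian rigid monoidal category with finite-length objects, finite-dimensional Hom spaces, $\mathbf{k}$-bilinear tensor product and $\mathrm{End}(\mathbf{1})=\mathbf{k}$. $\mathrm{FPdim}$ is the Frobenius-Perron dimension (the unique character of the Grothendieck ring positive on simple objects). $\mathbb{Z}_+$ denotes the nonnegative integers. "Finitely generated" means that $A$ is a quotient, as a graded algebra, of the symmetric algebra $SX=\bigoplus_n S^nX$ of some positively graded object $X\in\mathcal{C}$ (of finite length), where $S^nX$ denotes the $S_n$-coinvariants of $X^{\otimes n}$. *)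

theory Defs
  imports
    "HOL-Analysis.FPS_Convergence"
    "HOL-Algebra.QuotRing"
    "HOL-Algebra.Generated_Groups"
    "HOL-Library.Poly_Mapping"
    "HOL-Combinatorics.Transposition"
begin

text \<open>
  Data of a \<open>k\<close>-linear monoidal category with a braiding. The objects are the elements of the
  type \<open>'o\<close>. The Hom-spaces are subspaces of one ambient vector space \<open>'m\<close>: for
  a given category one may take the direct sum of all Hom-spaces and extend composition and
  tensor product bilinearly (with value 0 on non-composable pairs), so this costs no generality.
  Distinct Hom-spaces always share the element 0, hence a morphism does not determine its source
  and target; the predicates below take them as arguments, and all axioms are restricted to the
  relevant Hom-spaces.
\<close>

record ('k, 'o, 'm) moncat =
  hom_space :: "'o \<Rightarrow> 'o \<Rightarrow> 'm set"  (\<open>Hom\<index>\<close>)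
  scal :: "'k \<Rightarrow> 'm \<Rightarrow> 'm"
  cmp :: "'m \<Rightarrow> 'm \<Rightarrow> 'm"  (infixr \<open>\<cdot>\<index>\<close> 75)
  ident :: "'o \<Rightarrow> 'm"
  tobj :: "'o \<Rightarrow> 'o \<Rightarrow> 'o"  (infixl \<open>\<otimes>\<^sub>o\<index>\<close> 80)
  tmor :: "'m \<Rightarrow> 'm \<Rightarrow> 'm"  (infixl \<open>\<otimes>\<^sub>m\<index>\<close> 80)
  unit_obj :: "'o"
  associator :: "'o \<Rightarrow> 'o \<Rightarrow> 'o \<Rightarrow> 'm"
  lunitor :: "'o \<Rightarrow> 'm"
  runitor :: "'o \<Rightarrow> 'm"
  braiding :: "'o \<Rightarrow> 'o \<Rightarrow> 'm"


section \<open>Abelian categories\<close>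

context
  fixes C :: "('k::field, 'o, 'm::ab_group_add) moncat" (structure)
begin

definition is_inverse :: "'o \<Rightarrow> 'o \<Rightarrow> 'm \<Rightarrow> 'm \<Rightarrow> bool" where
  "is_inverse A B f g \<longleftrightarrow>
     f \<in> Hom A B \<and> g \<in> Hom B A \<and> g \<cdot> f = ident C A \<and> f \<cdot> g = ident C B"

definition is_iso :: "'o \<Rightarrow> 'o \<Rightarrow> 'm \<Rightarrow> bool" where
  "is_iso A B f \<longleftrightarrow> (\<exists>g. is_inverse A B f g)"

definition inverse_mor :: "'o \<Rightarrow> 'o \<Rightarrow> 'm \<Rightarrow> 'm" where
  "inverse_mor A B f = (THE g. is_inverse A B f g)"

definition isomorphic :: "'o \<Rightarrow> 'o \<Rightarrow> bool" where
  "isomorphic A B \<longleftrightarrow> (\<exists>f. is_iso A B f)"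

definition is_mono :: "'o \<Rightarrow> 'o \<Rightarrow> 'm \<Rightarrow> bool" where
  "is_mono A B f \<longleftrightarrow> f \<in> Hom A B \<and>
     (\<forall>T. \<forall>g\<in>Hom T A. \<forall>h\<in>Hom T A. f \<cdot> g = f \<cdot> h \<longrightarrow> g = h)"

definition is_epi :: "'o \<Rightarrow> 'o \<Rightarrow> 'm \<Rightarrow> bool" where
  "is_epi A B f \<longleftrightarrow> f \<in> Hom A B \<and>
     (\<forall>T. \<forall>g\<in>Hom B T. \<forall>h\<in>Hom B T. g \<cdot> f = h \<cdot> f \<longrightarrow> g = h)"

definition is_zero_obj :: "'o \<Rightarrow> bool" where
  "is_zero_obj Z \<longleftrightarrow> (\<forall>A. Hom Z A = {0} \<and> Hom A Z = {0})"

definition is_direct_sum ::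
    "'i set \<Rightarrow> ('i \<Rightarrow> 'o) \<Rightarrow> 'o \<Rightarrow> ('i \<Rightarrow> 'm) \<Rightarrow> ('i \<Rightarrow> 'm) \<Rightarrow> bool" where
  "is_direct_sum I Xs X inc prj \<longleftrightarrow>
     finite I \<and>
     (\<forall>i\<in>I. inc i \<in> Hom (Xs i) X \<and> prj i \<in> Hom X (Xs i)) \<and>
     (\<forall>i\<in>I. \<forall>j\<in>I. prj i \<cdot> inc j = (if i = j then ident C (Xs i) else 0)) \<and>
     (\<Sum>i\<in>I. inc i \<cdot> prj i) = ident C X"

definition is_kernel :: "'o \<Rightarrow> 'o \<Rightarrow> 'm \<Rightarrow> 'o \<Rightarrow> 'm \<Rightarrow> bool" where
  "is_kernel A B f K k \<longleftrightarrow>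
     f \<in> Hom A B \<and> k \<in> Hom K A \<and> f \<cdot> k = 0 \<and>
     (\<forall>T. \<forall>t\<in>Hom T A. f \<cdot> t = 0 \<longrightarrow> (\<exists>!u. u \<in> Hom T K \<and> k \<cdot> u = t))"

definition is_cokernel :: "'o \<Rightarrow> 'o \<Rightarrow> 'm \<Rightarrow> 'o \<Rightarrow> 'm \<Rightarrow> bool" where
  "is_cokernel A B f Q q \<longleftrightarrow>
     f \<in> Hom A B \<and> q \<in> Hom B Q \<and> q \<cdot> f = 0 \<and>
     (\<forall>T. \<forall>t\<in>Hom B T. t \<cdot> f = 0 \<longrightarrow> (\<exists>!u. u \<in> Hom Q T \<and> u \<cdot> q = t))"

definition short_exact :: "'o \<Rightarrow> 'm \<Rightarrow> 'o \<Rightarrow> 'm \<Rightarrow> 'o \<Rightarrow> bool" where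
  "short_exact A f B g D \<longleftrightarrow> is_kernel B D g A f \<and> is_cokernel A B f D g"

definition is_simple :: "'o \<Rightarrow> bool" where
  "is_simple S \<longleftrightarrow> \<not> is_zero_obj S \<and>
     (\<forall>A f. is_mono A S f \<longrightarrow> is_zero_obj A \<or> is_iso A S f)"

inductive composition_series :: "'o \<Rightarrow> 'o list \<Rightarrow> bool" where
  "is_zero_obj Z \<Longrightarrow> composition_series Z []"
| "composition_series A Ss \<Longrightarrow> is_simple S \<Longrightarrow> short_exact A f B g S
     \<Longrightarrow> composition_series B (S # Ss)"

definition finite_length :: "'o \<Rightarrow> bool" where
  "finite_length A \<longleftrightarrow> (\<exists>Ss. composition_series A Ss)"

definition finitely_many_simples :: bool where
  "finitely_many_simples \<longleftrightarrow>
     (\<exists>F. finite F \<and> (\<forall>S. is_simple S \<longrightarrow> (\<exists>T\<in>F. isomorphic S T)))"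

end

locale linear_category =
  fixes C :: "('k::field, 'o, 'm::ab_group_add) moncat" (structure)
  assumes ambient_vector_space: "vector_space (scal C)"
    and hom_subspace: "module.subspace (scal C) (Hom A B)"
    and ident_in_hom: "ident C A \<in> Hom A A"
    and cmp_in_hom: "f \<in> Hom A B \<Longrightarrow> g \<in> Hom B D \<Longrightarrow> g \<cdot> f \<in> Hom A D"
    and cmp_assoc: "f \<in> Hom A B \<Longrightarrow> g \<in> Hom B D \<Longrightarrow> h \<in> Hom D E \<Longrightarrow> (h \<cdot> g) \<cdot> f = h \<cdot> (g \<cdot> f)"
    and cmp_ident_right: "f \<in> Hom A B \<Longrightarrow> f \<cdot> ident C A = f"
    and cmp_ident_left: "f \<in> Hom A B \<Longrightarrow> ident C B \<cdot> f = f"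
    and cmp_add_right: "f \<in> Hom A B \<Longrightarrow> f' \<in> Hom A B \<Longrightarrow> g \<in> Hom B D \<Longrightarrow> g \<cdot> (f + f') = g \<cdot> f + g \<cdot> f'"
    and cmp_add_left: "f \<in> Hom A B \<Longrightarrow> g \<in> Hom B D \<Longrightarrow> g' \<in> Hom B D \<Longrightarrow> (g + g') \<cdot> f = g \<cdot> f + g' \<cdot> f"
    and cmp_scal_right: "f \<in> Hom A B \<Longrightarrow> g \<in> Hom B D \<Longrightarrow> g \<cdot> scal C c f = scal C c (g \<cdot> f)"
    and cmp_scal_left: "f \<in> Hom A B \<Longrightarrow> g \<in> Hom B D \<Longrightarrow> scal C c g \<cdot> f = scal C c (g \<cdot> f)"

text \<open>The empty direct sum (the case \<open>n = 0\<close>) is a zero object.\<close>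

locale linear_abelian_category = linear_category +
  assumes finite_direct_sums:
      "\<And>(n::nat) Xs. \<exists>X inc prj. is_direct_sum C {..<n} Xs X inc prj"
    and kernels: "f \<in> Hom A B \<Longrightarrow> \<exists>K k. is_kernel C A B f K k"
    and cokernels: "f \<in> Hom A B \<Longrightarrow> \<exists>Q q. is_cokernel C A B f Q q"
    and mono_normal: "is_mono C A B f \<Longrightarrow> \<exists>D g. is_kernel C B D g A f"
    and epi_normal: "is_epi C A B f \<Longrightarrow> \<exists>D g. is_cokernel C D A g B f"


section \<open>Tensor categories\<close>

locale linear_monoidal_category = linear_category +
  assumes tmor_in_hom:
      "f \<in> Hom A B \<Longrightarrow> g \<in> Hom A' B' \<Longrightarrow> f \<otimes>\<^sub>m g \<in> Hom (A \<otimes>\<^sub>o A') (B \<otimes>\<^sub>o B')"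
    and tmor_ident: "ident C A \<otimes>\<^sub>m ident C B = ident C (A \<otimes>\<^sub>o B)"
    and tmor_cmp:
      "f \<in> Hom A B \<Longrightarrow> g \<in> Hom B D \<Longrightarrow> f' \<in> Hom A' B' \<Longrightarrow> g' \<in> Hom B' D' \<Longrightarrow>
         (g \<cdot> f) \<otimes>\<^sub>m (g' \<cdot> f') = (g \<otimes>\<^sub>m g') \<cdot> (f \<otimes>\<^sub>m f')"
    and tmor_add_left:
      "f \<in> Hom A B \<Longrightarrow> f' \<in> Hom A B \<Longrightarrow> g \<in> Hom A' B' \<Longrightarrow> (f + f') \<otimes>\<^sub>m g = f \<otimes>\<^sub>m g + f' \<otimes>\<^sub>m g"
    and tmor_add_right:
      "f \<in> Hom A B \<Longrightarrow> g \<in> Hom A' B' \<Longrightarrow> g' \<in> Hom A' B' \<Longrightarrow> f \<otimes>\<^sub>m (g + g') = f \<otimes>\<^sub>m g + f \<otimes>\<^sub>m g'"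
    and tmor_scal_left:
      "f \<in> Hom A B \<Longrightarrow> g \<in> Hom A' B' \<Longrightarrow> scal C c f \<otimes>\<^sub>m g = scal C c (f \<otimes>\<^sub>m g)"
    and tmor_scal_right:
      "f \<in> Hom A B \<Longrightarrow> g \<in> Hom A' B' \<Longrightarrow> f \<otimes>\<^sub>m scal C c g = scal C c (f \<otimes>\<^sub>m g)"
    and associator_iso:
      "is_iso C ((X \<otimes>\<^sub>o Y) \<otimes>\<^sub>o Z) (X \<otimes>\<^sub>o (Y \<otimes>\<^sub>o Z)) (associator C X Y Z)"
    and lunitor_iso: "is_iso C (unit_obj C \<otimes>\<^sub>o X) X (lunitor C X)"
    and runitor_iso: "is_iso C (X \<otimes>\<^sub>o unit_obj C) X (runitor C X)"
    and associator_natural: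
      "f \<in> Hom X X' \<Longrightarrow> g \<in> Hom Y Y' \<Longrightarrow> h \<in> Hom Z Z' \<Longrightarrow>
         associator C X' Y' Z' \<cdot> ((f \<otimes>\<^sub>m g) \<otimes>\<^sub>m h) = (f \<otimes>\<^sub>m (g \<otimes>\<^sub>m h)) \<cdot> associator C X Y Z"
    and lunitor_natural:
      "f \<in> Hom X Y \<Longrightarrow> lunitor C Y \<cdot> (ident C (unit_obj C) \<otimes>\<^sub>m f) = f \<cdot> lunitor C X"
    and runitor_natural:
      "f \<in> Hom X Y \<Longrightarrow> runitor C Y \<cdot> (f \<otimes>\<^sub>m ident C (unit_obj C)) = f \<cdot> runitor C X"
    and pentagon:
      "(ident C W \<otimes>\<^sub>m associator C X Y Z) \<cdot> associator C W (X \<otimes>\<^sub>o Y) Z \<cdot> (associator C W X Y \<otimes>\<^sub>m ident C Z)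
        = associator C W X (Y \<otimes>\<^sub>o Z) \<cdot> associator C (W \<otimes>\<^sub>o X) Y Z"
    and triangle:
      "(ident C X \<otimes>\<^sub>m lunitor C Y) \<cdot> associator C X (unit_obj C) Y = runitor C X \<otimes>\<^sub>m ident C Y"

context
  fixes C :: "('k::field, 'o, 'm::ab_group_add) moncat" (structure)
begin

definition is_left_dual :: "'o \<Rightarrow> 'o \<Rightarrow> 'm \<Rightarrow> 'm \<Rightarrow> bool" where
  "is_left_dual X Y ev coev \<longleftrightarrow>
     ev \<in> Hom (Y \<otimes>\<^sub>o X) (unit_obj C) \<and> coev \<in> Hom (unit_obj C) (X \<otimes>\<^sub>o Y) \<and>
     runitor C X \<cdot> (ident C X \<otimes>\<^sub>m ev) \<cdot> associator C X Y X \<cdot> (coev \<otimes>\<^sub>m ident C X) = lunitor C X \<and>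
     lunitor C Y \<cdot> (ev \<otimes>\<^sub>m ident C Y) \<cdot>
       inverse_mor C ((Y \<otimes>\<^sub>o X) \<otimes>\<^sub>o Y) (Y \<otimes>\<^sub>o (X \<otimes>\<^sub>o Y)) (associator C Y X Y) \<cdot>
       (ident C Y \<otimes>\<^sub>m coev) = runitor C Y"

end

locale tensor_category = linear_abelian_category + linear_monoidal_category +
  assumes left_duals: "\<exists>Y ev coev. is_left_dual C X Y ev coev"
    and right_duals: "\<exists>Y ev coev. is_left_dual C Y X ev coev"
    and objects_finite_length: "finite_length C X"
    and hom_finite_dimensional:
      "\<exists>F. finite F \<and> F \<subseteq> Hom A B \<and> module.span (scal C) F = Hom A B"
    and end_unit:
      "bij_betw (\<lambda>c. scal C c (ident C (unit_obj C))) UNIV (Hom (unit_obj C) (unit_obj C))"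

locale symmetric_tensor_category = tensor_category +
  assumes braiding_in_hom: "braiding C X Y \<in> Hom (X \<otimes>\<^sub>o Y) (Y \<otimes>\<^sub>o X)"
    and braiding_natural:
      "f \<in> Hom X X' \<Longrightarrow> g \<in> Hom Y Y' \<Longrightarrow> braiding C X' Y' \<cdot> (f \<otimes>\<^sub>m g) = (g \<otimes>\<^sub>m f) \<cdot> braiding C X Y"
    and braiding_symmetric: "braiding C Y X \<cdot> braiding C X Y = ident C (X \<otimes>\<^sub>o Y)"
    and hexagon:
      "associator C Y Z X \<cdot> braiding C X (Y \<otimes>\<^sub>o Z) \<cdot> associator C X Y Z
        = (ident C Y \<otimes>\<^sub>m braiding C X Z) \<cdot> associator C Y X Z \<cdot> (braiding C X Y \<otimes>\<^sub>m ident C Z)"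


section \<open>Grothendieck ring and Frobenius-Perron dimension\<close>

text \<open>
  The Grothendieck ring is the free abelian group \<open>'o \<Rightarrow>\<^sub>0 int\<close> on the objects, with the bilinear
  extension of the tensor product, modulo the relations \<open>[B] = [A] + [D]\<close> for short exact
  sequences \<open>0 \<rightarrow> A \<rightarrow> B \<rightarrow> D \<rightarrow> 0\<close>. Before taking the quotient the product is not associative
  on the nose.
\<close>

context
  fixes C :: "('k::field, 'o, 'm::ab_group_add) moncat" (structure)
begin

definition free_tensor_ring :: "('o \<Rightarrow>\<^sub>0 int) ring" where
  "free_tensor_ring =
     \<lparr>carrier = UNIV,
      mult = (\<lambda>x y. frag_extend (\<lambda>A. frag_extend (\<lambda>B. frag_of (A \<otimes>\<^sub>o B)) y) x),
      one = frag_of (unit_obj C),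
      zero = 0,
      add = (+)\<rparr>"

definition exact_sequence_relations :: "('o \<Rightarrow>\<^sub>0 int) set" where
  "exact_sequence_relations = generate (add_monoid free_tensor_ring)
     {frag_of B - (frag_of A + frag_of D) | A B D. \<exists>f g. short_exact C A f B g D}"

definition Grothendieck_ring :: "('o \<Rightarrow>\<^sub>0 int) set ring" where
  "Grothendieck_ring = free_tensor_ring Quot exact_sequence_relations"

definition Grothendieck_class :: "'o \<Rightarrow> ('o \<Rightarrow>\<^sub>0 int) set" where
  "Grothendieck_class X = exact_sequence_relations +>\<^bsub>free_tensor_ring\<^esub> frag_of X"

definition real_ring :: "real ring" where
  "real_ring = \<lparr>carrier = UNIV, mult = (*), one = 1, zero = 0, add = (+)\<rparr>"

definition is_FP_character :: "(('o \<Rightarrow>\<^sub>0 int) set \<Rightarrow> real) \<Rightarrow> bool" where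
  "is_FP_character h \<longleftrightarrow>
     h \<in> ring_hom Grothendieck_ring real_ring \<and>
     (\<forall>S. is_simple C S \<longrightarrow> h (Grothendieck_class S) > 0)"

text \<open>
  A homomorphism is determined only on the carrier of the Grothendieck ring, so the
  description operator is applied to its value and not to the character.
\<close>

definition FPdim :: "'o \<Rightarrow> real" where
  "FPdim X = (THE d. \<exists>h. is_FP_character h \<and> d = h (Grothendieck_class X))"

end


section \<open>Graded commutative algebras\<close>

text \<open>
  A \<open>\<int>\<^sub>+\<close>-graded algebra \<open>A = \<Oplus>A\<^sub>i\<close> in the ind-completion with all \<open>A\<^sub>i\<close> in the category is given
  by the components of its multiplication \<open>A\<^sub>i \<otimes> A\<^sub>j \<rightarrow> A\<^sub>i\<^sub>+\<^sub>j\<close> and by its unit \<open>1 \<rightarrow> A\<^sub>0\<close>.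
\<close>

record ('o, 'm) graded_alg =
  gcomp :: "nat \<Rightarrow> 'o"
  gmul :: "nat \<Rightarrow> nat \<Rightarrow> 'm"
  gone :: "'m"

context
  fixes C :: "('k::field, 'o, 'm::ab_group_add) moncat" (structure)
begin

definition is_graded_algebra :: "('o, 'm) graded_alg \<Rightarrow> bool" where
  "is_graded_algebra A \<longleftrightarrow>
     (\<forall>i j. gmul A i j \<in> Hom (gcomp A i \<otimes>\<^sub>o gcomp A j) (gcomp A (i + j))) \<and>
     gone A \<in> Hom (unit_obj C) (gcomp A 0) \<and>
     (\<forall>i j k. gmul A (i + j) k \<cdot> (gmul A i j \<otimes>\<^sub>m ident C (gcomp A k))
        = gmul A i (j + k) \<cdot> (ident C (gcomp A i) \<otimes>\<^sub>m gmul A j k) \<cdot>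
            associator C (gcomp A i) (gcomp A j) (gcomp A k)) \<and>
     (\<forall>i. gmul A 0 i \<cdot> (gone A \<otimes>\<^sub>m ident C (gcomp A i)) = lunitor C (gcomp A i)) \<and>
     (\<forall>i. gmul A i 0 \<cdot> (ident C (gcomp A i) \<otimes>\<^sub>m gone A) = runitor C (gcomp A i))"

definition is_commutative_graded_algebra :: "('o, 'm) graded_alg \<Rightarrow> bool" where
  "is_commutative_graded_algebra A \<longleftrightarrow> is_graded_algebra A \<and>
     (\<forall>i j. gmul A j i \<cdot> braiding C (gcomp A i) (gcomp A j) = gmul A i j)"

text \<open>\<open>A\<^sub>0 = 1\<close>, identified via the unit of the algebra.\<close>

definition is_connected :: "('o, 'm) graded_alg \<Rightarrow> bool" where
  "is_connected A \<longleftrightarrow> is_iso C (unit_obj C) (gcomp A 0) (gone A)"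

definition is_graded_quotient_map ::
    "('o, 'm) graded_alg \<Rightarrow> ('o, 'm) graded_alg \<Rightarrow> (nat \<Rightarrow> 'm) \<Rightarrow> bool" where
  "is_graded_quotient_map S A \<phi> \<longleftrightarrow>
     (\<forall>i. is_epi C (gcomp S i) (gcomp A i) (\<phi> i)) \<and>
     (\<forall>i j. \<phi> (i + j) \<cdot> gmul S i j = gmul A i j \<cdot> (\<phi> i \<otimes>\<^sub>m \<phi> j)) \<and>
     \<phi> 0 \<cdot> gone S = gone A"


subsection \<open>Symmetric powers\<close>

primrec tpow :: "'o \<Rightarrow> nat \<Rightarrow> 'o" where
  "tpow X 0 = unit_obj C"
| "tpow X (Suc n) = tpow X n \<otimes>\<^sub>o X"

text \<open>
  \<open>adj_swap X n i\<close> exchanges the factors \<open>i\<close> and \<open>i + 1\<close> (counted from 0, \<open>i + 1 < n\<close>) of the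
  \<open>n\<close>-th tensor power; the first two equations are junk values.
\<close>

fun adj_swap :: "'o \<Rightarrow> nat \<Rightarrow> nat \<Rightarrow> 'm" where
  "adj_swap X 0 i = ident C (tpow X 0)"
| "adj_swap X (Suc 0) i = ident C (tpow X (Suc 0))"
| "adj_swap X (Suc (Suc n)) i =
     (if i = n
      then inverse_mor C (tpow X n \<otimes>\<^sub>o X \<otimes>\<^sub>o X) (tpow X n \<otimes>\<^sub>o (X \<otimes>\<^sub>o X)) (associator C (tpow X n) X X) \<cdot>
           (ident C (tpow X n) \<otimes>\<^sub>m braiding C X X) \<cdot> associator C (tpow X n) X X
      else adj_swap X (Suc n) i \<otimes>\<^sub>m ident C X)"

text \<open>
  The action of the symmetric group on the \<open>n\<close>-th tensor power, as a relation between
  permutations of \<open>{..<n}\<close> and endomorphisms.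
\<close>

inductive sym_action :: "'o \<Rightarrow> nat \<Rightarrow> (nat \<Rightarrow> nat) \<Rightarrow> 'm \<Rightarrow> bool" for X :: 'o and n :: nat where
  "sym_action X n id (ident C (tpow X n))"
| "sym_action X n \<sigma> f \<Longrightarrow> Suc i < n
     \<Longrightarrow> sym_action X n (Transposition.transpose i (Suc i) \<circ> \<sigma>) (adj_swap X n i \<cdot> f)"

text \<open>\<open>is_sym_power X n Q q\<close>: the morphism \<open>q\<close> exhibits \<open>Q\<close> as the coinvariants.\<close>

definition is_sym_power :: "'o \<Rightarrow> nat \<Rightarrow> 'o \<Rightarrow> 'm \<Rightarrow> bool" where
  "is_sym_power X n Q q \<longleftrightarrow>
     q \<in> Hom (tpow X n) Q \<and>
     (\<forall>\<sigma> f. sym_action X n \<sigma> f \<longrightarrow> q \<cdot> f = q) \<and>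
     (\<forall>T. \<forall>t\<in>Hom (tpow X n) T. (\<forall>\<sigma> f. sym_action X n \<sigma> f \<longrightarrow> t \<cdot> f = t)
        \<longrightarrow> (\<exists>!u. u \<in> Hom Q T \<and> u \<cdot> q = t))"

text \<open>The canonical isomorphism from the product of the powers \<open>n\<close> and \<open>p\<close> to the power \<open>n + p\<close>.\<close>

primrec tpow_join :: "'o \<Rightarrow> nat \<Rightarrow> nat \<Rightarrow> 'm" where
  "tpow_join X n 0 = runitor C (tpow X n)"
| "tpow_join X n (Suc p) =
     (tpow_join X n p \<otimes>\<^sub>m ident C X) \<cdot>
     inverse_mor C (tpow X n \<otimes>\<^sub>o tpow X p \<otimes>\<^sub>o X) (tpow X n \<otimes>\<^sub>o (tpow X p \<otimes>\<^sub>o X))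
       (associator C (tpow X n) (tpow X p) X)"


subsection \<open>The symmetric algebra of a graded object\<close>

text \<open>
  A grading of \<open>X\<close> enters below through the projectors \<open>e d\<close> of \<open>X\<close> onto its homogeneous
  components; \<open>tpow_degree X e n m\<close> is the resulting projector of the \<open>n\<close>-th tensor power
  onto its part of degree \<open>m\<close>.
\<close>

definition is_positive_grading :: "'o \<Rightarrow> (nat \<Rightarrow> 'm) \<Rightarrow> bool" where
  "is_positive_grading X e \<longleftrightarrow>
     (\<exists>I Xs inc prj. is_direct_sum C I Xs X inc prj \<and> 0 \<notin> I \<and>
        e = (\<lambda>d. if d \<in> I then inc d \<cdot> prj d else 0))"

primrec tpow_degree :: "'o \<Rightarrow> (nat \<Rightarrow> 'm) \<Rightarrow> nat \<Rightarrow> nat \<Rightarrow> 'm" where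
  "tpow_degree X e 0 m = (if m = 0 then ident C (tpow X 0) else 0)"
| "tpow_degree X e (Suc n) m = (\<Sum>d\<le>m. tpow_degree X e n (m - d) \<otimes>\<^sub>m e d)"

text \<open>
  In \<open>is_symmetric_algebra X e S\<close>, \<open>Q n\<close> is the symmetric power \<open>S\<^sup>nX\<close> with its projection \<open>q n\<close>,
  and \<open>R n m\<close> is the part of degree \<open>m\<close> of \<open>S\<^sup>nX\<close>, i.e. the image of the idempotent
  \<open>a n m \<cdot> b n m\<close> of \<open>S\<^sup>nX\<close> induced by \<open>tpow_degree X e n m\<close>. The part of degree \<open>m\<close> of the
  symmetric algebra is the direct sum of the \<open>R n m\<close>; since \<open>X\<close> is positively graded, only
  \<open>n \<le> m\<close> contribute. The multiplication is induced by the concatenation \<open>tpow_join\<close>.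
\<close>

definition is_symmetric_algebra :: "'o \<Rightarrow> (nat \<Rightarrow> 'm) \<Rightarrow> ('o, 'm) graded_alg \<Rightarrow> bool" where
  "is_symmetric_algebra X e S \<longleftrightarrow>
     (\<exists>Q q R a b inc prj.
        (\<forall>n. is_sym_power X n (Q n) (q n)) \<and>
        (\<forall>n m. a n m \<in> Hom (R n m) (Q n) \<and> b n m \<in> Hom (Q n) (R n m) \<and>
           b n m \<cdot> a n m = ident C (R n m) \<and>
           a n m \<cdot> b n m \<cdot> q n = q n \<cdot> tpow_degree X e n m) \<and>
        (\<forall>m. is_direct_sum C {..m} (\<lambda>n. R n m) (gcomp S m) (inc m) (prj m)) \<and>
        (\<forall>m l. gmul S m l \<in> Hom (gcomp S m \<otimes>\<^sub>o gcomp S l) (gcomp S (m + l))) \<and>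
        (\<forall>m l. \<forall>n\<le>m. \<forall>p\<le>l.
           gmul S m l \<cdot> ((inc m n \<cdot> b n m \<cdot> q n) \<otimes>\<^sub>m (inc l p \<cdot> b p l \<cdot> q p))
             = inc (m + l) (n + p) \<cdot> b (n + p) (m + l) \<cdot> q (n + p) \<cdot> tpow_join X n p \<cdot>
                 (tpow_degree X e n m \<otimes>\<^sub>m tpow_degree X e p l)) \<and>
        gone S = inc 0 0 \<cdot> b 0 0 \<cdot> q 0)"

definition is_finitely_generated :: "('o, 'm) graded_alg \<Rightarrow> bool" where
  "is_finitely_generated A \<longleftrightarrow>
     (\<exists>X e S \<phi>. is_positive_grading X e \<and> is_symmetric_algebra X e S \<and>
        is_graded_quotient_map S A \<phi>)"

definition FP_series :: "('o, 'm) graded_alg \<Rightarrow> real fps" where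
  "FP_series A = Abs_fps (\<lambda>i. FPdim C (gcomp A i))"

end

end

theory Submission
  imports Defs
begin

text \<open>
  Write \<open>d\<close> for \<open>FPdim\<close>, and multiply homogeneous subobjects of \<open>A\<close>; this product is commutative.
  Let \<open>R\<close> bound \<open>d\<close> on the finitely many simple objects. If \<open>G / F\<close> is simple, filtering
  \<open>G\<^sup>n\<close> by the \<open>F\<^sup>i G\<^sup>n\<^sup>-\<^sup>i\<close> gives \<open>d (G\<^sup>n) \<le> (\<Sum>i\<le>n. d (F\<^sup>i) R\<^sup>n\<^sup>-\<^sup>i)\<close>, so by induction on the length
  \<open>d (U\<^sup>n)\<close> is at most a polynomial times \<open>R\<^sup>n\<close> for every subobject \<open>U\<close>. As \<open>R\<close> does not depend on
  \<open>U\<close>, the same bound for \<open>U\<^sup>p\<close> shows that \<open>d (U\<^sup>n)\<close> grows no faster than \<open>R\<^sup>n\<^sup>/\<^sup>p\<close>, for all \<open>p\<close>.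
  Hence it grows subexponentially, and so does \<open>d (A\<^sub>m)\<close>, because \<open>A\<^sub>m\<close> is the sum of the polynomially
  many monomials of degree \<open>m\<close> in the finitely many generating subobjects. Conversely \<open>d\<close> is bounded
  below on nonzero objects, so the radius is at most 1 unless almost all \<open>A\<^sub>m\<close> vanish.
\<close>

section \<open>Abelian categories\<close>

text \<open>The obstacle is that A has no elements: products and sums of subobjects would have to be
  built from images and compared up to isomorphism. Instead, the subobject spanned by f : Y
  \<rightarrow> A_m is represented by the morphisms on A_m that vanish on f. Different spanning
  morphisms of the same subobject then give equal elements, associators and braidings disappear, and
  the homogeneous subobjects form an ordinary commutative monoid. Rigidity makes this work: for
  fixed g, the condition that t vanishes on the product of f and g transposes to the condition that
  some t' vanishes on f, so a product depends on the annihilators of its factors alone. The same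
  adjunction yields the exactness of the tensor product, and with it the multiplication on the
  Grothendieck ring and the estimate for quotients of products. Sums of subobjects are avoided too:
  sizes are codimensions of cokernels, and a family spans A_m if only 0 annihilates all its
  members.\<close>

context linear_category
begin

lemma zero_in_hom [simp]: "0 \<in> Hom A B"
proof -
  interpret V: vector_space "scal C" by (rule ambient_vector_space)
  show ?thesis using hom_subspace V.subspace_0 by blast
qed

lemma add_in_hom: "f \<in> Hom A B \<Longrightarrow> g \<in> Hom A B \<Longrightarrow> f + g \<in> Hom A B"
proof -
  interpret V: vector_space "scal C" by (rule ambient_vector_space)
  show "f \<in> Hom A B \<Longrightarrow> g \<in> Hom A B \<Longrightarrow> f + g \<in> Hom A B" using hom_subspace V.subspace_add by blast
qed

lemma diff_in_hom: "f \<in> Hom A B \<Longrightarrow> g \<in> Hom A B \<Longrightarrow> f - g \<in> Hom A B"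
proof -
  interpret V: vector_space "scal C" by (rule ambient_vector_space)
  show "f \<in> Hom A B \<Longrightarrow> g \<in> Hom A B \<Longrightarrow> f - g \<in> Hom A B" using hom_subspace V.subspace_diff by blast
qed

lemma sum_in_hom: "(\<And>i. i \<in> I \<Longrightarrow> f i \<in> Hom A B) \<Longrightarrow> sum f I \<in> Hom A B"
  by (induction I rule: infinite_finite_induct) (auto intro: add_in_hom)

lemma cmp_zero_right: "g \<in> Hom B D \<Longrightarrow> g \<cdot> 0 = 0"
  using cmp_add_right[of 0 B B 0 g D] by simp

lemma cmp_zero_left: "f \<in> Hom A B \<Longrightarrow> 0 \<cdot> f = 0"
  using cmp_add_left[of f A B 0 B 0] by simp

lemma cmp_diff_left:
  "f \<in> Hom A B \<Longrightarrow> g \<in> Hom B D \<Longrightarrow> g' \<in> Hom B D \<Longrightarrow> (g - g') \<cdot> f = g \<cdot> f - g' \<cdot> f"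
  using cmp_add_left[of f A B "g - g'" D g'] by (simp add: diff_in_hom algebra_simps)

lemma cmp_diff_right:
  "f \<in> Hom A B \<Longrightarrow> f' \<in> Hom A B \<Longrightarrow> g \<in> Hom B D \<Longrightarrow> g \<cdot> (f - f') = g \<cdot> f - g \<cdot> f'"
  using cmp_add_right[of "f - f'" A B f' g D] by (simp add: diff_in_hom algebra_simps)

lemma cmp_sum_right:
  assumes "g \<in> Hom B D" "\<And>i. i \<in> I \<Longrightarrow> f i \<in> Hom A B"
  shows "g \<cdot> sum f I = (\<Sum>i\<in>I. g \<cdot> f i)"
  using assms(2)
proof (induction I rule: infinite_finite_induct)
  case (insert i I)
  then show ?case using cmp_add_right[of "f i" A B "sum f I" g D] assms(1)
    by (simp add: sum_in_hom)
qed (auto simp: cmp_zero_right[OF assms(1)])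

text \<open>By additivity, cancelling g against h amounts to killing g - h, so epis, and likewise
  monos, can be tested on zero.\<close>

lemma epiI:
  assumes f: "f \<in> Hom A B" and z: "\<And>T t. t \<in> Hom B T \<Longrightarrow> t \<cdot> f = 0 \<Longrightarrow> t = 0"
  shows "is_epi C A B f"
  unfolding is_epi_def
proof (intro conjI allI ballI impI f)
  fix T g h assume gh: "g \<in> Hom B T" "h \<in> Hom B T" "g \<cdot> f = h \<cdot> f"
  then have "(g - h) \<cdot> f = 0" using cmp_diff_left[OF f gh(1,2)] by simp
  then show "g = h" using z[OF diff_in_hom[OF gh(1,2)]] by simp
qed

lemma monoI:
  assumes f: "f \<in> Hom A B" and z: "\<And>T t. t \<in> Hom T A \<Longrightarrow> f \<cdot> t = 0 \<Longrightarrow> t = 0"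
  shows "is_mono C A B f"
  unfolding is_mono_def
proof (intro conjI allI ballI impI f)
  fix T g h assume gh: "g \<in> Hom T A" "h \<in> Hom T A" "f \<cdot> g = f \<cdot> h"
  then have "f \<cdot> (g - h) = 0" using cmp_diff_right[OF gh(1,2) f] by simp
  then show "g = h" using z[OF diff_in_hom[OF gh(1,2)]] by simp
qed

lemma epi_in_hom: "is_epi C A B f \<Longrightarrow> f \<in> Hom A B"
  by (simp add: is_epi_def)

lemma mono_in_hom: "is_mono C A B f \<Longrightarrow> f \<in> Hom A B"
  by (simp add: is_mono_def)

lemma epi_cancel: "is_epi C A B f \<Longrightarrow> g \<in> Hom B T \<Longrightarrow> h \<in> Hom B T \<Longrightarrow> g \<cdot> f = h \<cdot> f \<Longrightarrow> g = h"
  unfolding is_epi_def by blast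

lemma mono_cancel: "is_mono C A B f \<Longrightarrow> g \<in> Hom T A \<Longrightarrow> h \<in> Hom T A \<Longrightarrow> f \<cdot> g = f \<cdot> h \<Longrightarrow> g = h"
  unfolding is_mono_def by blast

lemma epi_eq_0: "is_epi C A B f \<Longrightarrow> g \<in> Hom B T \<Longrightarrow> g \<cdot> f = 0 \<Longrightarrow> g = 0"
  using epi_cancel[of A B f g T 0] cmp_zero_left[of f A B] by (simp add: is_epi_def)

lemma mono_eq_0: "is_mono C A B f \<Longrightarrow> g \<in> Hom T A \<Longrightarrow> f \<cdot> g = 0 \<Longrightarrow> g = 0"
  using mono_cancel[of A B f g T 0] cmp_zero_right[of f A B] by (simp add: is_mono_def)

lemma epi_cmp:
  assumes f: "is_epi C A B f" and g: "is_epi C B D g"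
  shows "is_epi C A D (g \<cdot> f)"
proof (rule epiI)
  note fh = epi_in_hom[OF f] and gh = epi_in_hom[OF g]
  show "g \<cdot> f \<in> Hom A D" using fh gh by (rule cmp_in_hom)
  fix T t assume t: "t \<in> Hom D T" and "t \<cdot> (g \<cdot> f) = 0"
  then have "(t \<cdot> g) \<cdot> f = 0" using cmp_assoc[OF fh gh t] by simp
  then have "t \<cdot> g = 0" using epi_eq_0[OF f cmp_in_hom[OF gh t]] by simp
  then show "t = 0" using epi_eq_0[OF g t] by simp
qed

lemma mono_cmp:
  assumes f: "is_mono C A B f" and g: "is_mono C B D g"
  shows "is_mono C A D (g \<cdot> f)"
proof (rule monoI)
  note fh = mono_in_hom[OF f] and gh = mono_in_hom[OF g]
  show "g \<cdot> f \<in> Hom A D" using fh gh by (rule cmp_in_hom)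
  fix T t assume t: "t \<in> Hom T A" and "(g \<cdot> f) \<cdot> t = 0"
  then have "g \<cdot> (f \<cdot> t) = 0" using cmp_assoc[OF t fh gh] by simp
  then have "f \<cdot> t = 0" using mono_eq_0[OF g cmp_in_hom[OF t fh]] by simp
  then show "t = 0" using mono_eq_0[OF f t] by simp
qed

lemma section_epi:
  assumes a: "a \<in> Hom R Q" and b: "b \<in> Hom Q R" and ba: "b \<cdot> a = ident C R"
  shows "is_epi C Q R b"
proof (rule epiI[OF b])
  fix T t assume t: "t \<in> Hom R T" and "t \<cdot> b = 0"
  then have "(t \<cdot> b) \<cdot> a = 0" using cmp_zero_left[OF a] by simp
  then show "t = 0" using cmp_assoc[OF a b t] ba cmp_ident_right[OF t] by simp
qed

lemma is_inverse_unique: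
  assumes "is_inverse C A B f g" "is_inverse C A B f g'"
  shows "g = g'"
proof -
  have h: "f \<in> Hom A B" "g \<in> Hom B A" "g' \<in> Hom B A" "g \<cdot> f = ident C A" "f \<cdot> g' = ident C B"
    using assms by (auto simp: is_inverse_def)
  show ?thesis
    using cmp_assoc[OF h(3) h(1) h(2)] h(4,5) cmp_ident_left[OF h(3)] cmp_ident_right[OF h(2)] by simp
qed

lemma inverse_mor:
  assumes "is_iso C A B f"
  shows "is_inverse C A B f (inverse_mor C A B f)"
proof -
  obtain g where g: "is_inverse C A B f g" using assms by (auto simp: is_iso_def)
  show ?thesis unfolding inverse_mor_def
    by (rule theI[of _ g]) (use g is_inverse_unique in blast)+
qed

lemma inverse_mor_cmp:
  assumes "is_iso C A B f"
  shows "f \<in> Hom A B" "inverse_mor C A B f \<in> Hom B A"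
    "inverse_mor C A B f \<cdot> f = ident C A" "f \<cdot> inverse_mor C A B f = ident C B"
  using inverse_mor[OF assms] by (auto simp: is_inverse_def)

lemma iso_epi: "is_iso C A B f \<Longrightarrow> is_epi C A B f"
  using section_epi[OF inverse_mor_cmp(2) inverse_mor_cmp(1) inverse_mor_cmp(4)] by blast

lemma iso_mono:
  assumes "is_iso C A B f"
  shows "is_mono C A B f"
proof (rule monoI)
  note i = inverse_mor_cmp[OF assms]
  show "f \<in> Hom A B" by (rule i)
  fix T t assume t: "t \<in> Hom T A" "f \<cdot> t = 0"
  then show "t = 0"
    using cmp_assoc[OF t(1) i(1,2)] i(3) cmp_ident_left[OF t(1)] cmp_zero_right[OF i(2)] by simp
qed

lemma cokernel_epi:
  assumes "is_cokernel C A B f Q q"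
  shows "is_epi C B Q q"
proof (rule epiI)
  have q: "f \<in> Hom A B" "q \<in> Hom B Q" "q \<cdot> f = 0"
    using assms by (auto simp: is_cokernel_def)
  show "q \<in> Hom B Q" by (rule q)
  fix T t assume t: "t \<in> Hom Q T" "t \<cdot> q = 0"
  have "\<exists>!u. u \<in> Hom Q T \<and> u \<cdot> q = 0"
    using assms cmp_zero_left[OF q(1)] unfolding is_cokernel_def by simp
  then show "t = 0" using t cmp_zero_left[OF q(2)] zero_in_hom by metis
qed

lemma kernel_mono:
  assumes "is_kernel C A B f K k"
  shows "is_mono C K A k"
proof (rule monoI)
  have k: "f \<in> Hom A B" "k \<in> Hom K A" "f \<cdot> k = 0"
    using assms by (auto simp: is_kernel_def)
  show "k \<in> Hom K A" by (rule k)
  fix T t assume t: "t \<in> Hom T K" "k \<cdot> t = 0"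
  have "\<exists>!u. u \<in> Hom T K \<and> k \<cdot> u = 0"
    using assms cmp_zero_right[OF k(1)] unfolding is_kernel_def by simp
  then show "t = 0" using t cmp_zero_right[OF k(2)] zero_in_hom by metis
qed

text \<open>The uniqueness half of the universal property is already contained in q being epi; only
  the existence of a factorization is left.\<close>

lemma cokernelI:
  assumes f: "f \<in> Hom A B" and q: "is_epi C B Q q" and z: "q \<cdot> f = 0"
    and ex: "\<And>T t. t \<in> Hom B T \<Longrightarrow> t \<cdot> f = 0 \<Longrightarrow> \<exists>u. u \<in> Hom Q T \<and> u \<cdot> q = t"
  shows "is_cokernel C A B f Q q"
  unfolding is_cokernel_def using f epi_in_hom[OF q] z ex epi_cancel[OF q]
  by (metis (no_types, lifting))

lemma kernelI:
  assumes f: "f \<in> Hom A B" and k: "is_mono C K A k" and z: "f \<cdot> k = 0"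
    and ex: "\<And>T t. t \<in> Hom T A \<Longrightarrow> f \<cdot> t = 0 \<Longrightarrow> \<exists>u. u \<in> Hom T K \<and> k \<cdot> u = t"
  shows "is_kernel C A B f K k"
  unfolding is_kernel_def using f mono_in_hom[OF k] z ex mono_cancel[OF k]
  by (metis (no_types, lifting))

lemma cokernelE:
  assumes "is_cokernel C A B f Q q" "t \<in> Hom B T" "t \<cdot> f = 0"
  obtains u where "u \<in> Hom Q T" "u \<cdot> q = t"
  using assms unfolding is_cokernel_def by blast

lemma kernelE:
  assumes "is_kernel C A B f K k" "t \<in> Hom T A" "f \<cdot> t = 0"
  obtains u where "u \<in> Hom T K" "k \<cdot> u = t"
  using assms unfolding is_kernel_def by blast

lemma cokernel_in_hom:
  "is_cokernel C A B f Q q \<Longrightarrow> f \<in> Hom A B" "is_cokernel C A B f Q q \<Longrightarrow> q \<in> Hom B Q"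
  "is_cokernel C A B f Q q \<Longrightarrow> q \<cdot> f = 0"
  by (auto simp: is_cokernel_def)

lemma kernel_in_hom:
  "is_kernel C A B f K k \<Longrightarrow> f \<in> Hom A B" "is_kernel C A B f K k \<Longrightarrow> k \<in> Hom K A"
  "is_kernel C A B f K k \<Longrightarrow> f \<cdot> k = 0"
  by (auto simp: is_kernel_def)

lemma short_exact_in_hom:
  assumes "short_exact C A f B g D"
  shows "f \<in> Hom A B" "g \<in> Hom B D" "g \<cdot> f = 0" "is_mono C A B f" "is_epi C B D g"
  using assms kernel_in_hom cokernel_epi kernel_mono by (auto simp: short_exact_def)

end

context linear_abelian_category
begin

text \<open>By normality q is the cokernel of some g, and g factors through the kernel k. Whatever
  kills k therefore kills g and factors through q.\<close>

lemma epi_short_exact: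
  assumes q: "is_epi C B Q q" and k: "is_kernel C B Q q K k"
  shows "short_exact C K k B q Q"
  unfolding short_exact_def
proof (intro conjI k cokernelI[OF kernel_in_hom(2)[OF k] q kernel_in_hom(3)[OF k]])
  fix T t assume t: "t \<in> Hom B T" "t \<cdot> k = 0"
  obtain D g where g: "is_cokernel C D B g Q q" using epi_normal[OF q] by blast
  obtain u where u: "u \<in> Hom D K" "k \<cdot> u = g"
    using kernelE[OF k cokernel_in_hom(1)[OF g] cokernel_in_hom(3)[OF g]] by blast
  have "t \<cdot> g = 0"
    using cmp_assoc[OF u(1) kernel_in_hom(2)[OF k] t(1)] u t cmp_zero_left[OF u(1)] by simp
  then show "\<exists>u. u \<in> Hom Q T \<and> u \<cdot> q = t" using cokernelE[OF g t(1)] by metis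
qed

lemma mono_short_exact:
  assumes k: "is_mono C K B k" and q: "is_cokernel C K B k Q q"
  shows "short_exact C K k B q Q"
  unfolding short_exact_def
proof (intro conjI q kernelI[OF cokernel_in_hom(2)[OF q] k cokernel_in_hom(3)[OF q]])
  fix T t assume t: "t \<in> Hom T B" "q \<cdot> t = 0"
  obtain D g where g: "is_kernel C B D g K k" using mono_normal[OF k] by blast
  obtain u where u: "u \<in> Hom Q D" "u \<cdot> q = g"
    using cokernelE[OF q kernel_in_hom(1)[OF g] kernel_in_hom(3)[OF g]] by blast
  have "g \<cdot> t = 0"
    using cmp_assoc[OF t(1) cokernel_in_hom(2)[OF q] u(1)] u t cmp_zero_right[OF u(1)] by simp
  then show "\<exists>u. u \<in> Hom T K \<and> k \<cdot> u = t" using kernelE[OF g t(1)] by metis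
qed

text \<open>The image W is the kernel of the cokernel c. If t kills e, then f factors through the
  smaller subobject \<open>m \<cdot> k\<close> of Z, where k is the kernel of t. By normality
  \<open>m \<cdot> k\<close> is the kernel of some g; this g kills f, hence factors through c, hence
  kills m. So m factors through \<open>m \<cdot> k\<close>, which makes k split epi and forces t =
  0.\<close>

lemma image_factorization:
  assumes f: "f \<in> Hom Y Z" and c: "is_cokernel C Y Z f Q c"
  obtains W m e where "short_exact C W m Z c Q" "is_epi C Y W e" "f = m \<cdot> e"
proof -
  obtain W m where m: "is_kernel C Z Q c W m" using kernels[OF cokernel_in_hom(2)[OF c]] by blast
  have se: "short_exact C W m Z c Q" using epi_short_exact[OF cokernel_epi[OF c] m] .
  note mh = kernel_in_hom(2)[OF m]
  obtain e where e: "e \<in> Hom Y W" "m \<cdot> e = f"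
    using kernelE[OF m f cokernel_in_hom(3)[OF c]] by blast
  have "is_epi C Y W e"
  proof (rule epiI[OF e(1)])
    fix T t assume t: "t \<in> Hom W T" "t \<cdot> e = 0"
    obtain K k where k: "is_kernel C W T t K k" using kernels[OF t(1)] by blast
    note kh = kernel_in_hom(2)[OF k]
    obtain e' where e': "e' \<in> Hom Y K" "k \<cdot> e' = e" using kernelE[OF k e(1) t(2)] by blast
    have "is_mono C K Z (m \<cdot> k)" using mono_cmp[OF kernel_mono[OF k] kernel_mono[OF m]] .
    then obtain D g where g: "is_kernel C Z D g K (m \<cdot> k)" using mono_normal by blast
    note gh = kernel_in_hom(1)[OF g]
    have mk: "m \<cdot> k \<in> Hom K Z" using kh mh by (rule cmp_in_hom)
    have "(m \<cdot> k) \<cdot> e' = f" using cmp_assoc[OF e'(1) kh mh] e' e by simp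
    then have "g \<cdot> f = 0" using cmp_assoc[OF e'(1) mk gh] kernel_in_hom(3)[OF g] cmp_zero_left[OF e'(1)]
      by simp
    then obtain g' where g': "g' \<in> Hom Q D" "g' \<cdot> c = g" using cokernelE[OF c gh] by blast
    have "g \<cdot> m = 0"
      using cmp_assoc[OF mh cokernel_in_hom(2)[OF c] g'(1)] g' kernel_in_hom(3)[OF m] cmp_zero_right[OF g'(1)]
      by simp
    then obtain v where v: "v \<in> Hom W K" "(m \<cdot> k) \<cdot> v = m" using kernelE[OF g mh] by blast
    have "m \<cdot> (k \<cdot> v) = m \<cdot> ident C W" using cmp_assoc[OF v(1) kh mh] v cmp_ident_right[OF mh] by simp
    then have "k \<cdot> v = ident C W"
      using mono_cancel[OF kernel_mono[OF m] cmp_in_hom[OF v(1) kh] ident_in_hom] by blast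
    then show "t = 0"
      using cmp_assoc[OF v(1) kh t(1)] kernel_in_hom(3)[OF k] cmp_zero_left[OF v(1)] cmp_ident_right[OF t(1)]
      by simp
  qed
  then show ?thesis using that[OF se] e(2) by blast
qed

lemma zero_obj_exists: "\<exists>Z. is_zero_obj C Z"
proof -
  obtain Z inc prj where "is_direct_sum C {..<0::nat} undefined Z inc prj"
    using finite_direct_sums by blast
  then have i: "ident C Z = 0" by (simp add: is_direct_sum_def)
  have "f = 0" if "f \<in> Hom Z A" for f A
    using cmp_ident_right[OF that] cmp_zero_right[OF that] i by simp
  moreover have "f = 0" if "f \<in> Hom A Z" for f A
    using cmp_ident_left[OF that] cmp_zero_left[OF that] i by simp
  ultimately have "is_zero_obj C Z" unfolding is_zero_obj_def using zero_in_hom by blast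
  then show ?thesis by blast
qed

text \<open>This makes isomorphisms visible to anything additive on short exact sequences, both to
  dimension functions and to the relations of the Grothendieck ring.\<close>

lemma iso_short_exact:
  assumes "is_iso C A B f" "is_zero_obj C Z"
  shows "short_exact C Z 0 A f B"
proof (rule epi_short_exact[OF iso_epi[OF assms(1)]])
  have Z: "\<And>D. Hom Z D = {0}" "\<And>D. Hom D Z = {0}" using assms(2) by (auto simp: is_zero_obj_def)
  note f = inverse_mor_cmp(1)[OF assms(1)]
  have "is_mono C Z A 0" by (rule monoI) (use Z in auto)
  then show "is_kernel C A B f Z 0"
  proof (rule kernelI[OF f])
    show "f \<cdot> 0 = 0" using cmp_zero_right[OF f] .
    fix T t assume "t \<in> Hom T A" "f \<cdot> t = 0"
    then have "t = 0" using mono_eq_0[OF iso_mono[OF assms(1)]] by blast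
    then show "\<exists>u. u \<in> Hom T Z \<and> 0 \<cdot> u = t"
      using Z by (intro exI[of _ 0]) (auto intro: cmp_zero_left)
  qed
qed

end

subsection \<open>Additive dimension functions\<close>

locale additive_dimension = linear_abelian_category +
  fixes d :: "'b \<Rightarrow> real"
  assumes d_short_exact: "short_exact C A f B g D \<Longrightarrow> d B = d A + d D"
begin

lemma d_zero_obj:
  assumes "is_zero_obj C Z"
  shows "d Z = 0"
proof -
  have "Hom Z Z = {0}" using assms by (auto simp: is_zero_obj_def)
  then have "ident C Z = 0" using ident_in_hom by blast
  moreover have "is_inverse C Z Z (ident C Z) (ident C Z)"
    using ident_in_hom cmp_ident_left[OF ident_in_hom] by (auto simp: is_inverse_def)
  ultimately have "is_iso C Z Z 0" by (auto simp: is_iso_def)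
  \<comment> \<open>The sequence Z, Z, Z is short exact, so d Z = d Z + d Z.\<close>
  then show ?thesis using d_short_exact[OF iso_short_exact[OF _ assms]] by fastforce
qed

lemma d_iso: "is_iso C A B f \<Longrightarrow> d A = d B"
  using zero_obj_exists d_zero_obj d_short_exact[OF iso_short_exact] by fastforce

end

locale nonneg_dimension = additive_dimension +
  assumes d_nonneg: "0 \<le> d A"
begin

lemma d_epi_le:
  assumes "is_epi C B Q q"
  shows "d Q \<le> d B"
proof -
  obtain K k where "is_kernel C B Q q K k" using kernels[OF epi_in_hom[OF assms]] by blast
  then show ?thesis using d_short_exact[OF epi_short_exact[OF assms]] d_nonneg by fastforce
qed

text \<open>This is the dimension of the image of f. The formula by the cokernel is chosen because
  cokernels are compared through the morphisms that vanish on f, which is all that is later known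
  about a subobject.\<close>

definition rank :: "'b \<Rightarrow> 'b \<Rightarrow> 'c \<Rightarrow> real" where
  "rank Y Z f = d Z - d (SOME Q. \<exists>q. is_cokernel C Y Z f Q q)"

text \<open>The cokernel of f kills f' as well, so it is a quotient of the cokernel of f', and d
  does not grow along epis.\<close>

lemma rank_le_dominated:
  assumes f: "f \<in> Hom Y Z" and f': "f' \<in> Hom Y' Z"
    and le: "\<And>T t. t \<in> Hom Z T \<Longrightarrow> t \<cdot> f = 0 \<Longrightarrow> t \<cdot> f' = 0"
  shows "rank Y' Z f' \<le> rank Y Z f"
proof -
  define Q Q' where "Q = (SOME Q. \<exists>q. is_cokernel C Y Z f Q q)"
    and "Q' = (SOME Q. \<exists>q. is_cokernel C Y' Z f' Q q)"
  obtain q where q: "is_cokernel C Y Z f Q q"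
    unfolding Q_def using someI_ex[OF cokernels[OF f]] by blast
  obtain q' where q': "is_cokernel C Y' Z f' Q' q'"
    unfolding Q'_def using someI_ex[OF cokernels[OF f']] by blast
  note qh = cokernel_in_hom[OF q] and qh' = cokernel_in_hom[OF q']
  obtain u where u: "u \<in> Hom Q' Q" "u \<cdot> q' = q"
    using cokernelE[OF q' qh(2)] le[OF qh(2,3)] by blast
  have "is_epi C Q' Q u"
  proof (rule epiI[OF u(1)])
    fix T t assume t: "t \<in> Hom Q T" "t \<cdot> u = 0"
    then have "t \<cdot> q = 0" using cmp_assoc[OF qh'(2) u(1) t(1)] u cmp_zero_left[OF qh'(2)] by simp
    then show "t = 0" using epi_eq_0[OF cokernel_epi[OF q] t(1)] by simp
  qed
  then show ?thesis using d_epi_le unfolding rank_def Q_def[symmetric] Q'_def[symmetric] by fastforce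
qed

lemma rank_cokernel:
  assumes "is_cokernel C Y Z f Q q"
  shows "rank Y Z f = d Z - d Q"
proof -
  define Q' where "Q' = (SOME Q. \<exists>q. is_cokernel C Y Z f Q q)"
  obtain q' where q': "is_cokernel C Y Z f Q' q'"
    unfolding Q'_def using someI_ex[of "\<lambda>Q. \<exists>q. is_cokernel C Y Z f Q q"] assms by blast
  have le: "d R \<le> d R'" if r: "is_cokernel C Y Z f R r" and r': "is_cokernel C Y Z f R' r'" for R R' r r'
  proof -
    note rh = cokernel_in_hom[OF r] and rh' = cokernel_in_hom[OF r']
    obtain u where u: "u \<in> Hom R' R" "u \<cdot> r' = r" using cokernelE[OF r' rh(2,3)] by blast
    have "is_epi C R' R u"
    proof (rule epiI[OF u(1)])
      fix T t assume t: "t \<in> Hom R T" "t \<cdot> u = 0"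
      then have "t \<cdot> r = 0" using cmp_assoc[OF rh'(2) u(1) t(1)] u cmp_zero_left[OF rh'(2)] by simp
      then show "t = 0" using epi_eq_0[OF cokernel_epi[OF r] t(1)] by simp
    qed
    then show ?thesis by (rule d_epi_le)
  qed
  show ?thesis using le[OF assms q'] le[OF q' assms] unfolding rank_def Q'_def[symmetric] by simp
qed

text \<open>Since e is epi, \<open>m \<cdot> e\<close> has the same cokernel as m, and additivity
  turns its codimension into d W.\<close>

lemma rank_epi_mono:
  assumes "is_epi C Y W e" "is_mono C W Z m"
  shows "rank Y Z (m \<cdot> e) = d W"
proof -
  note eh = epi_in_hom[OF assms(1)] and mh = mono_in_hom[OF assms(2)]
  obtain Q c where c: "is_cokernel C W Z m Q c" using cokernels[OF mh] by blast
  note ch = cokernel_in_hom[OF c]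
  have "is_cokernel C Y Z (m \<cdot> e) Q c"
  proof (rule cokernelI[OF cmp_in_hom[OF eh mh] cokernel_epi[OF c]])
    show "c \<cdot> (m \<cdot> e) = 0" using cmp_assoc[OF eh mh ch(2)] ch(3) cmp_zero_left[OF eh] by simp
    fix T t assume t: "t \<in> Hom Z T" "t \<cdot> (m \<cdot> e) = 0"
    then have "(t \<cdot> m) \<cdot> e = 0" using cmp_assoc[OF eh mh t(1)] by simp
    then have "t \<cdot> m = 0" using epi_eq_0[OF assms(1) cmp_in_hom[OF mh t(1)]] by simp
    then show "\<exists>u. u \<in> Hom Q T \<and> u \<cdot> c = t" using cokernelE[OF c t(1)] by metis
  qed
  then show ?thesis using rank_cokernel d_short_exact[OF mono_short_exact[OF assms(2) c]] by simp
qed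

lemma rank_image:
  assumes f: "f \<in> Hom Y Z"
  obtains W m e where "is_mono C W Z m" "is_epi C Y W e" "f = m \<cdot> e" "rank Y Z f = d W"
proof -
  obtain Q c where c: "is_cokernel C Y Z f Q c" using cokernels[OF f] by blast
  obtain W m e where i: "short_exact C W m Z c Q" "is_epi C Y W e" "f = m \<cdot> e"
    using image_factorization[OF f c] by blast
  then show ?thesis using that short_exact_in_hom(4)[OF i(1)] rank_epi_mono by blast
qed

lemma rank_le_source: "f \<in> Hom Y Z \<Longrightarrow> rank Y Z f \<le> d Y"
  using rank_image d_epi_le by metis

lemma rank_cmp_le_left:
  assumes f: "f \<in> Hom Y P" and g: "g \<in> Hom P Z"
  shows "rank Y Z (g \<cdot> f) \<le> rank P Z g"
proof (rule rank_le_dominated[OF g cmp_in_hom[OF f g]])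
  fix T t assume t: "t \<in> Hom Z T" "t \<cdot> g = 0"
  then show "t \<cdot> (g \<cdot> f) = 0" using cmp_assoc[OF f g t(1)] cmp_zero_left[OF f] by simp
qed

lemma rank_zero: "rank Y Z 0 = 0"
proof -
  have "is_cokernel C Y Z 0 Z (ident C Z)"
  proof (rule cokernelI)
    show "is_epi C Z Z (ident C Z)" by (rule epiI[OF ident_in_hom]) (use cmp_ident_right in auto)
    show "ident C Z \<cdot> 0 = 0" using cmp_zero_right[OF ident_in_hom] .
    show "\<exists>u. u \<in> Hom Z T \<and> u \<cdot> ident C Z = t" if "t \<in> Hom Z T" for T t
      using that cmp_ident_right by blast
  qed simp
  then show ?thesis using rank_cokernel by simp
qed

text \<open>Modulo the image of k, the morphism f factors through P, so \<open>c \<cdot> f\<close>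
  has rank at most d P. Its cokernel E is a quotient of the cokernel of f, and the codimension of E
  in Z is the rank of k plus the rank of \<open>c \<cdot> f\<close>.\<close>

lemma rank_le_factor:
  assumes f: "f \<in> Hom Y Z" and c: "is_cokernel C Y' Z k Q c"
    and w: "w \<in> Hom Y P" and v: "v \<in> Hom P Q" and eq: "c \<cdot> f = v \<cdot> w"
  shows "rank Y Z f \<le> rank Y' Z k + d P"
proof -
  note ch = cokernel_in_hom(2)[OF c]
  have cf: "c \<cdot> f \<in> Hom Y Q" using f ch by (rule cmp_in_hom)
  obtain E e where e: "is_cokernel C Y Q (c \<cdot> f) E e" using cokernels[OF cf] by blast
  obtain F g where g: "is_cokernel C Y Z f F g" using cokernels[OF f] by blast
  note eh = cokernel_in_hom(2)[OF e] and gh = cokernel_in_hom(2)[OF g]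
  have "(e \<cdot> c) \<cdot> f = 0" using cmp_assoc[OF f ch eh] cokernel_in_hom(3)[OF e] by simp
  then obtain u where u: "u \<in> Hom F E" "u \<cdot> g = e \<cdot> c"
    using cokernelE[OF g cmp_in_hom[OF ch eh]] by blast
  have "is_epi C F E u"
  proof (rule epiI[OF u(1)])
    fix T t assume t: "t \<in> Hom E T" "t \<cdot> u = 0"
    have "t \<cdot> (e \<cdot> c) = 0"
      using cmp_assoc[OF gh u(1) t(1)] t u cmp_zero_left[OF gh] by simp
    then show "t = 0"
      using epi_eq_0[OF epi_cmp[OF cokernel_epi[OF c] cokernel_epi[OF e]] t(1)] by simp
  qed
  then have "d E \<le> d F" by (rule d_epi_le)
  moreover have "rank Y Q (c \<cdot> f) \<le> d P"
    using rank_cmp_le_left[OF w v] rank_le_source[OF v] eq by simp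
  ultimately show ?thesis
    using rank_cokernel[OF e] rank_cokernel[OF g] rank_cokernel[OF c] by simp
qed

end

section \<open>Exactness of the tensor product\<close>

context linear_monoidal_category
begin

lemma tmor_zero_left: "g \<in> Hom A' B' \<Longrightarrow> 0 \<otimes>\<^sub>m g = 0"
  using tmor_add_left[OF zero_in_hom zero_in_hom, of g] by simp

lemma tmor_zero_right: "g \<in> Hom A B \<Longrightarrow> g \<otimes>\<^sub>m 0 = 0"
  using tmor_add_right[OF _ zero_in_hom zero_in_hom, of g] by simp

lemma tmor_id_cmp:
  assumes "f \<in> Hom A B" "g \<in> Hom B D"
  shows "(g \<cdot> f) \<otimes>\<^sub>m ident C X = (g \<otimes>\<^sub>m ident C X) \<cdot> (f \<otimes>\<^sub>m ident C X)"
  using tmor_cmp[OF assms ident_in_hom ident_in_hom] cmp_ident_left[OF ident_in_hom] by metis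

lemma id_tmor_cmp:
  assumes "f \<in> Hom A B" "g \<in> Hom B D"
  shows "ident C X \<otimes>\<^sub>m (g \<cdot> f) = (ident C X \<otimes>\<^sub>m g) \<cdot> (ident C X \<otimes>\<^sub>m f)"
  using tmor_cmp[OF ident_in_hom ident_in_hom assms] cmp_ident_left[OF ident_in_hom] by metis

lemma tmor_split:
  assumes "f \<in> Hom A B" "g \<in> Hom A' B'"
  shows "f \<otimes>\<^sub>m g = (f \<otimes>\<^sub>m ident C B') \<cdot> (ident C A \<otimes>\<^sub>m g)"
    and "f \<otimes>\<^sub>m g = (ident C B \<otimes>\<^sub>m g) \<cdot> (f \<otimes>\<^sub>m ident C A')"
proof -
  show "f \<otimes>\<^sub>m g = (f \<otimes>\<^sub>m ident C B') \<cdot> (ident C A \<otimes>\<^sub>m g)"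
    using tmor_cmp[OF ident_in_hom assms(1) assms(2) ident_in_hom]
      cmp_ident_left[OF assms(2)] cmp_ident_right[OF assms(1)] by metis
  show "f \<otimes>\<^sub>m g = (ident C B \<otimes>\<^sub>m g) \<cdot> (f \<otimes>\<^sub>m ident C A')"
    using tmor_cmp[OF assms(1) ident_in_hom ident_in_hom assms(2)]
      cmp_ident_left[OF assms(1)] cmp_ident_right[OF assms(2)] by metis
qed

lemma id_tmor_in_hom: "f \<in> Hom A B \<Longrightarrow> ident C X \<otimes>\<^sub>m f \<in> Hom (X \<otimes>\<^sub>o A) (X \<otimes>\<^sub>o B)"
  and tmor_id_in_hom: "f \<in> Hom A B \<Longrightarrow> f \<otimes>\<^sub>m ident C X \<in> Hom (A \<otimes>\<^sub>o X) (B \<otimes>\<^sub>o X)"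
  by (auto intro: tmor_in_hom ident_in_hom)

lemma tmor_inverse:
  assumes "is_inverse C A B f g" "is_inverse C A' B' f' g'"
  shows "is_inverse C (A \<otimes>\<^sub>o A') (B \<otimes>\<^sub>o B') (f \<otimes>\<^sub>m f') (g \<otimes>\<^sub>m g')"
proof -
  have h: "f \<in> Hom A B" "g \<in> Hom B A" "g \<cdot> f = ident C A" "f \<cdot> g = ident C B"
    "f' \<in> Hom A' B'" "g' \<in> Hom B' A'" "g' \<cdot> f' = ident C A'" "f' \<cdot> g' = ident C B'"
    using assms by (auto simp: is_inverse_def)
  show ?thesis unfolding is_inverse_def
    using tmor_cmp[OF h(1,2,5,6)] tmor_cmp[OF h(2,1,6,5)] h tmor_in_hom tmor_ident by simp
qed

lemma ident_inverse: "is_inverse C A A (ident C A) (ident C A)"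
  using ident_in_hom cmp_ident_left[OF ident_in_hom] by (auto simp: is_inverse_def)

abbreviation ass_inv :: "'b \<Rightarrow> 'b \<Rightarrow> 'b \<Rightarrow> 'c" where
  "ass_inv X Y Z \<equiv> inverse_mor C (X \<otimes>\<^sub>o Y \<otimes>\<^sub>o Z) (X \<otimes>\<^sub>o (Y \<otimes>\<^sub>o Z)) (associator C X Y Z)"

abbreviation run_inv :: "'b \<Rightarrow> 'c" where
  "run_inv X \<equiv> inverse_mor C (X \<otimes>\<^sub>o unit_obj C) X (runitor C X)"

abbreviation lun_inv :: "'b \<Rightarrow> 'c" where
  "lun_inv X \<equiv> inverse_mor C (unit_obj C \<otimes>\<^sub>o X) X (lunitor C X)"

lemmas ass_cmp = inverse_mor_cmp[OF associator_iso]
lemmas run_cmp = inverse_mor_cmp[OF runitor_iso]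
lemmas lun_cmp = inverse_mor_cmp[OF lunitor_iso]

lemma cmp_eq_move_left:
  assumes "is_inverse C A B f g" "h \<in> Hom T A" "f \<cdot> h = k"
  shows "h = g \<cdot> k"
proof -
  have f: "f \<in> Hom A B" "g \<in> Hom B A" "g \<cdot> f = ident C A" using assms(1) by (auto simp: is_inverse_def)
  show ?thesis using cmp_assoc[OF assms(2) f(1,2)] f(3) cmp_ident_left[OF assms(2)] assms(3) by simp
qed

lemma cmp_eq_move_right:
  assumes "is_inverse C A B f g" "h \<in> Hom B T" "h \<cdot> f = k"
  shows "h = k \<cdot> g"
proof -
  have f: "f \<in> Hom A B" "g \<in> Hom B A" "f \<cdot> g = ident C B" using assms(1) by (auto simp: is_inverse_def)
  show ?thesis using cmp_assoc[OF f(2) f(1) assms(2)] f(3) cmp_ident_right[OF assms(2)] assms(3) by simp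
qed

text \<open>Kelly's lemma: the compatibility of \<open>r\<close> with a product follows from pentagon and triangle.\<close>

lemma runitor_tensor: "(ident C X \<otimes>\<^sub>m runitor C Y) \<cdot> associator C X Y (unit_obj C) = runitor C (X \<otimes>\<^sub>o Y)"
proof -
  let ?I = "unit_obj C" and ?id = "ident C" and ?a = "associator C" and ?r = "runitor C" and ?l = "lunitor C"
  let ?L = "(?id X \<otimes>\<^sub>m ?r Y) \<cdot> ?a X Y ?I" and ?R = "?r (X \<otimes>\<^sub>o Y)"
  note rY = run_cmp(1)[of Y] and aXY = ass_cmp(1)[of X Y ?I]
  note idr = id_tmor_in_hom[OF rY, of X]
  have L: "?L \<in> Hom ((X \<otimes>\<^sub>o Y) \<otimes>\<^sub>o ?I) (X \<otimes>\<^sub>o Y)" using aXY idr by (rule cmp_in_hom)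
  have R: "?R \<in> Hom ((X \<otimes>\<^sub>o Y) \<otimes>\<^sub>o ?I) (X \<otimes>\<^sub>o Y)" by (rule run_cmp)
  note lI = lun_cmp(1)[of ?I]
  have nat1: "?a X Y ?I \<cdot> ((?id X \<otimes>\<^sub>m ?r Y) \<otimes>\<^sub>m ?id ?I) = (?id X \<otimes>\<^sub>m (?r Y \<otimes>\<^sub>m ?id ?I)) \<cdot> ?a X (Y \<otimes>\<^sub>o ?I) ?I"
    by (rule associator_natural[OF ident_in_hom rY ident_in_hom])
  have tri: "?id X \<otimes>\<^sub>m (?r Y \<otimes>\<^sub>m ?id ?I) = (?id X \<otimes>\<^sub>m (?id Y \<otimes>\<^sub>m ?l ?I)) \<cdot> (?id X \<otimes>\<^sub>m ?a Y ?I ?I)"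
    unfolding triangle[symmetric] by (rule id_tmor_cmp[OF ass_cmp(1) id_tmor_in_hom[OF lI]])
  have nat2: "?a X Y ?I \<cdot> (?id (X \<otimes>\<^sub>o Y) \<otimes>\<^sub>m ?l ?I) = (?id X \<otimes>\<^sub>m (?id Y \<otimes>\<^sub>m ?l ?I)) \<cdot> ?a X Y (?I \<otimes>\<^sub>o ?I)"
    using associator_natural[OF ident_in_hom[of X] ident_in_hom[of Y] lI] tmor_ident by simp
  define p where "p = ?id X \<otimes>\<^sub>m (?id Y \<otimes>\<^sub>m ?l ?I)"
  have p: "p \<in> Hom (X \<otimes>\<^sub>o (Y \<otimes>\<^sub>o (?I \<otimes>\<^sub>o ?I))) (X \<otimes>\<^sub>o (Y \<otimes>\<^sub>o ?I))"
    unfolding p_def by (intro id_tmor_in_hom lI)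
  define b where "b = ?id X \<otimes>\<^sub>m ?a Y ?I ?I"
  have b: "b \<in> Hom (X \<otimes>\<^sub>o (Y \<otimes>\<^sub>o ?I \<otimes>\<^sub>o ?I)) (X \<otimes>\<^sub>o (Y \<otimes>\<^sub>o (?I \<otimes>\<^sub>o ?I)))"
    unfolding b_def by (intro id_tmor_in_hom ass_cmp)
  define e where "e = ?a X Y ?I \<otimes>\<^sub>m ?id ?I"
  have e: "e \<in> Hom (X \<otimes>\<^sub>o Y \<otimes>\<^sub>o ?I \<otimes>\<^sub>o ?I) (X \<otimes>\<^sub>o (Y \<otimes>\<^sub>o ?I) \<otimes>\<^sub>o ?I)"
    unfolding e_def by (intro tmor_id_in_hom ass_cmp)
  note a1 = ass_cmp(1)[of X "Y \<otimes>\<^sub>o ?I" ?I] and a2 = ass_cmp(1)[of X Y "?I \<otimes>\<^sub>o ?I"]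
    and a3 = ass_cmp(1)[of "X \<otimes>\<^sub>o Y" ?I ?I]
  have idr1: "(?id X \<otimes>\<^sub>m ?r Y) \<otimes>\<^sub>m ?id ?I \<in> Hom (X \<otimes>\<^sub>o (Y \<otimes>\<^sub>o ?I) \<otimes>\<^sub>o ?I) (X \<otimes>\<^sub>o Y \<otimes>\<^sub>o ?I)"
    using idr by (rule tmor_id_in_hom)
  \<comment> \<open>Both sides of the claim are compared after tensoring with the unit, where
    pentagon and triangle apply. Naturality of the right unitor strips the extra unit off at the
    end.\<close>
  have "?a X Y ?I \<cdot> (?L \<otimes>\<^sub>m ?id ?I) = (?a X Y ?I \<cdot> ((?id X \<otimes>\<^sub>m ?r Y) \<otimes>\<^sub>m ?id ?I)) \<cdot> e"
    unfolding tmor_id_cmp[OF aXY idr] e_def[symmetric] using cmp_assoc[OF e idr1 aXY] by simp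
  also have "\<dots> = ((p \<cdot> b) \<cdot> ?a X (Y \<otimes>\<^sub>o ?I) ?I) \<cdot> e"
    unfolding nat1 tri p_def b_def ..
  also have "\<dots> = p \<cdot> (b \<cdot> (?a X (Y \<otimes>\<^sub>o ?I) ?I \<cdot> e))"
    using cmp_assoc[OF a1 b p] cmp_assoc[OF e a1 b] cmp_assoc[OF e cmp_in_hom[OF a1 b] p] by simp
  also have "\<dots> = p \<cdot> (?a X Y (?I \<otimes>\<^sub>o ?I) \<cdot> ?a (X \<otimes>\<^sub>o Y) ?I ?I)"
    unfolding b_def e_def pentagon ..
  also have "\<dots> = (?a X Y ?I \<cdot> (?id (X \<otimes>\<^sub>o Y) \<otimes>\<^sub>m ?l ?I)) \<cdot> ?a (X \<otimes>\<^sub>o Y) ?I ?I"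
    unfolding nat2 p_def[symmetric] using cmp_assoc[OF a3 a2 p] by simp
  also have "\<dots> = ?a X Y ?I \<cdot> (?R \<otimes>\<^sub>m ?id ?I)"
    using cmp_assoc[OF a3 id_tmor_in_hom[OF lI] aXY] triangle by simp
  finally have "?L \<otimes>\<^sub>m ?id ?I = ?R \<otimes>\<^sub>m ?id ?I"
    using mono_cancel[OF iso_mono[OF associator_iso] tmor_id_in_hom[OF L] tmor_id_in_hom[OF R]] by blast
  then have "?L \<cdot> ?r (X \<otimes>\<^sub>o Y \<otimes>\<^sub>o ?I) = ?R \<cdot> ?r (X \<otimes>\<^sub>o Y \<otimes>\<^sub>o ?I)"
    using runitor_natural[OF L] runitor_natural[OF R] by simp
  then show ?thesis using epi_cancel[OF iso_epi[OF runitor_iso] L R] by blast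
qed

lemma cmp_assoc3:
  assumes "x \<in> Hom A B" "f \<in> Hom B D" "g \<in> Hom D E" "h \<in> Hom E F"
  shows "(h \<cdot> g \<cdot> f) \<cdot> x = h \<cdot> g \<cdot> f \<cdot> x"
proof -
  have "(h \<cdot> (g \<cdot> f)) \<cdot> x = h \<cdot> ((g \<cdot> f) \<cdot> x)"
    by (rule cmp_assoc[OF assms(1) cmp_in_hom[OF assms(2,3)] assms(4)])
  then show ?thesis using cmp_assoc[OF assms(1-3)] by simp
qed

lemma ass_inv_natural:
  assumes f: "f \<in> Hom X X'" and g: "g \<in> Hom Y Y'" and h: "h \<in> Hom Z Z'"
  shows "((f \<otimes>\<^sub>m g) \<otimes>\<^sub>m h) \<cdot> ass_inv X Y Z = ass_inv X' Y' Z' \<cdot> (f \<otimes>\<^sub>m (g \<otimes>\<^sub>m h))"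
proof -
  note t1 = tmor_in_hom[OF tmor_in_hom[OF f g] h] and t2 = tmor_in_hom[OF f tmor_in_hom[OF g h]]
  note a = ass_cmp[of X Y Z] and a' = ass_cmp[of X' Y' Z']
  have "associator C X' Y' Z' \<cdot> (((f \<otimes>\<^sub>m g) \<otimes>\<^sub>m h) \<cdot> ass_inv X Y Z) = f \<otimes>\<^sub>m (g \<otimes>\<^sub>m h)"
    using cmp_assoc[OF a(2) t1 a'(1)] associator_natural[OF f g h] cmp_assoc[OF a(2) a(1) t2] a(4)
      cmp_ident_right[OF t2] by simp
  then show ?thesis
    using cmp_eq_move_left[OF inverse_mor[OF associator_iso] cmp_in_hom[OF a(2) t1]] by blast
qed

text \<open>Up to associators and unitors, these two definitions are Z \<rightarrow> ZXY and TYX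
  \<rightarrow> T, the unit and the counit of the adjunction in which tensoring with X on the right
  is left adjoint to tensoring with Y.\<close>

definition dual_unit :: "'b \<Rightarrow> 'b \<Rightarrow> 'c \<Rightarrow> 'b \<Rightarrow> 'c" where
  "dual_unit X Y coev Z = ass_inv Z X Y \<cdot> (ident C Z \<otimes>\<^sub>m coev) \<cdot> run_inv Z"

definition dual_counit :: "'b \<Rightarrow> 'b \<Rightarrow> 'c \<Rightarrow> 'b \<Rightarrow> 'c" where
  "dual_counit X Y ev T = runitor C T \<cdot> (ident C T \<otimes>\<^sub>m ev) \<cdot> associator C T Y X"

context
  fixes X Y ev coev
  assumes dual: "is_left_dual C X Y ev coev"
begin

lemma ev_in_hom: "ev \<in> Hom (Y \<otimes>\<^sub>o X) (unit_obj C)"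
  and coev_in_hom: "coev \<in> Hom (unit_obj C) (X \<otimes>\<^sub>o Y)"
  using dual by (auto simp: is_left_dual_def)

lemma dual_unit_in_hom: "dual_unit X Y coev Z \<in> Hom Z (Z \<otimes>\<^sub>o X \<otimes>\<^sub>o Y)"
  unfolding dual_unit_def
  by (rule cmp_in_hom[OF cmp_in_hom[OF run_cmp(2) id_tmor_in_hom[OF coev_in_hom]] ass_cmp(2)])

lemma dual_counit_in_hom: "dual_counit X Y ev T \<in> Hom (T \<otimes>\<^sub>o Y \<otimes>\<^sub>o X) T"
  unfolding dual_counit_def
  by (rule cmp_in_hom[OF cmp_in_hom[OF ass_cmp(1) id_tmor_in_hom[OF ev_in_hom]] run_cmp(1)])

lemma dual_unit_natural:
  assumes f: "f \<in> Hom Z Z'"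
  shows "dual_unit X Y coev Z' \<cdot> f = ((f \<otimes>\<^sub>m ident C X) \<otimes>\<^sub>m ident C Y) \<cdot> dual_unit X Y coev Z"
proof -
  let ?I = "unit_obj C"
  note r = run_cmp[of Z] and r' = run_cmp[of Z'] and a = ass_cmp[of Z X Y] and a' = ass_cmp[of Z' X Y]
  note c = coev_in_hom
  note zc = id_tmor_in_hom[OF c, of Z] and zc' = id_tmor_in_hom[OF c, of Z']
  note fI = tmor_id_in_hom[OF f, of ?I] and fXY = tmor_id_in_hom[OF f, of "X \<otimes>\<^sub>o Y"]
  note fX_Y = tmor_id_in_hom[OF tmor_id_in_hom[OF f, of X], of Y]
  have "runitor C Z' \<cdot> ((f \<otimes>\<^sub>m ident C ?I) \<cdot> run_inv Z) = f"
    using cmp_assoc[OF r(2) fI r'(1)] runitor_natural[OF f] cmp_assoc[OF r(2) r(1) f] r(4)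
      cmp_ident_right[OF f] by simp
  then have 1: "run_inv Z' \<cdot> f = (f \<otimes>\<^sub>m ident C ?I) \<cdot> run_inv Z"
    using cmp_eq_move_left[OF inverse_mor[OF runitor_iso] cmp_in_hom[OF r(2) fI]] by simp
  have 2: "(ident C Z' \<otimes>\<^sub>m coev) \<cdot> (f \<otimes>\<^sub>m ident C ?I) = (f \<otimes>\<^sub>m ident C (X \<otimes>\<^sub>o Y)) \<cdot> (ident C Z \<otimes>\<^sub>m coev)"
    using tmor_split[OF f c] by simp
  have 3: "ass_inv Z' X Y \<cdot> (f \<otimes>\<^sub>m ident C (X \<otimes>\<^sub>o Y)) = ((f \<otimes>\<^sub>m ident C X) \<otimes>\<^sub>m ident C Y) \<cdot> ass_inv Z X Y"
    using ass_inv_natural[OF f ident_in_hom ident_in_hom] tmor_ident by simp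
  have "dual_unit X Y coev Z' \<cdot> f = ass_inv Z' X Y \<cdot> (ident C Z' \<otimes>\<^sub>m coev) \<cdot> (run_inv Z' \<cdot> f)"
    unfolding dual_unit_def by (rule cmp_assoc3[OF f r'(2) zc' a'(2)])
  also have "\<dots> = ass_inv Z' X Y \<cdot> (((ident C Z' \<otimes>\<^sub>m coev) \<cdot> (f \<otimes>\<^sub>m ident C ?I)) \<cdot> run_inv Z)"
    unfolding 1 using cmp_assoc[OF r(2) fI zc'] by simp
  also have "\<dots> = (ass_inv Z' X Y \<cdot> (f \<otimes>\<^sub>m ident C (X \<otimes>\<^sub>o Y))) \<cdot> ((ident C Z \<otimes>\<^sub>m coev) \<cdot> run_inv Z)"
    unfolding 2 using cmp_assoc[OF r(2) zc fXY] cmp_assoc[OF cmp_in_hom[OF r(2) zc] fXY a'(2)] by simp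
  also have "\<dots> = ((f \<otimes>\<^sub>m ident C X) \<otimes>\<^sub>m ident C Y) \<cdot> dual_unit X Y coev Z"
    unfolding 3 dual_unit_def using cmp_assoc[OF cmp_in_hom[OF r(2) zc] a(2) fX_Y] by simp
  finally show ?thesis .
qed

lemma dual_counit_natural:
  assumes f: "f \<in> Hom T T'"
  shows "f \<cdot> dual_counit X Y ev T = dual_counit X Y ev T' \<cdot> ((f \<otimes>\<^sub>m ident C Y) \<otimes>\<^sub>m ident C X)"
proof -
  let ?I = "unit_obj C"
  note r = run_cmp[of T] and r' = run_cmp[of T'] and a = ass_cmp[of T Y X] and a' = ass_cmp[of T' Y X]
  note e = ev_in_hom
  note te = id_tmor_in_hom[OF e, of T] and te' = id_tmor_in_hom[OF e, of T']
  note fI = tmor_id_in_hom[OF f, of ?I] and fYX = tmor_id_in_hom[OF f, of "Y \<otimes>\<^sub>o X"]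
  note fY_X = tmor_id_in_hom[OF tmor_id_in_hom[OF f, of Y], of X]
  have 2: "(f \<otimes>\<^sub>m ident C ?I) \<cdot> (ident C T \<otimes>\<^sub>m ev) = (ident C T' \<otimes>\<^sub>m ev) \<cdot> (f \<otimes>\<^sub>m ident C (Y \<otimes>\<^sub>o X))"
    using tmor_split[OF f e] by simp
  have 3: "(f \<otimes>\<^sub>m ident C (Y \<otimes>\<^sub>o X)) \<cdot> associator C T Y X = associator C T' Y X \<cdot> ((f \<otimes>\<^sub>m ident C Y) \<otimes>\<^sub>m ident C X)"
    using associator_natural[OF f ident_in_hom ident_in_hom] tmor_ident by simp
  note ta = cmp_in_hom[OF a(1) te]
  have "f \<cdot> dual_counit X Y ev T = (runitor C T' \<cdot> (f \<otimes>\<^sub>m ident C ?I)) \<cdot> ((ident C T \<otimes>\<^sub>m ev) \<cdot> associator C T Y X)"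
    unfolding dual_counit_def runitor_natural[OF f] using cmp_assoc[OF ta r(1) f] by simp
  also have "\<dots> = runitor C T' \<cdot> (((f \<otimes>\<^sub>m ident C ?I) \<cdot> (ident C T \<otimes>\<^sub>m ev)) \<cdot> associator C T Y X)"
    using cmp_assoc[OF ta fI r'(1)] cmp_assoc[OF a(1) te fI] by simp
  also have "\<dots> = runitor C T' \<cdot> ((ident C T' \<otimes>\<^sub>m ev) \<cdot> (associator C T' Y X \<cdot> ((f \<otimes>\<^sub>m ident C Y) \<otimes>\<^sub>m ident C X)))"
    unfolding 2 using cmp_assoc[OF a(1) fYX te'] 3 by simp
  also have "\<dots> = dual_counit X Y ev T' \<cdot> ((f \<otimes>\<^sub>m ident C Y) \<otimes>\<^sub>m ident C X)"
    unfolding dual_counit_def using cmp_assoc3[OF fY_X a'(1) te' r'(1)] by simp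
  finally show ?thesis .
qed

text \<open>Once the associators are out of the way, the composite is Z tensored with the first
  zigzag identity of the dual pair. \<open>A\<close> is the pentagon, \<open>B\<close> and
  \<open>D\<close> are naturality of the associator along coev and ev, \<open>Cc\<close> is the
  triangle, and \<open>E\<close> is \<open>runitor_tensor\<close>.\<close>

lemma dual_triangle_left:
  "dual_counit X Y ev (Z \<otimes>\<^sub>o X) \<cdot> (dual_unit X Y coev Z \<otimes>\<^sub>m ident C X) = ident C (Z \<otimes>\<^sub>o X)"
proof -
  let ?I = "unit_obj C" and ?id = "ident C"
  define r where "r = runitor C (Z \<otimes>\<^sub>o X)"
  define p where "p = ?id (Z \<otimes>\<^sub>o X) \<otimes>\<^sub>m ev"
  define \<alpha> where "\<alpha> = associator C (Z \<otimes>\<^sub>o X) Y X"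
  define \<beta> where "\<beta> = ass_inv Z X Y \<otimes>\<^sub>m ?id X"
  define \<gamma> where "\<gamma> = (?id Z \<otimes>\<^sub>m coev) \<otimes>\<^sub>m ?id X"
  define \<delta> where "\<delta> = run_inv Z \<otimes>\<^sub>m ?id X"
  define q where "q = ass_inv Z X (Y \<otimes>\<^sub>o X)"
  define m where "m = ?id Z \<otimes>\<^sub>m associator C X Y X"
  define \<alpha>' where "\<alpha>' = associator C Z (X \<otimes>\<^sub>o Y) X"
  define \<gamma>' where "\<gamma>' = ?id Z \<otimes>\<^sub>m (coev \<otimes>\<^sub>m ?id X)"
  define \<alpha>'' where "\<alpha>'' = associator C Z ?I X"
  define l where "l = ?id Z \<otimes>\<^sub>m lun_inv X"
  define q' where "q' = ass_inv Z X ?I"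
  define p' where "p' = ?id Z \<otimes>\<^sub>m (?id X \<otimes>\<^sub>m ev)"
  define \<rho> where "\<rho> = ?id Z \<otimes>\<^sub>m runitor C X"
  note defs = r_def p_def \<alpha>_def \<beta>_def \<gamma>_def \<delta>_def q_def m_def \<alpha>'_def \<gamma>'_def \<alpha>''_def l_def q'_def p'_def \<rho>_def
  note e = ev_in_hom and c = coev_in_hom
  have r: "r \<in> Hom (Z \<otimes>\<^sub>o X \<otimes>\<^sub>o ?I) (Z \<otimes>\<^sub>o X)"
    and p: "p \<in> Hom (Z \<otimes>\<^sub>o X \<otimes>\<^sub>o (Y \<otimes>\<^sub>o X)) (Z \<otimes>\<^sub>o X \<otimes>\<^sub>o ?I)"
    and \<alpha>: "\<alpha> \<in> Hom (Z \<otimes>\<^sub>o X \<otimes>\<^sub>o Y \<otimes>\<^sub>o X) (Z \<otimes>\<^sub>o X \<otimes>\<^sub>o (Y \<otimes>\<^sub>o X))"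
    and \<beta>: "\<beta> \<in> Hom (Z \<otimes>\<^sub>o (X \<otimes>\<^sub>o Y) \<otimes>\<^sub>o X) (Z \<otimes>\<^sub>o X \<otimes>\<^sub>o Y \<otimes>\<^sub>o X)"
    and \<gamma>: "\<gamma> \<in> Hom (Z \<otimes>\<^sub>o ?I \<otimes>\<^sub>o X) (Z \<otimes>\<^sub>o (X \<otimes>\<^sub>o Y) \<otimes>\<^sub>o X)"
    and \<delta>: "\<delta> \<in> Hom (Z \<otimes>\<^sub>o X) (Z \<otimes>\<^sub>o ?I \<otimes>\<^sub>o X)"
    and q: "q \<in> Hom (Z \<otimes>\<^sub>o (X \<otimes>\<^sub>o (Y \<otimes>\<^sub>o X))) (Z \<otimes>\<^sub>o X \<otimes>\<^sub>o (Y \<otimes>\<^sub>o X))"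
    and m: "m \<in> Hom (Z \<otimes>\<^sub>o (X \<otimes>\<^sub>o Y \<otimes>\<^sub>o X)) (Z \<otimes>\<^sub>o (X \<otimes>\<^sub>o (Y \<otimes>\<^sub>o X)))"
    and \<alpha>': "\<alpha>' \<in> Hom (Z \<otimes>\<^sub>o (X \<otimes>\<^sub>o Y) \<otimes>\<^sub>o X) (Z \<otimes>\<^sub>o (X \<otimes>\<^sub>o Y \<otimes>\<^sub>o X))"
    and \<gamma>': "\<gamma>' \<in> Hom (Z \<otimes>\<^sub>o (?I \<otimes>\<^sub>o X)) (Z \<otimes>\<^sub>o (X \<otimes>\<^sub>o Y \<otimes>\<^sub>o X))"
    and \<alpha>'': "\<alpha>'' \<in> Hom (Z \<otimes>\<^sub>o ?I \<otimes>\<^sub>o X) (Z \<otimes>\<^sub>o (?I \<otimes>\<^sub>o X))"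
    and l: "l \<in> Hom (Z \<otimes>\<^sub>o X) (Z \<otimes>\<^sub>o (?I \<otimes>\<^sub>o X))"
    and q': "q' \<in> Hom (Z \<otimes>\<^sub>o (X \<otimes>\<^sub>o ?I)) (Z \<otimes>\<^sub>o X \<otimes>\<^sub>o ?I)"
    and p': "p' \<in> Hom (Z \<otimes>\<^sub>o (X \<otimes>\<^sub>o (Y \<otimes>\<^sub>o X))) (Z \<otimes>\<^sub>o (X \<otimes>\<^sub>o ?I))"
    and \<rho>: "\<rho> \<in> Hom (Z \<otimes>\<^sub>o (X \<otimes>\<^sub>o ?I)) (Z \<otimes>\<^sub>o X)"
    unfolding defs
    by (intro id_tmor_in_hom tmor_id_in_hom e c ass_cmp(1,2) run_cmp(1,2) lun_cmp(1,2))+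
  have bi: "is_inverse C (Z \<otimes>\<^sub>o X \<otimes>\<^sub>o Y \<otimes>\<^sub>o X) (Z \<otimes>\<^sub>o (X \<otimes>\<^sub>o Y) \<otimes>\<^sub>o X) (associator C Z X Y \<otimes>\<^sub>m ?id X) \<beta>"
    unfolding \<beta>_def by (rule tmor_inverse[OF inverse_mor[OF associator_iso] ident_inverse])
  let ?b = "associator C Z X Y \<otimes>\<^sub>m ?id X"
  have b: "?b \<in> Hom (Z \<otimes>\<^sub>o X \<otimes>\<^sub>o Y \<otimes>\<^sub>o X) (Z \<otimes>\<^sub>o (X \<otimes>\<^sub>o Y) \<otimes>\<^sub>o X)" by (intro tmor_id_in_hom ass_cmp)
  have pent: "associator C Z X (Y \<otimes>\<^sub>o X) \<cdot> \<alpha> = (m \<cdot> \<alpha>') \<cdot> ?b"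
    using pentagon[of Z X Y X] cmp_assoc[OF b \<alpha>' m] unfolding defs by simp
  note ma = cmp_in_hom[OF \<alpha>' m]
  have "\<alpha> = q \<cdot> ((m \<cdot> \<alpha>') \<cdot> ?b)"
    unfolding q_def by (rule cmp_eq_move_left[OF inverse_mor[OF associator_iso] \<alpha> pent])
  then have "(q \<cdot> (m \<cdot> \<alpha>')) \<cdot> ?b = \<alpha>" using cmp_assoc[OF b ma q] by simp
  then have A: "\<alpha> \<cdot> \<beta> = q \<cdot> (m \<cdot> \<alpha>')"
    using cmp_eq_move_right[OF bi cmp_in_hom[OF ma q]] by simp
  have B: "\<alpha>' \<cdot> \<gamma> = \<gamma>' \<cdot> \<alpha>''"
    unfolding defs by (rule associator_natural[OF ident_in_hom c ident_in_hom])
  have ri: "is_inverse C (Z \<otimes>\<^sub>o ?I \<otimes>\<^sub>o X) (Z \<otimes>\<^sub>o X) (runitor C Z \<otimes>\<^sub>m ?id X) \<delta>"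
    unfolding \<delta>_def by (rule tmor_inverse[OF inverse_mor[OF runitor_iso] ident_inverse])
  have li: "is_inverse C (Z \<otimes>\<^sub>o (?I \<otimes>\<^sub>o X)) (Z \<otimes>\<^sub>o X) (?id Z \<otimes>\<^sub>m lunitor C X) l"
    unfolding l_def by (rule tmor_inverse[OF ident_inverse inverse_mor[OF lunitor_iso]])
  have "(?id Z \<otimes>\<^sub>m lunitor C X) \<cdot> (\<alpha>'' \<cdot> \<delta>) = ident C (Z \<otimes>\<^sub>o X)"
    using cmp_assoc[OF \<delta> \<alpha>'' id_tmor_in_hom[OF lun_cmp(1)]] triangle[of Z X] ri
    unfolding \<alpha>''_def is_inverse_def by simp
  then have Cc: "\<alpha>'' \<cdot> \<delta> = l"
    using cmp_eq_move_left[OF li cmp_in_hom[OF \<delta> \<alpha>'']] cmp_ident_right[OF l] by simp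
  have D: "p \<cdot> q = q' \<cdot> p'"
    unfolding defs using ass_inv_natural[OF ident_in_hom ident_in_hom e] tmor_ident by simp
  have E: "r \<cdot> q' = \<rho>"
    unfolding defs
    using cmp_eq_move_right[OF inverse_mor[OF associator_iso] id_tmor_in_hom[OF run_cmp(1)] runitor_tensor]
    by simp
  note gd = cmp_in_hom[OF \<delta> \<gamma>] and gl = cmp_in_hom[OF l \<gamma>']
  have "dual_counit X Y ev (Z \<otimes>\<^sub>o X) = r \<cdot> (p \<cdot> \<alpha>)" unfolding dual_counit_def defs ..
  moreover have "dual_unit X Y coev Z \<otimes>\<^sub>m ident C X = \<beta> \<cdot> (\<gamma> \<cdot> \<delta>)"
    unfolding dual_unit_def defs
    using tmor_id_cmp[OF cmp_in_hom[OF run_cmp(2) id_tmor_in_hom[OF c]] ass_cmp(2)]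
      tmor_id_cmp[OF run_cmp(2) id_tmor_in_hom[OF c]] by simp
  moreover have "\<alpha> \<cdot> (\<beta> \<cdot> (\<gamma> \<cdot> \<delta>)) = q \<cdot> (m \<cdot> (\<gamma>' \<cdot> l))"
  proof -
    have "\<alpha> \<cdot> (\<beta> \<cdot> (\<gamma> \<cdot> \<delta>)) = (q \<cdot> (m \<cdot> \<alpha>')) \<cdot> (\<gamma> \<cdot> \<delta>)"
      using cmp_assoc[OF gd \<beta> \<alpha>] A by simp
    also have "\<dots> = q \<cdot> (m \<cdot> (\<alpha>' \<cdot> (\<gamma> \<cdot> \<delta>)))" by (rule cmp_assoc3[OF gd \<alpha>' m q])
    also have "\<alpha>' \<cdot> (\<gamma> \<cdot> \<delta>) = \<gamma>' \<cdot> l"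
      using cmp_assoc[OF \<delta> \<gamma> \<alpha>'] cmp_assoc[OF \<delta> \<alpha>'' \<gamma>'] B Cc by simp
    finally show ?thesis .
  qed
  moreover note bgd = cmp_in_hom[OF gd \<beta>] and mgl = cmp_in_hom[OF gl m]
  ultimately have "dual_counit X Y ev (Z \<otimes>\<^sub>o X) \<cdot> (dual_unit X Y coev Z \<otimes>\<^sub>m ident C X)
      = r \<cdot> (p \<cdot> (q \<cdot> (m \<cdot> (\<gamma>' \<cdot> l))))"
    using cmp_assoc3[OF bgd \<alpha> p r] by simp
  also have "\<dots> = r \<cdot> (q' \<cdot> (p' \<cdot> (m \<cdot> (\<gamma>' \<cdot> l))))"
    using cmp_assoc[OF mgl q p] cmp_assoc[OF mgl p' q'] D by simp
  also have "\<dots> = \<rho> \<cdot> (p' \<cdot> (m \<cdot> (\<gamma>' \<cdot> l)))"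
    using cmp_assoc[OF cmp_in_hom[OF mgl p'] q' r] E by simp
  also have "\<dots> = ?id Z \<otimes>\<^sub>m (runitor C X \<cdot> ((?id X \<otimes>\<^sub>m ev) \<cdot> (associator C X Y X \<cdot> ((coev \<otimes>\<^sub>m ?id X) \<cdot> lun_inv X))))"
  proof -
    note t1 = lun_cmp(2)[of X] and t2 = tmor_id_in_hom[OF c, of X] and t3 = ass_cmp(1)[of X Y X]
      and t4 = id_tmor_in_hom[OF e, of X] and t5 = run_cmp(1)[of X]
    note s2 = cmp_in_hom[OF t1 t2]
    note s3 = cmp_in_hom[OF s2 t3]
    note s4 = cmp_in_hom[OF s3 t4]
    show ?thesis unfolding defs
      using id_tmor_cmp[OF t1 t2] id_tmor_cmp[OF s2 t3] id_tmor_cmp[OF s3 t4] id_tmor_cmp[OF s4 t5] by simp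
  qed
  also have "runitor C X \<cdot> ((?id X \<otimes>\<^sub>m ev) \<cdot> (associator C X Y X \<cdot> ((coev \<otimes>\<^sub>m ?id X) \<cdot> lun_inv X))) = ?id X"
  proof -
    note t1 = lun_cmp(2)[of X] and t2 = tmor_id_in_hom[OF c, of X] and t3 = ass_cmp(1)[of X Y X]
      and t4 = id_tmor_in_hom[OF e, of X] and t5 = run_cmp(1)[of X]
    have "lunitor C X \<cdot> lun_inv X = (runitor C X \<cdot> (?id X \<otimes>\<^sub>m ev) \<cdot> associator C X Y X \<cdot> (coev \<otimes>\<^sub>m ?id X)) \<cdot> lun_inv X"
      using dual by (simp add: is_left_dual_def)
    also have "\<dots> = runitor C X \<cdot> (?id X \<otimes>\<^sub>m ev) \<cdot> associator C X Y X \<cdot> (coev \<otimes>\<^sub>m ?id X) \<cdot> lun_inv X"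
      using cmp_assoc3[OF cmp_in_hom[OF t1 t2] t3 t4 t5] cmp_assoc3[OF t2 t3 t4 t5]
        cmp_assoc[OF t1 t2 cmp_in_hom[OF cmp_in_hom[OF t3 t4] t5]] by simp
    finally show ?thesis using lun_cmp(4) by simp
  qed
  finally show ?thesis using tmor_ident by simp
qed

text \<open>The same computation ends in the second zigzag identity. Now \<open>Cc\<close> comes
  from \<open>runitor_tensor\<close> and \<open>E\<close> from the triangle.\<close>

lemma dual_triangle_right:
  "(dual_counit X Y ev T \<otimes>\<^sub>m ident C Y) \<cdot> dual_unit X Y coev (T \<otimes>\<^sub>o Y) = ident C (T \<otimes>\<^sub>o Y)"
proof -
  let ?I = "unit_obj C" and ?id = "ident C"
  define r where "r = runitor C T \<otimes>\<^sub>m ?id Y"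
  define p where "p = (?id T \<otimes>\<^sub>m ev) \<otimes>\<^sub>m ?id Y"
  define \<alpha> where "\<alpha> = associator C T Y X \<otimes>\<^sub>m ?id Y"
  define \<beta> where "\<beta> = ass_inv (T \<otimes>\<^sub>o Y) X Y"
  define \<gamma> where "\<gamma> = ?id (T \<otimes>\<^sub>o Y) \<otimes>\<^sub>m coev"
  define \<delta> where "\<delta> = run_inv (T \<otimes>\<^sub>o Y)"
  define q where "q = ass_inv T (Y \<otimes>\<^sub>o X) Y"
  define m where "m = ?id T \<otimes>\<^sub>m ass_inv Y X Y"
  define \<alpha>' where "\<alpha>' = associator C T Y (X \<otimes>\<^sub>o Y)"
  define \<gamma>' where "\<gamma>' = ?id T \<otimes>\<^sub>m (?id Y \<otimes>\<^sub>m coev)"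
  define \<alpha>'' where "\<alpha>'' = associator C T Y ?I"
  define l where "l = ?id T \<otimes>\<^sub>m run_inv Y"
  define q' where "q' = ass_inv T ?I Y"
  define p' where "p' = ?id T \<otimes>\<^sub>m (ev \<otimes>\<^sub>m ?id Y)"
  define \<rho> where "\<rho> = ?id T \<otimes>\<^sub>m lunitor C Y"
  note defs = r_def p_def \<alpha>_def \<beta>_def \<gamma>_def \<delta>_def q_def m_def \<alpha>'_def \<gamma>'_def \<alpha>''_def l_def q'_def p'_def \<rho>_def
  note e = ev_in_hom and c = coev_in_hom
  have r: "r \<in> Hom (T \<otimes>\<^sub>o ?I \<otimes>\<^sub>o Y) (T \<otimes>\<^sub>o Y)"
    and p: "p \<in> Hom (T \<otimes>\<^sub>o (Y \<otimes>\<^sub>o X) \<otimes>\<^sub>o Y) (T \<otimes>\<^sub>o ?I \<otimes>\<^sub>o Y)"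
    and \<alpha>: "\<alpha> \<in> Hom (T \<otimes>\<^sub>o Y \<otimes>\<^sub>o X \<otimes>\<^sub>o Y) (T \<otimes>\<^sub>o (Y \<otimes>\<^sub>o X) \<otimes>\<^sub>o Y)"
    and \<beta>: "\<beta> \<in> Hom (T \<otimes>\<^sub>o Y \<otimes>\<^sub>o (X \<otimes>\<^sub>o Y)) (T \<otimes>\<^sub>o Y \<otimes>\<^sub>o X \<otimes>\<^sub>o Y)"
    and \<gamma>: "\<gamma> \<in> Hom (T \<otimes>\<^sub>o Y \<otimes>\<^sub>o ?I) (T \<otimes>\<^sub>o Y \<otimes>\<^sub>o (X \<otimes>\<^sub>o Y))"
    and \<delta>: "\<delta> \<in> Hom (T \<otimes>\<^sub>o Y) (T \<otimes>\<^sub>o Y \<otimes>\<^sub>o ?I)"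
    and q: "q \<in> Hom (T \<otimes>\<^sub>o (Y \<otimes>\<^sub>o X \<otimes>\<^sub>o Y)) (T \<otimes>\<^sub>o (Y \<otimes>\<^sub>o X) \<otimes>\<^sub>o Y)"
    and m: "m \<in> Hom (T \<otimes>\<^sub>o (Y \<otimes>\<^sub>o (X \<otimes>\<^sub>o Y))) (T \<otimes>\<^sub>o (Y \<otimes>\<^sub>o X \<otimes>\<^sub>o Y))"
    and \<alpha>': "\<alpha>' \<in> Hom (T \<otimes>\<^sub>o Y \<otimes>\<^sub>o (X \<otimes>\<^sub>o Y)) (T \<otimes>\<^sub>o (Y \<otimes>\<^sub>o (X \<otimes>\<^sub>o Y)))"
    and \<gamma>': "\<gamma>' \<in> Hom (T \<otimes>\<^sub>o (Y \<otimes>\<^sub>o ?I)) (T \<otimes>\<^sub>o (Y \<otimes>\<^sub>o (X \<otimes>\<^sub>o Y)))"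
    and \<alpha>'': "\<alpha>'' \<in> Hom (T \<otimes>\<^sub>o Y \<otimes>\<^sub>o ?I) (T \<otimes>\<^sub>o (Y \<otimes>\<^sub>o ?I))"
    and l: "l \<in> Hom (T \<otimes>\<^sub>o Y) (T \<otimes>\<^sub>o (Y \<otimes>\<^sub>o ?I))"
    and q': "q' \<in> Hom (T \<otimes>\<^sub>o (?I \<otimes>\<^sub>o Y)) (T \<otimes>\<^sub>o ?I \<otimes>\<^sub>o Y)"
    and p': "p' \<in> Hom (T \<otimes>\<^sub>o (Y \<otimes>\<^sub>o X \<otimes>\<^sub>o Y)) (T \<otimes>\<^sub>o (?I \<otimes>\<^sub>o Y))"
    and \<rho>: "\<rho> \<in> Hom (T \<otimes>\<^sub>o (?I \<otimes>\<^sub>o Y)) (T \<otimes>\<^sub>o Y)"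
    unfolding defs
    by (intro id_tmor_in_hom tmor_id_in_hom e c ass_cmp(1,2) run_cmp(1,2) lun_cmp(1,2))+
  let ?m = "?id T \<otimes>\<^sub>m associator C Y X Y" and ?q = "associator C T (Y \<otimes>\<^sub>o X) Y"
  let ?b = "associator C (T \<otimes>\<^sub>o Y) X Y"
  note m' = id_tmor_in_hom[OF ass_cmp(1)[of Y X Y], of T] and qh = ass_cmp(1)[of T "Y \<otimes>\<^sub>o X" Y]
    and b = ass_cmp(1)[of "T \<otimes>\<^sub>o Y" X Y]
  have mi: "is_inverse C (T \<otimes>\<^sub>o (Y \<otimes>\<^sub>o X \<otimes>\<^sub>o Y)) (T \<otimes>\<^sub>o (Y \<otimes>\<^sub>o (X \<otimes>\<^sub>o Y))) ?m m"
    unfolding m_def by (rule tmor_inverse[OF ident_inverse inverse_mor[OF associator_iso]])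
  have pent: "?m \<cdot> (?q \<cdot> \<alpha>) = \<alpha>' \<cdot> ?b"
    using pentagon[of T Y X Y] unfolding defs by simp
  have "?q \<cdot> \<alpha> = m \<cdot> (\<alpha>' \<cdot> ?b)"
    by (rule cmp_eq_move_left[OF mi cmp_in_hom[OF \<alpha> qh] pent])
  then have "\<alpha> = q \<cdot> (m \<cdot> (\<alpha>' \<cdot> ?b))"
    using cmp_eq_move_left[OF inverse_mor[OF associator_iso] \<alpha>] unfolding q_def by simp
  then have "(q \<cdot> m \<cdot> \<alpha>') \<cdot> ?b = \<alpha>" using cmp_assoc3[OF b \<alpha>' m q] by simp
  then have A: "\<alpha> \<cdot> \<beta> = q \<cdot> (m \<cdot> \<alpha>')"
    using cmp_eq_move_right[OF inverse_mor[OF associator_iso] cmp_in_hom[OF cmp_in_hom[OF \<alpha>' m] q]]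
    unfolding \<beta>_def by simp
  have B: "\<alpha>' \<cdot> \<gamma> = \<gamma>' \<cdot> \<alpha>''"
    unfolding defs using associator_natural[OF ident_in_hom ident_in_hom c] tmor_ident by simp
  have li: "is_inverse C (T \<otimes>\<^sub>o (Y \<otimes>\<^sub>o ?I)) (T \<otimes>\<^sub>o Y) (?id T \<otimes>\<^sub>m runitor C Y) l"
    unfolding l_def by (rule tmor_inverse[OF ident_inverse inverse_mor[OF runitor_iso]])
  have "(?id T \<otimes>\<^sub>m runitor C Y) \<cdot> (\<alpha>'' \<cdot> \<delta>) = ident C (T \<otimes>\<^sub>o Y)"
    using cmp_assoc[OF \<delta> \<alpha>'' id_tmor_in_hom[OF run_cmp(1)]] runitor_tensor[of T Y] run_cmp(4)
    unfolding \<alpha>''_def \<delta>_def by simp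
  then have Cc: "\<alpha>'' \<cdot> \<delta> = l"
    using cmp_eq_move_left[OF li cmp_in_hom[OF \<delta> \<alpha>'']] cmp_ident_right[OF l] by simp
  have D: "p \<cdot> q = q' \<cdot> p'"
    unfolding defs by (rule ass_inv_natural[OF ident_in_hom e ident_in_hom])
  have E: "r \<cdot> q' = \<rho>"
    unfolding defs
    using cmp_eq_move_right[OF inverse_mor[OF associator_iso] id_tmor_in_hom[OF lun_cmp(1)] triangle]
    by simp
  note gd = cmp_in_hom[OF \<delta> \<gamma>] and gl = cmp_in_hom[OF l \<gamma>']
  have "dual_unit X Y coev (T \<otimes>\<^sub>o Y) = \<beta> \<cdot> (\<gamma> \<cdot> \<delta>)" unfolding dual_unit_def defs ..
  moreover have "dual_counit X Y ev T \<otimes>\<^sub>m ident C Y = r \<cdot> (p \<cdot> \<alpha>)"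
    unfolding dual_counit_def defs
    using tmor_id_cmp[OF cmp_in_hom[OF ass_cmp(1) id_tmor_in_hom[OF e]] run_cmp(1)]
      tmor_id_cmp[OF ass_cmp(1) id_tmor_in_hom[OF e]] by simp
  moreover have "\<alpha> \<cdot> (\<beta> \<cdot> (\<gamma> \<cdot> \<delta>)) = q \<cdot> (m \<cdot> (\<gamma>' \<cdot> l))"
  proof -
    have "\<alpha> \<cdot> (\<beta> \<cdot> (\<gamma> \<cdot> \<delta>)) = (q \<cdot> (m \<cdot> \<alpha>')) \<cdot> (\<gamma> \<cdot> \<delta>)"
      using cmp_assoc[OF gd \<beta> \<alpha>] A by simp
    also have "\<dots> = q \<cdot> (m \<cdot> (\<alpha>' \<cdot> (\<gamma> \<cdot> \<delta>)))" by (rule cmp_assoc3[OF gd \<alpha>' m q])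
    also have "\<alpha>' \<cdot> (\<gamma> \<cdot> \<delta>) = \<gamma>' \<cdot> l"
      using cmp_assoc[OF \<delta> \<gamma> \<alpha>'] cmp_assoc[OF \<delta> \<alpha>'' \<gamma>'] B Cc by simp
    finally show ?thesis .
  qed
  moreover note bgd = cmp_in_hom[OF gd \<beta>] and mgl = cmp_in_hom[OF gl m]
  ultimately have "(dual_counit X Y ev T \<otimes>\<^sub>m ident C Y) \<cdot> dual_unit X Y coev (T \<otimes>\<^sub>o Y)
      = r \<cdot> (p \<cdot> (q \<cdot> (m \<cdot> (\<gamma>' \<cdot> l))))"
    using cmp_assoc3[OF bgd \<alpha> p r] by simp
  also have "\<dots> = r \<cdot> (q' \<cdot> (p' \<cdot> (m \<cdot> (\<gamma>' \<cdot> l))))"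
    using cmp_assoc[OF mgl q p] cmp_assoc[OF mgl p' q'] D by simp
  also have "\<dots> = \<rho> \<cdot> (p' \<cdot> (m \<cdot> (\<gamma>' \<cdot> l)))"
    using cmp_assoc[OF cmp_in_hom[OF mgl p'] q' r] E by simp
  also have "\<dots> = ?id T \<otimes>\<^sub>m (lunitor C Y \<cdot> ((ev \<otimes>\<^sub>m ?id Y) \<cdot> (ass_inv Y X Y \<cdot> ((?id Y \<otimes>\<^sub>m coev) \<cdot> run_inv Y))))"
  proof -
    note t1 = run_cmp(2)[of Y] and t2 = id_tmor_in_hom[OF c, of Y] and t3 = ass_cmp(2)[of Y X Y]
      and t4 = tmor_id_in_hom[OF e, of Y] and t5 = lun_cmp(1)[of Y]
    note s2 = cmp_in_hom[OF t1 t2]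
    note s3 = cmp_in_hom[OF s2 t3]
    note s4 = cmp_in_hom[OF s3 t4]
    show ?thesis unfolding defs
      using id_tmor_cmp[OF t1 t2] id_tmor_cmp[OF s2 t3] id_tmor_cmp[OF s3 t4] id_tmor_cmp[OF s4 t5] by simp
  qed
  also have "lunitor C Y \<cdot> ((ev \<otimes>\<^sub>m ?id Y) \<cdot> (ass_inv Y X Y \<cdot> ((?id Y \<otimes>\<^sub>m coev) \<cdot> run_inv Y))) = ?id Y"
  proof -
    note t1 = run_cmp(2)[of Y] and t2 = id_tmor_in_hom[OF c, of Y] and t3 = ass_cmp(2)[of Y X Y]
      and t4 = tmor_id_in_hom[OF e, of Y] and t5 = lun_cmp(1)[of Y]
    have "runitor C Y \<cdot> run_inv Y = (lunitor C Y \<cdot> (ev \<otimes>\<^sub>m ?id Y) \<cdot> ass_inv Y X Y \<cdot> (?id Y \<otimes>\<^sub>m coev)) \<cdot> run_inv Y"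
      using dual by (simp add: is_left_dual_def)
    also have "\<dots> = lunitor C Y \<cdot> (ev \<otimes>\<^sub>m ?id Y) \<cdot> ass_inv Y X Y \<cdot> (?id Y \<otimes>\<^sub>m coev) \<cdot> run_inv Y"
      using cmp_assoc3[OF cmp_in_hom[OF t1 t2] t3 t4 t5] cmp_assoc3[OF t2 t3 t4 t5]
        cmp_assoc[OF t1 t2 cmp_in_hom[OF cmp_in_hom[OF t3 t4] t5]] by simp
    finally show ?thesis using run_cmp(4) by simp
  qed
  finally show ?thesis using tmor_ident by simp
qed

lemma transpose_unit:
  assumes s: "s \<in> Hom (Z \<otimes>\<^sub>o X) T"
  shows "dual_counit X Y ev T \<cdot> (((s \<otimes>\<^sub>m ident C Y) \<cdot> dual_unit X Y coev Z) \<otimes>\<^sub>m ident C X) = s"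
proof -
  note u = dual_unit_in_hom[of Z] and sY = tmor_id_in_hom[OF s, of Y]
  have "dual_counit X Y ev T \<cdot> (((s \<otimes>\<^sub>m ident C Y) \<cdot> dual_unit X Y coev Z) \<otimes>\<^sub>m ident C X)
      = (dual_counit X Y ev T \<cdot> ((s \<otimes>\<^sub>m ident C Y) \<otimes>\<^sub>m ident C X)) \<cdot> (dual_unit X Y coev Z \<otimes>\<^sub>m ident C X)"
    using tmor_id_cmp[OF u sY]
      cmp_assoc[OF tmor_id_in_hom[OF u] tmor_id_in_hom[OF sY] dual_counit_in_hom] by simp
  also have "\<dots> = s \<cdot> (dual_counit X Y ev (Z \<otimes>\<^sub>o X) \<cdot> (dual_unit X Y coev Z \<otimes>\<^sub>m ident C X))"
    unfolding dual_counit_natural[OF s, symmetric]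
    by (rule cmp_assoc[OF tmor_id_in_hom[OF u] dual_counit_in_hom s])
  finally show ?thesis using dual_triangle_left cmp_ident_right[OF s] by simp
qed

lemma transpose_counit:
  assumes t: "t \<in> Hom T (B \<otimes>\<^sub>o Y)"
  shows "((dual_counit X Y ev B \<cdot> (t \<otimes>\<^sub>m ident C X)) \<otimes>\<^sub>m ident C Y) \<cdot> dual_unit X Y coev T = t"
proof -
  note u = dual_unit_in_hom[of T] and tX = tmor_id_in_hom[OF t, of X] and e = dual_counit_in_hom[of B]
  have "((dual_counit X Y ev B \<cdot> (t \<otimes>\<^sub>m ident C X)) \<otimes>\<^sub>m ident C Y) \<cdot> dual_unit X Y coev T
      = (dual_counit X Y ev B \<otimes>\<^sub>m ident C Y) \<cdot> (((t \<otimes>\<^sub>m ident C X) \<otimes>\<^sub>m ident C Y) \<cdot> dual_unit X Y coev T)"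
    using tmor_id_cmp[OF tX e]
      cmp_assoc[OF u tmor_id_in_hom[OF tX] tmor_id_in_hom[OF e]] by simp
  also have "\<dots> = ((dual_counit X Y ev B \<otimes>\<^sub>m ident C Y) \<cdot> dual_unit X Y coev (B \<otimes>\<^sub>o Y)) \<cdot> t"
    unfolding dual_unit_natural[OF t, symmetric]
    by (rule cmp_assoc[OF t dual_unit_in_hom tmor_id_in_hom[OF e], symmetric])
  finally show ?thesis using dual_triangle_right cmp_ident_left[OF t] by simp
qed

text \<open>The final equivalence combines naturality of transposition in Z with the fact that
  transposing back recovers the morphism. It trades vanishing on a tensor product for vanishing of a
  plain composite, the form in which duality enters \<open>tensor_cokernel\<close> and
  \<open>transpose_annihilator\<close>.\<close>

lemma transpose_left:
  assumes s: "s \<in> Hom (Z \<otimes>\<^sub>o X) T"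
  obtains s' where "s' \<in> Hom Z (T \<otimes>\<^sub>o Y)" "s = dual_counit X Y ev T \<cdot> (s' \<otimes>\<^sub>m ident C X)"
    "\<And>W f. f \<in> Hom W Z \<Longrightarrow> s \<cdot> (f \<otimes>\<^sub>m ident C X) = 0 \<longleftrightarrow> s' \<cdot> f = 0"
proof
  define s' where "s' = (s \<otimes>\<^sub>m ident C Y) \<cdot> dual_unit X Y coev Z"
  note sY = tmor_id_in_hom[OF s, of Y]
  show s': "s' \<in> Hom Z (T \<otimes>\<^sub>o Y)"
    unfolding s'_def by (rule cmp_in_hom[OF dual_unit_in_hom sY])
  show eq: "s = dual_counit X Y ev T \<cdot> (s' \<otimes>\<^sub>m ident C X)"
    unfolding s'_def transpose_unit[OF s] ..
  fix W f assume f: "f \<in> Hom W Z"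
  note fX = tmor_id_in_hom[OF f, of X]
  have 1: "s' \<cdot> f = ((s \<cdot> (f \<otimes>\<^sub>m ident C X)) \<otimes>\<^sub>m ident C Y) \<cdot> dual_unit X Y coev W"
    unfolding s'_def
    using cmp_assoc[OF f dual_unit_in_hom sY] dual_unit_natural[OF f] tmor_id_cmp[OF fX s]
      cmp_assoc[OF dual_unit_in_hom tmor_id_in_hom[OF fX] sY] by simp
  have 2: "s \<cdot> (f \<otimes>\<^sub>m ident C X) = dual_counit X Y ev T \<cdot> ((s' \<cdot> f) \<otimes>\<^sub>m ident C X)"
    using transpose_unit[OF cmp_in_hom[OF fX s]] 1 by simp
  show "s \<cdot> (f \<otimes>\<^sub>m ident C X) = 0 \<longleftrightarrow> s' \<cdot> f = 0"
  proof
    assume "s \<cdot> (f \<otimes>\<^sub>m ident C X) = 0"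
    then show "s' \<cdot> f = 0" using 1 tmor_zero_left[OF ident_in_hom] cmp_zero_left[OF dual_unit_in_hom] by simp
  next
    assume "s' \<cdot> f = 0"
    then show "s \<cdot> (f \<otimes>\<^sub>m ident C X) = 0"
      using 2 tmor_zero_left[OF ident_in_hom] cmp_zero_right[OF dual_counit_in_hom] by simp
  qed
qed

lemma transpose_right:
  assumes t: "t \<in> Hom T (B \<otimes>\<^sub>o Y)"
  obtains t' where "t' \<in> Hom (T \<otimes>\<^sub>o X) B" "t = (t' \<otimes>\<^sub>m ident C Y) \<cdot> dual_unit X Y coev T"
    "\<And>D g. g \<in> Hom B D \<Longrightarrow> (g \<otimes>\<^sub>m ident C Y) \<cdot> t = 0 \<longleftrightarrow> g \<cdot> t' = 0"
proof
  define t' where "t' = dual_counit X Y ev B \<cdot> (t \<otimes>\<^sub>m ident C X)"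
  note tX = tmor_id_in_hom[OF t, of X]
  show t': "t' \<in> Hom (T \<otimes>\<^sub>o X) B"
    unfolding t'_def by (rule cmp_in_hom[OF tX dual_counit_in_hom])
  show eq: "t = (t' \<otimes>\<^sub>m ident C Y) \<cdot> dual_unit X Y coev T"
    unfolding t'_def transpose_counit[OF t] ..
  fix D g assume g: "g \<in> Hom B D"
  note gY = tmor_id_in_hom[OF g, of Y]
  have 1: "g \<cdot> t' = dual_counit X Y ev D \<cdot> (((g \<otimes>\<^sub>m ident C Y) \<cdot> t) \<otimes>\<^sub>m ident C X)"
    unfolding t'_def
    using cmp_assoc[OF tX dual_counit_in_hom g] dual_counit_natural[OF g] tmor_id_cmp[OF t gY]
      cmp_assoc[OF tX tmor_id_in_hom[OF gY] dual_counit_in_hom] by simp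
  have 2: "(g \<otimes>\<^sub>m ident C Y) \<cdot> t = ((g \<cdot> t') \<otimes>\<^sub>m ident C Y) \<cdot> dual_unit X Y coev T"
    using transpose_counit[OF cmp_in_hom[OF t gY]] 1 by simp
  show "(g \<otimes>\<^sub>m ident C Y) \<cdot> t = 0 \<longleftrightarrow> g \<cdot> t' = 0"
  proof
    assume "(g \<otimes>\<^sub>m ident C Y) \<cdot> t = 0"
    then show "g \<cdot> t' = 0" using 1 tmor_zero_left[OF ident_in_hom] cmp_zero_right[OF dual_counit_in_hom] by simp
  next
    assume "g \<cdot> t' = 0"
    then show "(g \<otimes>\<^sub>m ident C Y) \<cdot> t = 0"
      using 2 tmor_zero_left[OF ident_in_hom] cmp_zero_left[OF dual_unit_in_hom] by simp
  qed
qed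

text \<open>Left adjoints preserve cokernels: a morphism that kills
  \<open>f \<otimes>\<^sub>m ident C X\<close> is transposed, factored through q, and transposed
  back.\<close>

lemma tensor_cokernel:
  assumes q: "is_cokernel C A B f Q q"
  shows "is_cokernel C (A \<otimes>\<^sub>o X) (B \<otimes>\<^sub>o X) (f \<otimes>\<^sub>m ident C X) (Q \<otimes>\<^sub>o X) (q \<otimes>\<^sub>m ident C X)"
proof (rule cokernelI)
  note h = cokernel_in_hom[OF q]
  show fX: "f \<otimes>\<^sub>m ident C X \<in> Hom (A \<otimes>\<^sub>o X) (B \<otimes>\<^sub>o X)" by (rule tmor_id_in_hom[OF h(1)])
  show "(q \<otimes>\<^sub>m ident C X) \<cdot> (f \<otimes>\<^sub>m ident C X) = 0"
    using tmor_id_cmp[OF h(1,2)] h(3) tmor_zero_left[OF ident_in_hom] by metis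
  show "is_epi C (B \<otimes>\<^sub>o X) (Q \<otimes>\<^sub>o X) (q \<otimes>\<^sub>m ident C X)"
  proof (rule epiI[OF tmor_id_in_hom[OF h(2)]])
    fix T t assume t: "t \<in> Hom (Q \<otimes>\<^sub>o X) T" "t \<cdot> (q \<otimes>\<^sub>m ident C X) = 0"
    obtain t' where t': "t' \<in> Hom Q (T \<otimes>\<^sub>o Y)" "t = dual_counit X Y ev T \<cdot> (t' \<otimes>\<^sub>m ident C X)"
      "\<And>W f. f \<in> Hom W Q \<Longrightarrow> t \<cdot> (f \<otimes>\<^sub>m ident C X) = 0 \<longleftrightarrow> t' \<cdot> f = 0"
      using transpose_left[OF t(1)] by metis
    have "t' = 0" using t'(3)[OF h(2)] t(2) epi_eq_0[OF cokernel_epi[OF q] t'(1)] by simp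
    then show "t = 0" using t'(2) tmor_zero_left[OF ident_in_hom] cmp_zero_right[OF dual_counit_in_hom] by simp
  qed
  fix T t assume t: "t \<in> Hom (B \<otimes>\<^sub>o X) T" "t \<cdot> (f \<otimes>\<^sub>m ident C X) = 0"
  obtain t' where t': "t' \<in> Hom B (T \<otimes>\<^sub>o Y)" "t = dual_counit X Y ev T \<cdot> (t' \<otimes>\<^sub>m ident C X)"
    "\<And>W f. f \<in> Hom W B \<Longrightarrow> t \<cdot> (f \<otimes>\<^sub>m ident C X) = 0 \<longleftrightarrow> t' \<cdot> f = 0"
    using transpose_left[OF t(1)] by metis
  obtain u where u: "u \<in> Hom Q (T \<otimes>\<^sub>o Y)" "u \<cdot> q = t'"
    using cokernelE[OF q t'(1)] t'(3)[OF h(1)] t(2) by blast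
  have "(dual_counit X Y ev T \<cdot> (u \<otimes>\<^sub>m ident C X)) \<cdot> (q \<otimes>\<^sub>m ident C X) = t"
    using cmp_assoc[OF tmor_id_in_hom[OF h(2)] tmor_id_in_hom[OF u(1)] dual_counit_in_hom]
      tmor_id_cmp[OF h(2) u(1)] u(2) t'(2) by simp
  then show "\<exists>u. u \<in> Hom (Q \<otimes>\<^sub>o X) T \<and> u \<cdot> (q \<otimes>\<^sub>m ident C X) = t"
    using cmp_in_hom[OF tmor_id_in_hom[OF u(1)] dual_counit_in_hom] by blast
qed

text \<open>Right adjoints preserve kernels; here the functor is tensoring with the dual Y.\<close>

lemma tensor_kernel:
  assumes k: "is_kernel C B D g K k"
  shows "is_kernel C (B \<otimes>\<^sub>o Y) (D \<otimes>\<^sub>o Y) (g \<otimes>\<^sub>m ident C Y) (K \<otimes>\<^sub>o Y) (k \<otimes>\<^sub>m ident C Y)"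
proof (rule kernelI)
  note h = kernel_in_hom[OF k]
  show "g \<otimes>\<^sub>m ident C Y \<in> Hom (B \<otimes>\<^sub>o Y) (D \<otimes>\<^sub>o Y)" by (rule tmor_id_in_hom[OF h(1)])
  show "(g \<otimes>\<^sub>m ident C Y) \<cdot> (k \<otimes>\<^sub>m ident C Y) = 0"
    using tmor_id_cmp[OF h(2,1)] h(3) tmor_zero_left[OF ident_in_hom] by metis
  show "is_mono C (K \<otimes>\<^sub>o Y) (B \<otimes>\<^sub>o Y) (k \<otimes>\<^sub>m ident C Y)"
  proof (rule monoI[OF tmor_id_in_hom[OF h(2)]])
    fix T t assume t: "t \<in> Hom T (K \<otimes>\<^sub>o Y)" "(k \<otimes>\<^sub>m ident C Y) \<cdot> t = 0"
    obtain t' where t': "t' \<in> Hom (T \<otimes>\<^sub>o X) K" "t = (t' \<otimes>\<^sub>m ident C Y) \<cdot> dual_unit X Y coev T"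
      "\<And>D g. g \<in> Hom K D \<Longrightarrow> (g \<otimes>\<^sub>m ident C Y) \<cdot> t = 0 \<longleftrightarrow> g \<cdot> t' = 0"
      using transpose_right[OF t(1)] by metis
    have "t' = 0" using t'(3)[OF h(2)] t(2) mono_eq_0[OF kernel_mono[OF k] t'(1)] by simp
    then show "t = 0" using t'(2) tmor_zero_left[OF ident_in_hom] cmp_zero_left[OF dual_unit_in_hom] by simp
  qed
  fix T t assume t: "t \<in> Hom T (B \<otimes>\<^sub>o Y)" "(g \<otimes>\<^sub>m ident C Y) \<cdot> t = 0"
  obtain t' where t': "t' \<in> Hom (T \<otimes>\<^sub>o X) B" "t = (t' \<otimes>\<^sub>m ident C Y) \<cdot> dual_unit X Y coev T"
    "\<And>D g. g \<in> Hom B D \<Longrightarrow> (g \<otimes>\<^sub>m ident C Y) \<cdot> t = 0 \<longleftrightarrow> g \<cdot> t' = 0"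
    using transpose_right[OF t(1)] by metis
  obtain u where u: "u \<in> Hom (T \<otimes>\<^sub>o X) K" "k \<cdot> u = t'"
    using kernelE[OF k t'(1)] t'(3)[OF h(1)] t(2) by blast
  have "(k \<otimes>\<^sub>m ident C Y) \<cdot> ((u \<otimes>\<^sub>m ident C Y) \<cdot> dual_unit X Y coev T) = t"
    using cmp_assoc[OF dual_unit_in_hom tmor_id_in_hom[OF u(1)] tmor_id_in_hom[OF h(2)]]
      tmor_id_cmp[OF u(1) h(2)] u(2) t'(2) by simp
  then show "\<exists>u. u \<in> Hom T (K \<otimes>\<^sub>o Y) \<and> (k \<otimes>\<^sub>m ident C Y) \<cdot> u = t"
    using cmp_in_hom[OF dual_unit_in_hom tmor_id_in_hom[OF u(1)]] by blast
qed

end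

end

section \<open>Exactness of tensoring in the presence of duals and a braiding\<close>

context tensor_category
begin

lemma cokernel_tmor:
  "is_cokernel C A B f Q q \<Longrightarrow>
     is_cokernel C (A \<otimes>\<^sub>o X) (B \<otimes>\<^sub>o X) (f \<otimes>\<^sub>m ident C X) (Q \<otimes>\<^sub>o X) (q \<otimes>\<^sub>m ident C X)"
  using left_duals tensor_cokernel by blast

text \<open>The left dual makes tensoring with X a left adjoint and the right dual makes it a right
  adjoint, which takes care of cokernels and kernels respectively.\<close>

lemma short_exact_tmor:
  "short_exact C A f B g D \<Longrightarrow>
     short_exact C (A \<otimes>\<^sub>o X) (f \<otimes>\<^sub>m ident C X) (B \<otimes>\<^sub>o X) (g \<otimes>\<^sub>m ident C X) (D \<otimes>\<^sub>o X)"
  unfolding short_exact_def using right_duals[of X] tensor_kernel cokernel_tmor by blast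

text \<open>The shape of T' (it is T tensored with a dual of X) is forgotten on purpose: later only
  the set of annihilated morphisms matters.\<close>

lemma transpose_annihilator:
  assumes "s \<in> Hom (Z \<otimes>\<^sub>o X) T"
  obtains T' s' where "s' \<in> Hom Z T'"
    "\<And>W f. f \<in> Hom W Z \<Longrightarrow> s \<cdot> (f \<otimes>\<^sub>m ident C X) = 0 \<longleftrightarrow> s' \<cdot> f = 0"
  using left_duals[of X] transpose_left[OF _ assms] by metis

end

context symmetric_tensor_category
begin

lemma braiding_inverse: "is_inverse C (X \<otimes>\<^sub>o Y) (Y \<otimes>\<^sub>o X) (braiding C X Y) (braiding C Y X)"
  unfolding is_inverse_def using braiding_in_hom braiding_symmetric by blast

lemma braiding_iso: "is_iso C (X \<otimes>\<^sub>o Y) (Y \<otimes>\<^sub>o X) (braiding C X Y)"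
  using braiding_inverse by (auto simp: is_iso_def)

text \<open>Conjugating with the braiding transfers right exactness from one tensor factor to the
  other, without a second duality argument.\<close>

lemma id_tmor_braiding:
  assumes "f \<in> Hom A B"
  shows "ident C X \<otimes>\<^sub>m f = braiding C B X \<cdot> (f \<otimes>\<^sub>m ident C X) \<cdot> braiding C X A"
proof -
  have "braiding C X B \<cdot> (ident C X \<otimes>\<^sub>m f) = (f \<otimes>\<^sub>m ident C X) \<cdot> braiding C X A"
    by (rule braiding_natural[OF ident_in_hom assms])
  then show ?thesis by (rule cmp_eq_move_left[OF braiding_inverse id_tmor_in_hom[OF assms]])
qed

lemma cokernel_id_tmor:
  assumes q: "is_cokernel C A B f Q q"
  shows "is_cokernel C (X \<otimes>\<^sub>o A) (X \<otimes>\<^sub>o B) (ident C X \<otimes>\<^sub>m f) (X \<otimes>\<^sub>o Q) (ident C X \<otimes>\<^sub>m q)"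
proof (rule cokernelI)
  note h = cokernel_in_hom[OF q] and b = braiding_in_hom
  note q' = cokernel_tmor[OF q, of X]
  show fX: "ident C X \<otimes>\<^sub>m f \<in> Hom (X \<otimes>\<^sub>o A) (X \<otimes>\<^sub>o B)" by (rule id_tmor_in_hom[OF h(1)])
  show "(ident C X \<otimes>\<^sub>m q) \<cdot> (ident C X \<otimes>\<^sub>m f) = 0"
    using id_tmor_cmp[OF h(1,2)] h(3) tmor_zero_right[OF ident_in_hom] by metis
  show "is_epi C (X \<otimes>\<^sub>o B) (X \<otimes>\<^sub>o Q) (ident C X \<otimes>\<^sub>m q)"
    unfolding id_tmor_braiding[OF h(2)]
    by (intro epi_cmp[OF epi_cmp[OF iso_epi[OF braiding_iso] cokernel_epi[OF q']] iso_epi[OF braiding_iso]])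
  fix T t assume t: "t \<in> Hom (X \<otimes>\<^sub>o B) T" "t \<cdot> (ident C X \<otimes>\<^sub>m f) = 0"
  have "braiding C B X \<cdot> (f \<otimes>\<^sub>m ident C X) = (ident C X \<otimes>\<^sub>m f) \<cdot> braiding C A X"
    by (rule braiding_natural[OF h(1) ident_in_hom])
  then have "(t \<cdot> braiding C B X) \<cdot> (f \<otimes>\<^sub>m ident C X) = (t \<cdot> (ident C X \<otimes>\<^sub>m f)) \<cdot> braiding C A X"
    using cmp_assoc[OF tmor_id_in_hom[OF h(1)] b t(1)] cmp_assoc[OF b fX t(1)] by simp
  then have "(t \<cdot> braiding C B X) \<cdot> (f \<otimes>\<^sub>m ident C X) = 0"
    using t(2) cmp_zero_left[OF b] by simp
  then obtain u where u: "u \<in> Hom (Q \<otimes>\<^sub>o X) T" "u \<cdot> (q \<otimes>\<^sub>m ident C X) = t \<cdot> braiding C B X"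
    using cokernelE[OF q' cmp_in_hom[OF b t(1)]] by blast
  have "(u \<cdot> braiding C X Q) \<cdot> (ident C X \<otimes>\<^sub>m q) = u \<cdot> ((q \<otimes>\<^sub>m ident C X) \<cdot> braiding C X B)"
    using cmp_assoc[OF id_tmor_in_hom[OF h(2)] b u(1)] braiding_natural[OF ident_in_hom h(2)] by simp
  also have "\<dots> = (t \<cdot> braiding C B X) \<cdot> braiding C X B"
    using cmp_assoc[OF b tmor_id_in_hom[OF h(2)] u(1)] u(2) by simp
  also have "\<dots> = t"
    using cmp_assoc[OF b b t(1)] braiding_symmetric cmp_ident_right[OF t(1)] by simp
  finally show "\<exists>u. u \<in> Hom (X \<otimes>\<^sub>o Q) T \<and> u \<cdot> (ident C X \<otimes>\<^sub>m q) = t"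
    using cmp_in_hom[OF b u(1)] by blast
qed

end

section \<open>The Grothendieck ring and its characters\<close>

lemma group_free_tensor_ring: "group (add_monoid (free_tensor_ring C))"
proof (rule groupI)
  fix x assume "x \<in> carrier (add_monoid (free_tensor_ring C))"
  show "\<exists>y\<in>carrier (add_monoid (free_tensor_ring C)).
      y \<otimes>\<^bsub>add_monoid (free_tensor_ring C)\<^esub> x = \<one>\<^bsub>add_monoid (free_tensor_ring C)\<^esub>"
    by (intro bexI[of _ "- x"]) (auto simp: free_tensor_ring_def)
qed (auto simp: free_tensor_ring_def algebra_simps)

lemma inv_free_tensor_ring: "inv\<^bsub>add_monoid (free_tensor_ring C)\<^esub> x = - x"
  by (rule group.inv_equality[OF group_free_tensor_ring]) (auto simp: free_tensor_ring_def)

context linear_category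
begin

abbreviation relations :: "('o \<Rightarrow>\<^sub>0 int) set" where
  "relations \<equiv> exact_sequence_relations C"

text \<open>\<open>generate\<close> adjoins inverses of generators only, not of arbitrary elements;
  hence the separate base case \<open>exact_neg\<close>.\<close>

lemma relations_induct [consumes 1, case_names zero exact exact_neg add]:
  assumes "x \<in> relations" "P 0"
    and "\<And>A f B g D. short_exact C A f B g D \<Longrightarrow> P (frag_of B - (frag_of A + frag_of D))"
    and "\<And>A f B g D. short_exact C A f B g D \<Longrightarrow> P (- (frag_of B - (frag_of A + frag_of D)))"
    and "\<And>x y. x \<in> relations \<Longrightarrow> y \<in> relations \<Longrightarrow> P x \<Longrightarrow> P y \<Longrightarrow> P (x + y)"
  shows "P x"
  using assms(1) unfolding exact_sequence_relations_def
proof (induction rule: generate.induct)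
  case one
  then show ?case using assms(2) by (simp add: free_tensor_ring_def)
next
  case (incl h)
  then show ?case using assms(3) by auto
next
  case (inv h)
  then show ?case using assms(4) unfolding inv_free_tensor_ring by blast
next
  case (eng h1 h2)
  then show ?case using assms(5) unfolding exact_sequence_relations_def by (simp add: free_tensor_ring_def)
qed

lemma relations_exact: "short_exact C A f B g D \<Longrightarrow> frag_of B - (frag_of A + frag_of D) \<in> relations"
  unfolding exact_sequence_relations_def by (rule generate.incl) blast

lemma relations_zero: "0 \<in> relations"
  unfolding exact_sequence_relations_def
  using generate.one[of "add_monoid (free_tensor_ring C)"] by (simp add: free_tensor_ring_def)

lemma relations_add: "x \<in> relations \<Longrightarrow> y \<in> relations \<Longrightarrow> x + y \<in> relations"
  unfolding exact_sequence_relations_def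
  using generate.eng[of _ "add_monoid (free_tensor_ring C)"] by (simp add: free_tensor_ring_def)

lemma relations_uminus: "x \<in> relations \<Longrightarrow> - x \<in> relations"
proof (induction rule: relations_induct)
  case (exact_neg A f B g D)
  then show ?case using relations_exact by fastforce
next
  case (exact A f B g D)
  then show ?case
    unfolding exact_sequence_relations_def inv_free_tensor_ring[of C, symmetric]
    by (intro generate.inv) blast
next
  case (add x y)
  then show ?case using relations_add[of "- x" "- y"] by simp
qed (simp add: relations_zero)

lemma relations_diff: "x \<in> relations \<Longrightarrow> y \<in> relations \<Longrightarrow> x - y \<in> relations"
  using relations_add[of x "- y"] relations_uminus[of y] by simp

abbreviation coset :: "('o \<Rightarrow>\<^sub>0 int) \<Rightarrow> ('o \<Rightarrow>\<^sub>0 int) set" where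
  "coset x \<equiv> relations +>\<^bsub>free_tensor_ring C\<^esub> x"

lemma coset_eq: "coset x = {y. y - x \<in> relations}"
proof -
  have "coset x = (\<lambda>r. r + x) ` relations"
    by (auto simp: a_r_coset_def r_coset_def free_tensor_ring_def)
  also have "\<dots> = {y. y - x \<in> relations}"
    by (force simp: algebra_simps)
  finally show ?thesis .
qed

lemma coset_eqI:
  assumes "x - y \<in> relations"
  shows "coset x = coset y"
proof -
  have "z - x \<in> relations \<longleftrightarrow> z - y \<in> relations" for z
    using relations_add[OF _ assms, of "z - x"] relations_diff[OF _ assms, of "z - y"] by auto
  then show ?thesis unfolding coset_eq by simp
qed

lemma coset_add: "coset x <+>\<^bsub>free_tensor_ring C\<^esub> coset y = coset (x + y)"
proof -
  have "coset x <+>\<^bsub>free_tensor_ring C\<^esub> coset y = {a + b |a b. a \<in> coset x \<and> b \<in> coset y}"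
    by (auto simp: set_add_def set_mult_def free_tensor_ring_def)
  also have "\<dots> = coset (x + y)"
  proof (intro equalityI subsetI)
    fix z assume "z \<in> {a + b |a b. a \<in> coset x \<and> b \<in> coset y}"
    then obtain a b where "z = a + b" "a - x \<in> relations" "b - y \<in> relations"
      unfolding coset_eq by blast
    then show "z \<in> coset (x + y)"
      using relations_add[of "a - x" "b - y"] unfolding coset_eq by (simp add: algebra_simps)
  next
    fix z assume "z \<in> coset (x + y)"
    then have "z - y \<in> coset x" "y \<in> coset y"
      using relations_zero unfolding coset_eq by (auto simp: algebra_simps)
    moreover have "z = (z - y) + y" by simp
    ultimately show "z \<in> {a + b |a b. a \<in> coset x \<and> b \<in> coset y}" by blast
  qed
  finally show ?thesis .
qed

end

section \<open>The relations absorb products, so the tensor product descends to cosets\<close>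

abbreviation tensor_bilinear ::
  "('k::field, 'o, 'm::ab_group_add) moncat \<Rightarrow> ('o \<Rightarrow>\<^sub>0 int) \<Rightarrow> ('o \<Rightarrow>\<^sub>0 int) \<Rightarrow> 'o \<Rightarrow>\<^sub>0 int" where
  "tensor_bilinear C x y \<equiv> x \<otimes>\<^bsub>free_tensor_ring C\<^esub> y"

lemma tensor_bilinear_left:
  "tensor_bilinear C (x + x') y = tensor_bilinear C x y + tensor_bilinear C x' y"
  "tensor_bilinear C (x - x') y = tensor_bilinear C x y - tensor_bilinear C x' y"
  "tensor_bilinear C (- x) y = - tensor_bilinear C x y"
  "tensor_bilinear C 0 y = 0"
  by (auto simp: free_tensor_ring_def frag_extend_add frag_extend_diff frag_extend_minus)

lemma tensor_bilinear_right:
  "tensor_bilinear C x (y + y') = tensor_bilinear C x y + tensor_bilinear C x y'"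
  "tensor_bilinear C x (y - y') = tensor_bilinear C x y - tensor_bilinear C x y'"
  "tensor_bilinear C x (- y) = - tensor_bilinear C x y"
  "tensor_bilinear C x 0 = 0"
proof -
  \<comment> \<open>On this side y sits inside the function that the outer
    \<open>frag_extend\<close> extends, so additivity has to be pulled out of the defining
    sum.\<close>
  have add: "tensor_bilinear C x (y + y') = tensor_bilinear C x y + tensor_bilinear C x y'" for y y'
    by (simp add: free_tensor_ring_def frag_extend_add, simp add: frag_extend_def frag_cmul_distrib2 sum.distrib)
  show "tensor_bilinear C x (y + y') = tensor_bilinear C x y + tensor_bilinear C x y'" by (rule add)
  show z: "tensor_bilinear C x 0 = 0" using add[of 0 0] by simp
  show "tensor_bilinear C x (y - y') = tensor_bilinear C x y - tensor_bilinear C x y'"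
    using add[of "y - y'" y'] by simp
  show "tensor_bilinear C x (- y) = - tensor_bilinear C x y"
    using add[of y "- y"] z by (simp add: eq_neg_iff_add_eq_0 add.commute)
qed

lemma tensor_bilinear_of: "tensor_bilinear C (frag_of A) (frag_of B) = frag_of (A \<otimes>\<^sub>o\<^bsub>C\<^esub> B)"
  by (simp add: free_tensor_ring_def)

context symmetric_tensor_category
begin

lemma relations_iso:
  assumes "is_iso C A B f"
  shows "frag_of A - frag_of B \<in> relations"
proof -
  obtain Z where Z: "is_zero_obj C Z" using zero_obj_exists by blast
  have "is_inverse C Z Z 0 0"
    using Z zero_in_hom ident_in_hom[of Z] cmp_zero_left[OF zero_in_hom]
    unfolding is_inverse_def is_zero_obj_def by simp
  then have "is_iso C Z Z 0" by (auto simp: is_iso_def)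
  \<comment> \<open>The sequence Z, Z, Z makes -[Z] a relation. This removes the zero object that
    \<open>iso_short_exact\<close> introduces.\<close>
  then have "frag_of Z - (frag_of Z + frag_of Z) \<in> relations"
    using relations_exact[OF iso_short_exact[OF _ Z]] by blast
  then have "frag_of Z \<in> relations" using relations_uminus by fastforce
  moreover have "frag_of A - (frag_of Z + frag_of B) \<in> relations"
    using relations_exact[OF iso_short_exact[OF assms Z]] .
  ultimately have "(frag_of A - (frag_of Z + frag_of B)) + frag_of Z \<in> relations"
    by (rule relations_add[rotated])
  then show ?thesis by (simp add: algebra_simps)
qed

text \<open>Exactness of tensoring with Z sends a generating relation to another one. The other side
  follows from \<open>relations_commute\<close>, that is, from the braiding.\<close>

lemma relations_ideal_left:
  assumes "x \<in> relations"
  shows "tensor_bilinear C x y \<in> relations"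
proof (induction y rule: frag_induction[OF subset_UNIV])
  case 1
  then show ?case using relations_zero by (simp add: tensor_bilinear_right)
next
  case (2 Z)
  have ex: "tensor_bilinear C (frag_of B - (frag_of A + frag_of D)) (frag_of Z) \<in> relations"
    if "short_exact C A f B g D" for A f B g D
    using relations_exact[OF short_exact_tmor[OF that]]
    by (simp add: tensor_bilinear_left tensor_bilinear_of)
  from assms show ?case
  proof (induction rule: relations_induct)
    case (exact_neg A f B g D)
    show ?case using relations_uminus[OF ex[OF exact_neg]] by (simp only: tensor_bilinear_left)
  qed (auto simp: relations_zero tensor_bilinear_left(1,4) relations_add ex)
next
  case (3 a b)
  then show ?case using relations_diff by (simp add: tensor_bilinear_right)
qed

lemma relations_commute: "tensor_bilinear C x y - tensor_bilinear C y x \<in> relations"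
proof (induction x rule: frag_induction[OF subset_UNIV])
  case 1
  then show ?case using relations_zero by (simp add: tensor_bilinear_right tensor_bilinear_left)
next
  case (2 A)
  show ?case
  proof (induction y rule: frag_induction[OF subset_UNIV])
    case 1
    then show ?case using relations_zero by (simp add: tensor_bilinear_right tensor_bilinear_left)
  next
    case (2 B)
    then show ?case using relations_iso[OF braiding_iso] by (simp add: tensor_bilinear_of)
  next
    case (3 a b)
    then show ?case using relations_diff[OF 3]
      by (simp add: tensor_bilinear_right tensor_bilinear_left algebra_simps)
  qed
next
  case (3 a b)
  then show ?case using relations_diff[OF 3]
    by (simp add: tensor_bilinear_right tensor_bilinear_left algebra_simps)
qed

lemma relations_ideal_right:
  assumes "y \<in> relations"
  shows "tensor_bilinear C x y \<in> relations"
  using relations_add[OF relations_commute[of x y] relations_ideal_left[OF assms, of x]] by simp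

text \<open>As the product on the free group is not associative, \<open>relations\<close> is not an
  ideal of a ring in the formal sense. The union in \<open>rcoset_mult\<close> is therefore computed
  directly: all its members are one and the same coset.\<close>

lemma coset_mult: "rcoset_mult (free_tensor_ring C) relations (coset x) (coset y) = coset (tensor_bilinear C x y)"
proof -
  have "coset (tensor_bilinear C a b) = coset (tensor_bilinear C x y)"
    if "a \<in> coset x" "b \<in> coset y" for a b
  proof (rule coset_eqI)
    have "tensor_bilinear C (a - x) b + tensor_bilinear C x (b - y) \<in> relations"
      using that relations_add relations_ideal_left relations_ideal_right unfolding coset_eq by simp
    then show "tensor_bilinear C a b - tensor_bilinear C x y \<in> relations"
      by (simp add: tensor_bilinear_left tensor_bilinear_right)
  qed
  moreover have "x \<in> coset x" "y \<in> coset y" using relations_zero by (auto simp: coset_eq)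
  ultimately show ?thesis unfolding rcoset_mult_def by blast
qed

end

text \<open>A character of the Grothendieck ring that is positive on simple objects, seen as a
  function on objects. The finiteness of the set of simple objects is included because every uniform
  bound below rests on it.\<close>

locale fp_dimension = symmetric_tensor_category + additive_dimension +
  assumes d_tensor: "d (A \<otimes>\<^sub>o B) = d A * d B"
    and d_unit: "d (unit_obj C) = 1"
    and d_simple_pos: "is_simple C S \<Longrightarrow> 0 < d S"
    and finite_simples: "finitely_many_simples C"
begin

lemma d_composition_series:
  assumes "composition_series C A Ss"
  shows "d A = (\<Sum>S\<leftarrow>Ss. d S) \<and> (\<forall>S\<in>set Ss. is_simple C S)"
  using assms
proof (induction rule: composition_series.induct)
  case (1 Z)
  then show ?case using d_zero_obj by simp
next
  case (2 A Ss S f B g)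
  then show ?case using d_short_exact[OF 2(3)] by simp
qed

sublocale nonneg_dimension
proof
  fix A
  obtain Ss where "composition_series C A Ss"
    using objects_finite_length by (auto simp: finite_length_def)
  then show "0 \<le> d A"
    using d_composition_series d_simple_pos by (fastforce intro!: sum_list_nonneg)
qed

lemma finite_d_simples: "finite (d ` Collect (is_simple C))"
proof -
  obtain F where F: "finite F" "\<forall>S. is_simple C S \<longrightarrow> (\<exists>T\<in>F. isomorphic C S T)"
    using finite_simples by (auto simp: finitely_many_simples_def)
  then have "d ` Collect (is_simple C) \<subseteq> d ` F"
    using d_iso by (fastforce simp: isomorphic_def)
  then show ?thesis using F(1) finite_subset by blast
qed

lemma d_simple_lower:
  obtains \<epsilon> where "0 < \<epsilon>" "\<And>S. is_simple C S \<Longrightarrow> \<epsilon> \<le> d S"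
proof
  \<comment> \<open>The element 1 keeps the set nonempty whatever the simple objects are.\<close>
  let ?D = "insert 1 (d ` Collect (is_simple C))"
  show "0 < Min ?D" using finite_d_simples d_simple_pos by (subst Min_gr_iff) auto
  show "Min ?D \<le> d S" if "is_simple C S" for S using finite_d_simples that by (intro Min_le) auto
qed

lemma d_simple_upper:
  obtains R where "1 \<le> R" "\<And>S. is_simple C S \<Longrightarrow> d S \<le> R"
proof
  \<comment> \<open>Here the 1 also ensures 1 \<le> R, so that powers of R are monotone.\<close>
  let ?D = "insert 1 (d ` Collect (is_simple C))"
  show "1 \<le> Max ?D" using finite_d_simples by (intro Max_ge) auto
  show "d S \<le> Max ?D" if "is_simple C S" for S using finite_d_simples that by (intro Max_ge) auto
qed

lemma d_lower:
  obtains \<epsilon> where "0 < \<epsilon>" "\<And>A. d A \<noteq> 0 \<Longrightarrow> \<epsilon> \<le> d A"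
proof -
  obtain \<epsilon> where e: "0 < \<epsilon>" "\<And>S. is_simple C S \<Longrightarrow> \<epsilon> \<le> d S" using d_simple_lower by blast
  have "\<epsilon> \<le> d A" if A: "d A \<noteq> 0" for A
  proof -
    obtain Ss where "composition_series C A Ss"
      using objects_finite_length by (auto simp: finite_length_def)
    then have s: "d A = (\<Sum>S\<leftarrow>Ss. d S)" "\<forall>S\<in>set Ss. is_simple C S" using d_composition_series by auto
    then obtain S Ss' where "Ss = S # Ss'" using A by (cases Ss) auto
    moreover have "0 \<le> (\<Sum>S\<leftarrow>Ss'. d S)" by (rule sum_list_nonneg) (auto simp: d_nonneg)
    ultimately show ?thesis using s e(2)[of S] by simp
  qed
  then show ?thesis using e(1) that by blast
qed

lemma d_tpow: "d (tpow C X n) = d X ^ n"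
  by (induction n) (auto simp: d_unit d_tensor)

end

text \<open>Tensor power trick. On simple objects d is at most c times d', with c the quotient of an
  upper bound for d by a lower bound for d'; by a composition series the same holds for all objects.
  For the n-th tensor power of X this reads \<open>d X ^ n \<le> c * d' X ^ n\<close>, and letting n
  grow removes the constant. Applied in both directions it shows that the character is
  unique.\<close>

lemma fp_dimension_le:
  assumes "fp_dimension C d" "fp_dimension C d'"
  shows "d X \<le> d' X"
proof (rule ccontr)
  interpret a: fp_dimension C d by (rule assms(1))
  interpret b: fp_dimension C d' by (rule assms(2))
  assume gt: "\<not> d X \<le> d' X"
  obtain R where R: "1 \<le> R" "\<And>S. is_simple C S \<Longrightarrow> d S \<le> R" using a.d_simple_upper by blast
  obtain \<epsilon> where e: "0 < \<epsilon>" "\<And>S. is_simple C S \<Longrightarrow> \<epsilon> \<le> d' S" using b.d_simple_lower by blast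
  define c where "c = R / \<epsilon>"
  have "d S \<le> c * d' S" if "is_simple C S" for S
  proof -
    have "R * \<epsilon> \<le> R * d' S" using e(2)[OF that] R(1) by simp
    then have "R \<le> c * d' S" using e(1) by (simp add: c_def field_simps)
    then show ?thesis using R(2)[OF that] by simp
  qed
  then have sum_le: "(\<Sum>S\<leftarrow>Ss. d S) \<le> c * (\<Sum>S\<leftarrow>Ss. d' S)" if "\<forall>S\<in>set Ss. is_simple C S" for Ss
    using that by (induction Ss) (auto simp: algebra_simps add_mono)
  have le: "d Y \<le> c * d' Y" for Y
  proof -
    obtain Ss where "composition_series C Y Ss"
      using a.objects_finite_length by (auto simp: finite_length_def)
    then show ?thesis using a.d_composition_series b.d_composition_series sum_le by metis
  qed
  have pow: "d X ^ n \<le> c * d' X ^ n" for n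
    using le[of "tpow C X n"] a.d_tpow b.d_tpow by simp
  have "d' X > 0"
    using pow[of 1] gt b.d_nonneg[of X] by (cases "d' X = 0") auto
  then have "1 < d X / d' X" using gt by simp
  then obtain n where "c < (d X / d' X) ^ n" using real_arch_pow by blast
  then show False using pow[of n] \<open>d' X > 0\<close> by (simp add: power_divide field_simps)
qed

context symmetric_tensor_category
begin

text \<open>H pulls the character back to the free group on the objects, where additivity on short
  exact sequences is the vanishing of H on \<open>relations\<close>.\<close>

lemma FP_character_dimension:
  assumes h: "is_FP_character C h" and fin: "finitely_many_simples C"
  shows "fp_dimension C (\<lambda>X. h (Grothendieck_class C X))"
proof -
  define H where "H x = h (coset x)" for x
  have car: "coset x \<in> carrier (Grothendieck_ring C)" for x
    by (auto simp: Grothendieck_ring_def FactRing_def A_RCOSETS_def RCOSETS_def a_r_coset_def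
        free_tensor_ring_def)
  have hom: "h \<in> ring_hom (Grothendieck_ring C) real_ring" using h by (simp add: is_FP_character_def)
  have H_add: "H (x + y) = H x + H y" for x y
    using ring_hom_add[OF hom car[of x] car[of y]] coset_add[of x y]
    by (simp add: H_def Grothendieck_ring_def FactRing_def real_ring_def)
  have H_mult: "H (tensor_bilinear C x y) = H x * H y" for x y
    using ring_hom_mult[OF hom car[of x] car[of y]] coset_mult[of x y]
    by (simp add: H_def Grothendieck_ring_def FactRing_def real_ring_def)
  have H_one: "H (frag_of (unit_obj C)) = 1"
    using ring_hom_one[OF hom]
    by (simp add: H_def Grothendieck_ring_def FactRing_def real_ring_def free_tensor_ring_def)
  have H_rel: "H x = 0" if "x \<in> relations" for x
  proof -
    have "H 0 = 0" using H_add[of 0 0] by simp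
    moreover have "H x = H 0" unfolding H_def using coset_eqI[of x 0] that by simp
    ultimately show ?thesis by simp
  qed
  have cls: "h (Grothendieck_class C X) = H (frag_of X)" for X
    by (simp add: H_def Grothendieck_class_def)
  show ?thesis
  proof (unfold_locales, unfold cls)
    fix A f B g D assume "short_exact C A f B g D"
    then have "H (frag_of B - (frag_of A + frag_of D)) = 0" using H_rel relations_exact by blast
    then show "H (frag_of B) = H (frag_of A) + H (frag_of D)"
      using H_add[of "frag_of B - (frag_of A + frag_of D)" "frag_of A + frag_of D"] H_add by simp
  next
    show "H (frag_of (A \<otimes>\<^sub>o B)) = H (frag_of A) * H (frag_of B)" for A B
      using H_mult[of "frag_of A" "frag_of B"] by (simp add: tensor_bilinear_of)
    show "0 < H (frag_of S)" if "is_simple C S" for S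
      using h that cls unfolding is_FP_character_def by metis
  qed (use H_one fin in auto)
qed

text \<open>If a character exists, all characters agree on classes of objects, so \<open>THE\<close>
  returns its value. If none exists, the predicate under \<open>THE\<close> is false for every
  object, so the description has the same value everywhere.\<close>

lemma FPdim_dichotomy:
  assumes fin: "finitely_many_simples C"
  shows "fp_dimension C (FPdim C) \<or> (\<exists>c. \<forall>X. FPdim C X = c)"
proof (cases "\<exists>h. is_FP_character C h")
  case True
  then obtain h where h: "is_FP_character C h" by blast
  have "FPdim C X = h (Grothendieck_class C X)" for X
    unfolding FPdim_def
  proof (rule the_equality)
    fix e assume "\<exists>h'. is_FP_character C h' \<and> e = h' (Grothendieck_class C X)"
    then obtain h' where h': "is_FP_character C h'" "e = h' (Grothendieck_class C X)" by blast
    then show "e = h (Grothendieck_class C X)"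
      using fp_dimension_le[OF FP_character_dimension[OF h fin] FP_character_dimension[OF h'(1) fin], of X]
        fp_dimension_le[OF FP_character_dimension[OF h'(1) fin] FP_character_dimension[OF h fin], of X]
      by simp
  qed (use h in blast)
  then have "FPdim C = (\<lambda>X. h (Grothendieck_class C X))" by blast
  then show ?thesis using FP_character_dimension[OF h fin] by simp
next
  case False
  then show ?thesis unfolding FPdim_def by simp
qed

end

section \<open>Growth of ranks in a ranked commutative monoid\<close>

text \<open>
  The axioms are those of the homogeneous subobjects of a graded commutative algebra, with \<open>le\<close>
  the inclusion. In \<open>rk_square\<close>, \<open>F' G' / (F G' + F' G)\<close> is a quotient of
  \<open>(F' / F) \<otimes> (G' / G)\<close>.
\<close>

lemma sum_UN_le:
  fixes f :: "'a \<Rightarrow> real"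
  assumes "finite K" "\<And>k. k \<in> K \<Longrightarrow> finite (A k)" "\<And>k x. k \<in> K \<Longrightarrow> x \<in> A k \<Longrightarrow> 0 \<le> f x"
  shows "sum f (\<Union>k\<in>K. A k) \<le> (\<Sum>k\<in>K. sum f (A k))"
  using assms
proof (induction K rule: finite_induct)
  case (insert k K)
  have "sum f (A k \<union> (\<Union>k\<in>K. A k)) + sum f (A k \<inter> (\<Union>k\<in>K. A k)) = sum f (A k) + sum f (\<Union>k\<in>K. A k)"
    using insert.hyps insert.prems(1) by (intro sum.union_inter) auto
  moreover have "0 \<le> sum f (A k \<inter> (\<Union>k\<in>K. A k))" using insert.prems(2) by (intro sum_nonneg) auto
  moreover have "sum f (\<Union>k\<in>K. A k) \<le> (\<Sum>k\<in>K. sum f (A k))" using insert.IH insert.prems by blast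
  ultimately show ?case using insert.hyps by simp
qed simp

locale ranked_comm_monoid = comm_monoid M for M (structure) +
  fixes le :: "'a \<Rightarrow> 'a \<Rightarrow> bool" (infix \<open>\<preceq>\<close> 50) and rk :: "'a \<Rightarrow> real"
  assumes le_refl: "U \<preceq> U"
    and le_mult: "U \<in> carrier M \<Longrightarrow> V \<in> carrier M \<Longrightarrow> W \<in> carrier M \<Longrightarrow> U \<preceq> V \<Longrightarrow> U \<otimes> W \<preceq> V \<otimes> W"
    and rk_nonneg: "U \<in> carrier M \<Longrightarrow> 0 \<le> rk U"
    and rk_mono: "U \<in> carrier M \<Longrightarrow> V \<in> carrier M \<Longrightarrow> U \<preceq> V \<Longrightarrow> rk U \<le> rk V"
    and rk_one: "rk \<one> \<le> 1"
    and rk_mult: "U \<in> carrier M \<Longrightarrow> V \<in> carrier M \<Longrightarrow> rk (U \<otimes> V) \<le> rk U * rk V"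
    and rk_mult_diff: "H \<in> carrier M \<Longrightarrow> F \<in> carrier M \<Longrightarrow> G \<in> carrier M \<Longrightarrow> F \<preceq> G \<Longrightarrow>
       rk (H \<otimes> G) \<le> rk (H \<otimes> F) + rk H * (rk G - rk F)"
    and rk_square: "F \<in> carrier M \<Longrightarrow> F' \<in> carrier M \<Longrightarrow> G \<in> carrier M \<Longrightarrow> G' \<in> carrier M \<Longrightarrow>
       K \<in> carrier M \<Longrightarrow> F \<preceq> F' \<Longrightarrow> G \<preceq> G' \<Longrightarrow> F \<otimes> G' \<preceq> K \<Longrightarrow> F' \<otimes> G \<preceq> K \<Longrightarrow>
       rk (F' \<otimes> G') \<le> rk K + (rk F' - rk F) * (rk G' - rk G)"
begin

text \<open>One factor G is traded for F. In the induction step \<open>rk_square\<close> is applied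
  to H F G^m \<preceq> H G^(m+1) and F \<preceq> G. By commutativity both mixed products are K = H F
  G^(m+1), so each further factor G multiplies the error by at most R.\<close>

lemma rk_pow_exchange:
  assumes H: "H \<in> carrier M" and F: "F \<in> carrier M" and G: "G \<in> carrier M"
    and le: "F \<preceq> G" and R: "rk G \<le> rk F + R"
  shows "rk (H \<otimes> G [^] Suc m) \<le> rk (H \<otimes> F \<otimes> G [^] m) + rk H * R ^ Suc m"
proof (induction m)
  case 0
  have "rk H * (rk G - rk F) \<le> rk H * R" using R rk_nonneg[OF H] by (intro mult_left_mono) auto
  then show ?case using rk_mult_diff[OF H F G le] H F G by simp
next
  case (Suc m)
  let ?F = "H \<otimes> F \<otimes> G [^] m" and ?F' = "H \<otimes> G [^] Suc m" and ?K = "H \<otimes> F \<otimes> G [^] Suc m"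
  have c: "?F \<in> carrier M" "?F' \<in> carrier M" "?K \<in> carrier M" using H F G by auto
  have e1: "?F \<otimes> G = ?K" and e2: "?F' \<otimes> F = ?K" using H F G by (simp_all add: m_ac)
  have "F \<otimes> (H \<otimes> G [^] m) \<preceq> G \<otimes> (H \<otimes> G [^] m)" using le_mult[OF F G _ le] H G by simp
  then have l: "?F \<preceq> ?F'" using H F G by (simp add: m_ac)
  have "rk (?F' \<otimes> G) \<le> rk ?K + (rk ?F' - rk ?F) * (rk G - rk F)"
    using rk_square[OF c(1,2) F G c(3) l le] le_refl e1 e2 by simp
  also have "\<dots> \<le> rk ?K + (rk H * R ^ Suc m) * R"
    using Suc R rk_mono[OF c(1,2) l] rk_mono[OF F G le] rk_nonneg[OF H]
    by (intro add_left_mono mult_mono) auto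
  also have "?F' \<otimes> G = H \<otimes> G [^] Suc (Suc m)" using H G by (simp add: m_assoc)
  finally show ?case by (simp only: mult.assoc power_Suc2)
qed

text \<open>The exchange is iterated with H = F^i: each round moves one factor into the power of F
  and leaves one error term. The general i is what makes the induction on n go through.\<close>

lemma rk_pow_sum:
  assumes F: "F \<in> carrier M" and G: "G \<in> carrier M" and le: "F \<preceq> G" and R: "rk G \<le> rk F + R"
  shows "rk (F [^] i \<otimes> G [^] n) \<le> (\<Sum>j\<le>n. rk (F [^] (i + j)) * R ^ (n - j))"
proof (induction n arbitrary: i)
  case 0
  then show ?case using F by simp
next
  case (Suc n)
  have "rk (F [^] i \<otimes> G [^] Suc n) \<le> rk (F [^] i \<otimes> F \<otimes> G [^] n) + rk (F [^] i) * R ^ Suc n"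
    using rk_pow_exchange[OF _ F G le R] F by blast
  also have "rk (F [^] i \<otimes> F \<otimes> G [^] n) \<le> (\<Sum>j\<le>n. rk (F [^] (Suc i + j)) * R ^ (n - j))"
    using Suc[of "Suc i"] by simp
  also have "(\<Sum>j\<le>n. rk (F [^] (Suc i + j)) * R ^ (n - j)) + rk (F [^] i) * R ^ Suc n
      = (\<Sum>j\<le>Suc n. rk (F [^] (i + j)) * R ^ (Suc n - j))"
    unfolding sum.atMost_Suc_shift[of _ n] by simp
  finally show ?case by simp
qed

text \<open>The sum from \<open>rk_pow_sum\<close> has n + 1 terms, each at most (n + 1)^k R^n, so
  enlarging F to G costs exactly one degree of the polynomial.\<close>

lemma poly_growth_step:
  assumes F: "F \<in> carrier M" and G: "G \<in> carrier M" and le: "F \<preceq> G" and R: "rk G \<le> rk F + R" "1 \<le> R"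
    and growth: "\<And>n. rk (F [^] (n::nat)) \<le> real (n + 1) ^ k * R ^ n"
  shows "rk (G [^] (n::nat)) \<le> real (n + 1) ^ Suc k * R ^ n"
proof -
  have "rk (G [^] n) \<le> (\<Sum>j\<le>n. rk (F [^] j) * R ^ (n - j))"
    using rk_pow_sum[OF F G le R(1), of 0 n] G by simp
  also have "\<dots> \<le> (\<Sum>j\<le>n. real (n + 1) ^ k * R ^ n)"
  proof (rule sum_mono)
    fix j assume j: "j \<in> {..n}"
    have "rk (F [^] j) * R ^ (n - j) \<le> real (j + 1) ^ k * R ^ j * R ^ (n - j)"
      using growth[of j] R by (intro mult_right_mono) auto
    also have "\<dots> = real (j + 1) ^ k * R ^ n" using j by (simp add: mult.assoc power_add[symmetric])
    also have "\<dots> \<le> real (n + 1) ^ k * R ^ n"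
      using j R by (intro mult_right_mono power_mono) auto
    finally show "rk (F [^] j) * R ^ (n - j) \<le> real (n + 1) ^ k * R ^ n" .
  qed
  finally show ?thesis by (simp add: mult.assoc)
qed

text \<open>Positive powers have rank 0, while the power 0 is the unit; this is where
  \<open>rk_one\<close> is used with constant 1.\<close>

lemma zero_growth:
  assumes U: "U \<in> carrier M" "rk U = 0" and R: "1 \<le> R"
  shows "rk (U [^] (n::nat)) \<le> real (n + 1) ^ 0 * R ^ n"
proof (cases n)
  case 0
  then show ?thesis using rk_one by simp
next
  case (Suc m)
  then have "rk (U [^] n) \<le> 0" using rk_mult[of "U [^] m" U] U by simp
  moreover have "0 \<le> R ^ n" using R by simp
  ultimately show ?thesis by simp
qed

text \<open>Products of powers of the listed elements, where (e, G) gives G the weight e, of total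
  weight m. The bound k \<le> m follows from k * e \<le> m if e > 0, and it keeps the set finite if
  e = 0.\<close>

fun monomials :: "(nat \<times> 'a) list \<Rightarrow> nat \<Rightarrow> 'a set" where
  "monomials [] m = (if m = 0 then {\<one>} else {})"
| "monomials ((e, G) # gs) m = (\<Union>k\<in>{k. k \<le> m \<and> k * e \<le> m}. (\<lambda>V. G [^] k \<otimes> V) ` monomials gs (m - k * e))"

lemma monomials_carrier:
  "(\<forall>(e, G)\<in>set gs. G \<in> carrier M) \<Longrightarrow> monomials gs m \<subseteq> carrier M"
proof (induction gs arbitrary: m)
  case (Cons g gs)
  obtain e G where g: "g = (e, G)" by (cases g)
  have "G [^] k \<otimes> V \<in> carrier M" if "V \<in> monomials gs j" for k :: nat and V j
    using Cons.IH[of j] Cons.prems that unfolding g by auto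
  then show ?case unfolding g by auto
qed simp

lemma one_in_monomials: "\<one> \<in> monomials gs 0"
proof (induction gs)
  case (Cons g gs)
  obtain e G where g: "g = (e, G)" by (cases g)
  have "(\<lambda>V. G [^] (0::nat) \<otimes> V) \<one> \<in> (\<lambda>V. G [^] (0::nat) \<otimes> V) ` monomials gs 0"
    using Cons by (rule imageI)
  then show ?case using g by simp
qed simp

lemma monomials_mult:
  assumes "\<forall>(e, G)\<in>set gs. G \<in> carrier M \<and> 0 < e" "(e, G) \<in> set gs" "U \<in> monomials gs m"
  shows "U \<otimes> G \<in> monomials gs (m + e)"
  using assms
proof (induction gs arbitrary: m U)
  case (Cons g gs)
  obtain e' G' where g: "g = (e', G')" by (cases g)
  have G: "G \<in> carrier M" "0 < e" and G': "G' \<in> carrier M" using Cons.prems g by auto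
  have gs: "\<forall>(e, G)\<in>set gs. G \<in> carrier M \<and> 0 < e" using Cons.prems by auto
  obtain k V where k: "k \<le> m" "k * e' \<le> m" "V \<in> monomials gs (m - k * e')" "U = G' [^] k \<otimes> V"
    using Cons.prems(3) g by auto
  have V: "V \<in> carrier M" using monomials_carrier[of gs] gs k(3) by auto
  show ?case
  proof (cases "(e, G) = g")
    case True
    then have "U \<otimes> G = G' [^] Suc k \<otimes> V" using g k(4) V G' by (simp add: m_ac)
    moreover have "V \<in> monomials gs (m + e - Suc k * e')" using True g k by (simp add: algebra_simps)
    \<comment> \<open>The exponent grows by 1 and the degree by e, so the bound on the exponent
      survives because e is positive.\<close>
    moreover have "Suc k \<le> m + e" "Suc k * e' \<le> m + e" using k G(2) True g by auto
    ultimately show ?thesis unfolding g by (auto intro!: bexI[of _ "Suc k"])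
  next
    case False
    then have "V \<otimes> G \<in> monomials gs (m - k * e' + e)"
      using Cons.IH[OF gs _ k(3)] Cons.prems(2) by auto
    moreover have "m - k * e' + e = m + e - k * e'" using k by simp
    moreover have "U \<otimes> G = G' [^] k \<otimes> (V \<otimes> G)" using k(4) V G G' by (simp add: m_assoc)
    ultimately have "U \<otimes> G \<in> (\<lambda>V. G' [^] k \<otimes> V) ` monomials gs (m + e - k * e')" by auto
    moreover have "k \<le> m + e" "k * e' \<le> m + e" using k by auto
    ultimately show ?thesis unfolding g by auto
  qed
qed simp

lemma finite_monomials: "finite (monomials gs m)"
  by (induction gs m rule: monomials.induct) auto

end

locale poly_growth_monoid = ranked_comm_monoid +
  fixes R :: real
  assumes R_ge_1: "1 \<le> R"
    and poly_growth: "U \<in> carrier M \<Longrightarrow> \<exists>k. \<forall>n::nat. rk (U [^] n) \<le> real (n + 1) ^ k * R ^ n"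
begin

text \<open>The bound \<open>R\<close> is uniform in \<open>U\<close>, so it applies to \<open>U [^] p\<close> and improves to its \<open>p\<close>-th root.\<close>

lemma subexponential_pow:
  assumes U: "U \<in> carrier M" and \<rho>: "1 < \<rho>"
  obtains c k where "0 \<le> c" "\<And>n::nat. rk (U [^] n) \<le> c * real (n + 1) ^ k * \<rho> ^ n"
proof -
  obtain p' where "R < \<rho> ^ p'" using real_arch_pow[OF \<rho>] by blast
  \<comment> \<open>The successor makes the exponent positive, so that n can be divided by
    it.\<close>
  then have "R \<le> \<rho> ^ Suc p'" using \<rho> power_increasing[of p' "Suc p'" \<rho>] by linarith
  then obtain p where p: "0 < p" "R \<le> \<rho> ^ p" by blast
  obtain k where k: "\<And>n::nat. rk ((U [^] p) [^] n) \<le> real (n + 1) ^ k * R ^ n"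
    using poly_growth[of "U [^] p"] U by auto
  \<comment> \<open>The remainder of n modulo p only takes the values s < p and is absorbed into
    this constant; the quotient is governed by the bound for the powers of
    \<open>U [^] p\<close>.\<close>
  define c where "c = Max ((\<lambda>s. rk (U [^] s)) ` {..<p})"
  have c: "rk (U [^] s) \<le> c" if "s < p" for s unfolding c_def using that by (intro Max_ge) auto
  have c0: "0 \<le> c" using c[OF p(1)] rk_nonneg[of "U [^] (0::nat)"] by simp
  have "rk (U [^] n) \<le> c * real (n + 1) ^ k * \<rho> ^ n" for n
  proof -
    define q s where "q = n div p" and "s = n mod p"
    have n: "n = p * q + s" "s < p" using p by (auto simp: q_def s_def)
    have "U [^] n = (U [^] p) [^] q \<otimes> U [^] s" using U by (simp add: n(1) nat_pow_mult nat_pow_pow)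
    then have "rk (U [^] n) \<le> rk ((U [^] p) [^] q) * rk (U [^] s)" using rk_mult U by simp
    also have "\<dots> \<le> (real (q + 1) ^ k * R ^ q) * c"
      using k c[OF n(2)] c0 rk_nonneg U R_ge_1 by (intro mult_mono) auto
    also have "\<dots> \<le> (real (n + 1) ^ k * \<rho> ^ n) * c"
    proof (intro mult_right_mono mult_mono c0)
      have "q \<le> n" by (simp add: q_def)
      then show "real (q + 1) ^ k \<le> real (n + 1) ^ k" by (intro power_mono) auto
      have "R ^ q \<le> (\<rho> ^ p) ^ q" using p R_ge_1 by (intro power_mono) auto
      also have "\<dots> \<le> \<rho> ^ n" unfolding power_mult[symmetric] using n \<rho> by (intro power_increasing) auto
      finally show "R ^ q \<le> \<rho> ^ n" .
    qed (use R_ge_1 in auto)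
    finally show ?thesis by (simp add: mult_ac)
  qed
  then show ?thesis using that c0 by blast
qed

text \<open>Induction on the list. If G has exponent k and the remaining factors have degree j, then
  e > 0 gives k + j \<le> m, so the two exponential factors combine to at most \<rho>^m. The
  polynomial degrees add up, plus one for the at most m + 1 choices of k.\<close>

lemma subexponential_monomials:
  assumes "1 < \<rho>" "\<forall>(e, G)\<in>set gs. G \<in> carrier M \<and> 0 < e"
  shows "\<exists>c k. 0 \<le> c \<and> (\<forall>m. (\<Sum>U\<in>monomials gs m. rk U) \<le> c * real (m + 1) ^ k * \<rho> ^ m)"
  using assms(2)
proof (induction gs)
  case Nil
  show ?case using rk_one by (intro exI[of _ 1] exI[of _ 0]) (use assms(1) in \<open>auto intro: order_trans\<close>)
next
  case (Cons g gs)
  obtain e G where g: "g = (e, G)" by (cases g)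
  have G: "G \<in> carrier M" and e: "0 < e" using Cons.prems g by auto
  have gs: "\<forall>(e, G)\<in>set gs. G \<in> carrier M \<and> 0 < e" using Cons.prems by auto
  have mc: "V \<in> carrier M" if "V \<in> monomials gs j" for V j using monomials_carrier[of gs] gs that by auto
  obtain c1 a where c1: "0 \<le> c1" "\<And>k::nat. rk (G [^] k) \<le> c1 * real (k + 1) ^ a * \<rho> ^ k"
    using subexponential_pow[OF G assms(1)] by blast
  obtain c2 b where c2: "0 \<le> c2" "\<And>m. (\<Sum>U\<in>monomials gs m. rk U) \<le> c2 * real (m + 1) ^ b * \<rho> ^ m"
    using Cons.IH gs by blast
  have "(\<Sum>U\<in>monomials (g # gs) m. rk U) \<le> (c1 * c2) * real (m + 1) ^ Suc (a + b) * \<rho> ^ m" for m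
  proof -
    let ?K = "{k. k \<le> m \<and> k * e \<le> m}"
    have fK: "finite ?K" by (rule finite_subset[of _ "{..m}"]) auto
    have cK: "card ?K \<le> m + 1" using card_mono[of "{..m}" ?K] by auto
    have term_le: "(\<Sum>U\<in>(\<lambda>V. G [^] k \<otimes> V) ` monomials gs (m - k * e). rk U)
        \<le> (c1 * c2) * real (m + 1) ^ (a + b) * \<rho> ^ m" if k: "k \<in> ?K" for k
    proof -
      define j where "j = m - k * e"
      let ?N = "monomials gs j"
      have "k \<le> k * e" "k * e \<le> m" and km: "k \<le> m" using e k by (cases e, auto)
      then have kj: "k + j \<le> m" unfolding j_def by linarith
      have "(\<Sum>U\<in>(\<lambda>V. G [^] k \<otimes> V) ` ?N. rk U) \<le> (\<Sum>V\<in>?N. rk (G [^] k \<otimes> V))"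
        using sum_image_le[OF finite_monomials, of gs j rk "\<lambda>V. G [^] k \<otimes> V"] rk_nonneg G mc
        by (auto simp: comp_def)
      also have "\<dots> \<le> (\<Sum>V\<in>?N. rk (G [^] k) * rk V)" using rk_mult G mc by (intro sum_mono) auto
      also have "\<dots> = rk (G [^] k) * (\<Sum>V\<in>?N. rk V)" by (simp add: sum_distrib_left)
      also have "\<dots> \<le> (c1 * real (k + 1) ^ a * \<rho> ^ k) * (c2 * real (j + 1) ^ b * \<rho> ^ j)"
        using c1 c2(2) rk_nonneg mc G assms(1) by (intro mult_mono sum_nonneg) auto
      also have "\<dots> = (c1 * c2) * (real (k + 1) ^ a * real (j + 1) ^ b) * (\<rho> ^ k * \<rho> ^ j)"
        by (simp add: mult_ac)
      also have "\<dots> \<le> (c1 * c2) * (real (m + 1) ^ a * real (m + 1) ^ b) * \<rho> ^ m"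
      proof (intro mult_mono mult_left_mono power_mono)
        show "\<rho> ^ k * \<rho> ^ j \<le> \<rho> ^ m"
          unfolding power_add[symmetric] using assms(1) kj by (intro power_increasing) auto
      qed (use kj km c1 c2 assms(1) in auto)
      finally have "(\<Sum>U\<in>(\<lambda>V. G [^] k \<otimes> V) ` ?N. rk U) \<le> (c1 * c2) * real (m + 1) ^ (a + b) * \<rho> ^ m"
        by (simp only: power_add)
      then show ?thesis unfolding j_def .
    qed
    have "(\<Sum>U\<in>monomials (g # gs) m. rk U)
        \<le> (\<Sum>k\<in>?K. \<Sum>U\<in>(\<lambda>V. G [^] k \<otimes> V) ` monomials gs (m - k * e). rk U)"
      unfolding g monomials.simps using rk_nonneg G mc
      by (intro sum_UN_le fK) (auto simp: finite_monomials)
    also have "\<dots> \<le> (\<Sum>k\<in>?K. (c1 * c2) * real (m + 1) ^ (a + b) * \<rho> ^ m)"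
      by (rule sum_mono) (rule term_le)
    also have "\<dots> = real (card ?K) * ((c1 * c2) * real (m + 1) ^ (a + b) * \<rho> ^ m)" by simp
    also have "\<dots> \<le> real (m + 1) * ((c1 * c2) * real (m + 1) ^ (a + b) * \<rho> ^ m)"
      using cK c1 c2 assms(1) by (intro mult_right_mono) auto
    finally show ?thesis by (simp add: mult_ac)
  qed
  then show ?case using c1(1) c2(1) by (intro exI[of _ "c1 * c2"] exI[of _ "Suc (a + b)"]) auto
qed

end

section \<open>Homogeneous subobjects of a commutative algebra\<close>

context linear_abelian_category
begin

lemma id_zero_zero_obj:
  assumes "ident C Z = 0"
  shows "is_zero_obj C Z"
proof -
  have "f = 0" if "f \<in> Hom Z A" for f A
    using cmp_ident_right[OF that] cmp_zero_right[OF that] assms by simp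
  moreover have "f = 0" if "f \<in> Hom A Z" for f A
    using cmp_ident_left[OF that] cmp_zero_left[OF that] assms by simp
  ultimately show ?thesis unfolding is_zero_obj_def using zero_in_hom by blast
qed

text \<open>In an abelian category f' is the kernel of its own cokernel, and by hypothesis that
  cokernel kills f.\<close>

lemma mono_dominated_factor:
  assumes f: "is_mono C W Z f" and f': "is_mono C W' Z f'"
    and le: "\<And>T t. t \<in> Hom Z T \<Longrightarrow> t \<cdot> f' = 0 \<Longrightarrow> t \<cdot> f = 0"
  obtains i where "is_mono C W W' i" "f' \<cdot> i = f"
proof -
  note fh = mono_in_hom[OF f] and fh' = mono_in_hom[OF f']
  obtain Q c where c: "is_cokernel C W' Z f' Q c" using cokernels[OF fh'] by blast
  have k: "is_kernel C Z Q c W' f'" using mono_short_exact[OF f' c] by (simp add: short_exact_def)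
  obtain i where i: "i \<in> Hom W W'" "f' \<cdot> i = f"
    using kernelE[OF k fh le[OF cokernel_in_hom(2,3)[OF c]]] by blast
  have "is_mono C W W' i"
  proof (rule monoI[OF i(1)])
    fix T t assume t: "t \<in> Hom T W" "i \<cdot> t = 0"
    then have "f \<cdot> t = 0" using cmp_assoc[OF t(1) i(1) fh'] i(2) cmp_zero_right[OF fh'] by simp
    then show "t = 0" using mono_eq_0[OF f t(1)] by simp
  qed
  then show ?thesis using that i(2) by blast
qed

end

context symmetric_tensor_category
begin

text \<open>By right exactness s factors in the first variable, giving u. Cancelling the epi
  \<open>p \<otimes>\<^sub>m ident C A'\<close> shows that u still kills the second subobject, so u
  factors in the second variable.\<close>

lemma factor_through_quotients:
  assumes p: "is_cokernel C A B i P p" and p': "is_cokernel C A' B' i' P' p'"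
    and s: "s \<in> Hom (B \<otimes>\<^sub>o B') T" "s \<cdot> (i \<otimes>\<^sub>m ident C B') = 0" "s \<cdot> (ident C B \<otimes>\<^sub>m i') = 0"
  obtains v where "v \<in> Hom (P \<otimes>\<^sub>o P') T" "s = v \<cdot> (p \<otimes>\<^sub>m p')"
proof -
  note h = cokernel_in_hom[OF p] and h' = cokernel_in_hom[OF p']
  note c1 = cokernel_tmor[OF p, of B'] and c2 = cokernel_id_tmor[OF p', of P]
  obtain u where u: "u \<in> Hom (P \<otimes>\<^sub>o B') T" "u \<cdot> (p \<otimes>\<^sub>m ident C B') = s"
    using cokernelE[OF c1 s(1,2)] by blast
  note ui = cmp_in_hom[OF id_tmor_in_hom[OF h'(1)] u(1)]
  have "(u \<cdot> (ident C P \<otimes>\<^sub>m i')) \<cdot> (p \<otimes>\<^sub>m ident C A') = u \<cdot> ((ident C P \<otimes>\<^sub>m i') \<cdot> (p \<otimes>\<^sub>m ident C A'))"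
    by (rule cmp_assoc[OF tmor_id_in_hom[OF h(2)] id_tmor_in_hom[OF h'(1)] u(1)])
  also have "\<dots> = u \<cdot> ((p \<otimes>\<^sub>m ident C B') \<cdot> (ident C B \<otimes>\<^sub>m i'))"
    using tmor_split[OF h(2) h'(1)] by simp
  also have "\<dots> = s \<cdot> (ident C B \<otimes>\<^sub>m i')"
    using cmp_assoc[OF id_tmor_in_hom[OF h'(1)] tmor_id_in_hom[OF h(2)] u(1)] u(2) by simp
  finally have "u \<cdot> (ident C P \<otimes>\<^sub>m i') = 0"
    using s(3) epi_eq_0[OF cokernel_epi[OF cokernel_tmor[OF p]] ui] by simp
  then obtain v where v: "v \<in> Hom (P \<otimes>\<^sub>o P') T" "v \<cdot> (ident C P \<otimes>\<^sub>m p') = u"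
    using cokernelE[OF c2 u(1)] by blast
  have "v \<cdot> (p \<otimes>\<^sub>m p') = s"
    unfolding tmor_split(2)[OF h(2) h'(2)]
    using cmp_assoc[OF tmor_id_in_hom[OF h(2)] id_tmor_in_hom[OF h'(2)] v(1)] u v by simp
  then show ?thesis using that v(1) by blast
qed

end

section \<open>The ranked commutative monoid of homogeneous subobjects\<close>

locale graded_commutative_algebra = fp_dimension C d
  for C :: "('k::field, 'o, 'm::ab_group_add) moncat" (structure) and d +
  fixes A :: "('o, 'm) graded_alg"
  assumes commutative_algebra: "is_commutative_graded_algebra C A"
begin

lemma gmul_in_hom: "gmul A i j \<in> Hom (gcomp A i \<otimes>\<^sub>o gcomp A j) (gcomp A (i + j))"
  and gone_in_hom: "gone A \<in> Hom (unit_obj C) (gcomp A 0)"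
  and gmul_assoc: "gmul A (i + j) k \<cdot> (gmul A i j \<otimes>\<^sub>m ident C (gcomp A k))
        = gmul A i (j + k) \<cdot> (ident C (gcomp A i) \<otimes>\<^sub>m gmul A j k) \<cdot>
            associator C (gcomp A i) (gcomp A j) (gcomp A k)"
  and gmul_one: "gmul A 0 i \<cdot> (gone A \<otimes>\<^sub>m ident C (gcomp A i)) = lunitor C (gcomp A i)"
  and gmul_comm: "gmul A j i \<cdot> braiding C (gcomp A i) (gcomp A j) = gmul A i j"
  using commutative_algebra
  by (auto simp: is_commutative_graded_algebra_def is_graded_algebra_def)

text \<open>
  The subobject spanned by \<open>f : Y \<rightarrow> A\<^sub>m\<close> is encoded, together with its degree, by the set of
  morphisms that vanish on it. As a morphism does not determine its target, the target is recorded.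
\<close>

definition ann :: "nat \<Rightarrow> 'm \<Rightarrow> ('o \<times> 'm) set" where
  "ann m f = {(T, t). t \<in> Hom (gcomp A m) T \<and> t \<cdot> f = 0}"

definition subobj :: "nat \<Rightarrow> 'm \<Rightarrow> nat \<times> ('o \<times> 'm) set" where
  "subobj m f = (m, ann m f)"

definition mult_map :: "nat \<Rightarrow> nat \<Rightarrow> 'm \<Rightarrow> 'm \<Rightarrow> 'm" where
  "mult_map i j f g = gmul A i j \<cdot> (f \<otimes>\<^sub>m g)"

text \<open>The description quantifies over all spanning morphisms; that the outcome does not depend
  on them is \<open>subobj_mult_eq\<close>.\<close>

definition subobj_mult where
  "subobj_mult U V = (THE W. \<exists>i j Y Y' f g. f \<in> Hom Y (gcomp A i) \<and> g \<in> Hom Y' (gcomp A j) \<and>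
     U = subobj i f \<and> V = subobj j g \<and> W = subobj (i + j) (mult_map i j f g))"

text \<open>Spanning morphisms are arbitrary rather than mono, so the carrier is closed under
  products without taking images. \<open>carrier_mono\<close> supplies a mono when one is
  wanted.\<close>

definition subobj_monoid :: "(nat \<times> ('o \<times> 'm) set) monoid" where
  "subobj_monoid = \<lparr>carrier = {subobj m f |m Y f. f \<in> Hom Y (gcomp A m)},
     mult = subobj_mult, one = subobj 0 (gone A)\<rparr>"

text \<open>A larger subobject is annihilated by fewer morphisms, hence the reversed
  inclusion.\<close>

definition subobj_le :: "nat \<times> ('o \<times> 'm) set \<Rightarrow> nat \<times> ('o \<times> 'm) set \<Rightarrow> bool" where
  "subobj_le U V \<longleftrightarrow> fst U = fst V \<and> snd V \<subseteq> snd U"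

definition subobj_rank :: "nat \<times> ('o \<times> 'm) set \<Rightarrow> real" where
  "subobj_rank U = (THE r. \<exists>m Y f. f \<in> Hom Y (gcomp A m) \<and> U = subobj m f \<and> r = rank Y (gcomp A m) f)"

lemma mult_map_in_hom:
  "f \<in> Hom Y (gcomp A i) \<Longrightarrow> g \<in> Hom Y' (gcomp A j) \<Longrightarrow>
     mult_map i j f g \<in> Hom (Y \<otimes>\<^sub>o Y') (gcomp A (i + j))"
  unfolding mult_map_def by (rule cmp_in_hom[OF tmor_in_hom gmul_in_hom])

lemma mult_map_cmp:
  assumes f: "f \<in> Hom Y (gcomp A i)" and g: "g \<in> Hom Y' (gcomp A j)" and u: "u \<in> Hom Z Y" and v: "v \<in> Hom Z' Y'"
  shows "mult_map i j (f \<cdot> u) (g \<cdot> v) = mult_map i j f g \<cdot> (u \<otimes>\<^sub>m v)"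
  unfolding mult_map_def tmor_cmp[OF u f v g]
  using cmp_assoc[OF tmor_in_hom[OF u v] tmor_in_hom[OF f g] gmul_in_hom] by simp

lemma ann_mem: "(T, t) \<in> ann m f \<longleftrightarrow> t \<in> Hom (gcomp A m) T \<and> t \<cdot> f = 0"
  by (simp add: ann_def)

lemma ann_cmp_epi:
  assumes f: "f \<in> Hom Y (gcomp A m)" and e: "is_epi C Z Y e"
  shows "ann m (f \<cdot> e) = ann m f"
proof -
  note eh = epi_in_hom[OF e]
  have "t \<cdot> (f \<cdot> e) = 0 \<longleftrightarrow> t \<cdot> f = 0" if t: "t \<in> Hom (gcomp A m) T" for t T
    using cmp_assoc[OF eh f t] epi_eq_0[OF e cmp_in_hom[OF f t]] cmp_zero_left[OF eh] by auto
  then show ?thesis unfolding ann_def by blast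
qed

text \<open>For fixed t and g, the composite of t with the product is
  \<open>s \<cdot> (f \<otimes>\<^sub>m ident C Y')\<close> with s independent of f, and s can be
  transposed. This is the substitute for dividing by g: it makes products well defined, and it peels
  the last letter off a word in \<open>generators\<close>.\<close>

lemma mult_map_annihilator:
  assumes t: "t \<in> Hom (gcomp A (i + j)) T" and g: "g \<in> Hom Y' (gcomp A j)"
  obtains T' t' where "t' \<in> Hom (gcomp A i) T'"
    "\<And>Y f. f \<in> Hom Y (gcomp A i) \<Longrightarrow> t \<cdot> mult_map i j f g = 0 \<longleftrightarrow> t' \<cdot> f = 0"
proof -
  define s where "s = (t \<cdot> gmul A i j) \<cdot> (ident C (gcomp A i) \<otimes>\<^sub>m g)"
  note tm = cmp_in_hom[OF gmul_in_hom t] and ig = id_tmor_in_hom[OF g, of "gcomp A i"]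
  have s: "s \<in> Hom (gcomp A i \<otimes>\<^sub>o Y') T" unfolding s_def by (rule cmp_in_hom[OF ig tm])
  obtain T' s' where s': "s' \<in> Hom (gcomp A i) T'"
    "\<And>W f. f \<in> Hom W (gcomp A i) \<Longrightarrow> s \<cdot> (f \<otimes>\<^sub>m ident C Y') = 0 \<longleftrightarrow> s' \<cdot> f = 0"
    using transpose_annihilator[OF s] by metis
  have "t \<cdot> mult_map i j f g = s \<cdot> (f \<otimes>\<^sub>m ident C Y')" if f: "f \<in> Hom Y (gcomp A i)" for f Y
    unfolding s_def mult_map_def
    using cmp_assoc[OF tmor_id_in_hom[OF f] ig tm] tmor_split(2)[OF f g]
      cmp_assoc[OF tmor_in_hom[OF f g] gmul_in_hom t] by simp
  then show ?thesis using that s' by simp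
qed

lemma mult_map_comm:
  assumes f: "f \<in> Hom Y (gcomp A i)" and g: "g \<in> Hom Y' (gcomp A j)"
  shows "ann (i + j) (mult_map i j f g) = ann (j + i) (mult_map j i g f)"
proof -
  note b = braiding_in_hom[of Y Y'] and b' = braiding_in_hom[of "gcomp A i" "gcomp A j"]
  have "mult_map i j f g = gmul A j i \<cdot> (braiding C (gcomp A i) (gcomp A j) \<cdot> (f \<otimes>\<^sub>m g))"
    unfolding mult_map_def gmul_comm[of j i, symmetric] by (rule cmp_assoc[OF tmor_in_hom[OF f g] b' gmul_in_hom])
  also have "\<dots> = mult_map j i g f \<cdot> braiding C Y Y'"
    unfolding mult_map_def braiding_natural[OF f g]
    using cmp_assoc[OF b tmor_in_hom[OF g f] gmul_in_hom] by simp
  finally have "ann (i + j) (mult_map i j f g) = ann (j + i) (mult_map j i g f \<cdot> braiding C Y Y')"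
    by (simp add: add.commute)
  then show ?thesis using ann_cmp_epi[OF mult_map_in_hom[OF g f] iso_epi[OF braiding_iso]] by simp
qed

lemma mult_map_mono_left:
  assumes f: "f \<in> Hom Y (gcomp A i)" "f' \<in> Hom Z (gcomp A i)" and le: "ann i f \<subseteq> ann i f'"
    and g: "g \<in> Hom Y' (gcomp A j)"
  shows "ann (i + j) (mult_map i j f g) \<subseteq> ann (i + j) (mult_map i j f' g)"
proof
  fix x assume x: "x \<in> ann (i + j) (mult_map i j f g)"
  obtain T t where Tt: "x = (T, t)" by (cases x)
  then have t: "t \<in> Hom (gcomp A (i + j)) T" "t \<cdot> mult_map i j f g = 0" using x by (auto simp: ann_mem)
  obtain T' t' where t': "t' \<in> Hom (gcomp A i) T'"
    "\<And>Y f. f \<in> Hom Y (gcomp A i) \<Longrightarrow> t \<cdot> mult_map i j f g = 0 \<longleftrightarrow> t' \<cdot> f = 0"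
    using mult_map_annihilator[OF t(1) g] by metis
  have "(T', t') \<in> ann i f" using t t' f by (auto simp: ann_mem)
  then have "(T', t') \<in> ann i f'" using le by blast
  then have "t' \<cdot> f' = 0" by (simp add: ann_mem)
  then show "x \<in> ann (i + j) (mult_map i j f' g)" using t t' f Tt by (auto simp: ann_mem)
qed

text \<open>Spanning morphisms are replaced one at a time. Only the left factor can be exchanged
  directly, so the right one is first moved to the left by commutativity.\<close>

lemma subobj_mult_eq:
  assumes f: "f \<in> Hom Y (gcomp A i)" and g: "g \<in> Hom Y' (gcomp A j)"
  shows "subobj_mult (subobj i f) (subobj j g) = subobj (i + j) (mult_map i j f g)"
  unfolding subobj_mult_def
proof (rule the_equality)
  fix W assume "\<exists>i' j' Z Z' f' g'. f' \<in> Hom Z (gcomp A i') \<and> g' \<in> Hom Z' (gcomp A j') \<and>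
    subobj i f = subobj i' f' \<and> subobj j g = subobj j' g' \<and> W = subobj (i' + j') (mult_map i' j' f' g')"
  then obtain Z Z' f' g' where h: "f' \<in> Hom Z (gcomp A i)" "g' \<in> Hom Z' (gcomp A j)"
    "ann i f = ann i f'" "ann j g = ann j g'" "W = subobj (i + j) (mult_map i j f' g')"
    by (auto simp: subobj_def)
  have "ann (i + j) (mult_map i j f g) = ann (i + j) (mult_map i j f' g)"
    using mult_map_mono_left[OF f h(1) _ g] mult_map_mono_left[OF h(1) f _ g] h(3) by blast
  also have "\<dots> = ann (j + i) (mult_map j i g f')" by (rule mult_map_comm[OF h(1) g])
  also have "\<dots> = ann (j + i) (mult_map j i g' f')"
    using mult_map_mono_left[OF g h(2) _ h(1)] mult_map_mono_left[OF h(2) g _ h(1)] h(4) by blast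
  also have "\<dots> = ann (i + j) (mult_map i j f' g')" by (rule mult_map_comm[OF h(1,2), symmetric])
  finally show "W = subobj (i + j) (mult_map i j f g)" using h(5) by (simp add: subobj_def)
qed (use f g in blast)

lemma subobj_in_carrier: "f \<in> Hom Y (gcomp A m) \<Longrightarrow> subobj m f \<in> carrier subobj_monoid"
  unfolding subobj_monoid_def by auto

lemma carrier_subobj:
  assumes "U \<in> carrier subobj_monoid"
  obtains m Y f where "f \<in> Hom Y (gcomp A m)" "U = subobj m f"
  using assms unfolding subobj_monoid_def by auto

lemma subobj_monoid_mult:
  "f \<in> Hom Y (gcomp A i) \<Longrightarrow> g \<in> Hom Y' (gcomp A j) \<Longrightarrow>
     subobj i f \<otimes>\<^bsub>subobj_monoid\<^esub> subobj j g = subobj (i + j) (mult_map i j f g)"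
  unfolding subobj_monoid_def by (simp add: subobj_mult_eq)

lemma subobj_one: "\<one>\<^bsub>subobj_monoid\<^esub> = subobj 0 (gone A)"
  by (simp add: subobj_monoid_def)

lemma mult_map_assoc:
  assumes f: "f \<in> Hom X (gcomp A i)" and g: "g \<in> Hom Y (gcomp A j)" and h: "h \<in> Hom Z (gcomp A k)"
  shows "mult_map (i + j) k (mult_map i j f g) h = mult_map i (j + k) f (mult_map j k g h) \<cdot> associator C X Y Z"
proof -
  let ?a = "associator C (gcomp A i) (gcomp A j) (gcomp A k)"
  note fg = tmor_in_hom[OF f g] and gh = tmor_in_hom[OF g h]
  note fgh = tmor_in_hom[OF fg h] and fgh' = tmor_in_hom[OF f gh]
  note m1 = tmor_id_in_hom[OF gmul_in_hom, of i j "gcomp A k"]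
    and m2 = id_tmor_in_hom[OF gmul_in_hom, of "gcomp A i" j k]
    and m3 = gmul_in_hom[of "i + j" k] and m4 = gmul_in_hom[of i "j + k"]
  have "mult_map i j f g \<otimes>\<^sub>m h = (gmul A i j \<otimes>\<^sub>m ident C (gcomp A k)) \<cdot> ((f \<otimes>\<^sub>m g) \<otimes>\<^sub>m h)"
    unfolding mult_map_def using tmor_cmp[OF fg gmul_in_hom h ident_in_hom] cmp_ident_left[OF h] by simp
  then have "mult_map (i + j) k (mult_map i j f g) h
      = (gmul A (i + j) k \<cdot> (gmul A i j \<otimes>\<^sub>m ident C (gcomp A k))) \<cdot> ((f \<otimes>\<^sub>m g) \<otimes>\<^sub>m h)"
    unfolding mult_map_def[of "i + j"] using cmp_assoc[OF fgh m1 m3] by simp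
  also have "\<dots> = gmul A i (j + k) \<cdot> (ident C (gcomp A i) \<otimes>\<^sub>m gmul A j k) \<cdot> (?a \<cdot> ((f \<otimes>\<^sub>m g) \<otimes>\<^sub>m h))"
    unfolding gmul_assoc using cmp_assoc3[OF fgh ass_cmp(1) m2] m4 by (simp add: add.assoc)
  also have "?a \<cdot> ((f \<otimes>\<^sub>m g) \<otimes>\<^sub>m h) = (f \<otimes>\<^sub>m (g \<otimes>\<^sub>m h)) \<cdot> associator C X Y Z"
    by (rule associator_natural[OF f g h])
  also have "gmul A i (j + k) \<cdot> (ident C (gcomp A i) \<otimes>\<^sub>m gmul A j k) \<cdot> (f \<otimes>\<^sub>m (g \<otimes>\<^sub>m h)) \<cdot> associator C X Y Z
      = (gmul A i (j + k) \<cdot> ((ident C (gcomp A i) \<otimes>\<^sub>m gmul A j k) \<cdot> (f \<otimes>\<^sub>m (g \<otimes>\<^sub>m h)))) \<cdot> associator C X Y Z"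
    using cmp_assoc3[OF ass_cmp(1) fgh' m2 m4] by simp
  also have "(ident C (gcomp A i) \<otimes>\<^sub>m gmul A j k) \<cdot> (f \<otimes>\<^sub>m (g \<otimes>\<^sub>m h)) = f \<otimes>\<^sub>m mult_map j k g h"
    unfolding mult_map_def using tmor_cmp[OF f ident_in_hom gh gmul_in_hom] cmp_ident_left[OF f] by simp
  finally show ?thesis unfolding mult_map_def[of i "j + k"] .
qed

lemma mult_map_one:
  assumes f: "f \<in> Hom Y (gcomp A i)"
  shows "mult_map 0 i (gone A) f = f \<cdot> lunitor C Y"
proof -
  have "mult_map 0 i (gone A) f = (gmul A 0 i \<cdot> (gone A \<otimes>\<^sub>m ident C (gcomp A i))) \<cdot> (ident C (unit_obj C) \<otimes>\<^sub>m f)"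
    unfolding mult_map_def tmor_split(1)[OF gone_in_hom f]
    using cmp_assoc[OF id_tmor_in_hom[OF f] tmor_id_in_hom[OF gone_in_hom] gmul_in_hom] by simp
  then show ?thesis unfolding gmul_one using lunitor_natural[OF f] by simp
qed

text \<open>The laws hold as equations because associator, braiding and unitor are isomorphisms, and
  composing a spanning morphism with an epi does not change its annihilator.\<close>

lemma comm_monoid_subobj: "comm_monoid subobj_monoid"
proof (rule comm_monoidI)
  fix U V assume "U \<in> carrier subobj_monoid" "V \<in> carrier subobj_monoid"
  then obtain i Y f j Y' g where h: "f \<in> Hom Y (gcomp A i)" "U = subobj i f" "g \<in> Hom Y' (gcomp A j)" "V = subobj j g"
    using carrier_subobj by metis
  show "U \<otimes>\<^bsub>subobj_monoid\<^esub> V \<in> carrier subobj_monoid"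
    unfolding h subobj_monoid_mult[OF h(1,3)] by (rule subobj_in_carrier[OF mult_map_in_hom[OF h(1,3)]])
  show "U \<otimes>\<^bsub>subobj_monoid\<^esub> V = V \<otimes>\<^bsub>subobj_monoid\<^esub> U"
    unfolding h subobj_monoid_mult[OF h(1,3)] subobj_monoid_mult[OF h(3,1)]
    using mult_map_comm[OF h(1,3)] by (simp add: subobj_def add.commute)
  fix W assume "W \<in> carrier subobj_monoid"
  then obtain k Z w where w: "w \<in> Hom Z (gcomp A k)" "W = subobj k w" using carrier_subobj by metis
  note fg = mult_map_in_hom[OF h(1,3)] and gw = mult_map_in_hom[OF h(3) w(1)]
  have "ann (i + (j + k)) (mult_map (i + j) k (mult_map i j f g) w) = ann (i + (j + k)) (mult_map i (j + k) f (mult_map j k g w))"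
    unfolding mult_map_assoc[OF h(1,3) w(1)]
    by (rule ann_cmp_epi[OF mult_map_in_hom[OF h(1) gw] iso_epi[OF associator_iso]])
  then show "U \<otimes>\<^bsub>subobj_monoid\<^esub> V \<otimes>\<^bsub>subobj_monoid\<^esub> W = U \<otimes>\<^bsub>subobj_monoid\<^esub> (V \<otimes>\<^bsub>subobj_monoid\<^esub> W)"
    unfolding h w subobj_monoid_mult[OF h(1,3)] subobj_monoid_mult[OF h(3) w(1)]
      subobj_monoid_mult[OF fg w(1)] subobj_monoid_mult[OF h(1) gw]
    by (simp add: subobj_def add.assoc)
next
  show "\<one>\<^bsub>subobj_monoid\<^esub> \<in> carrier subobj_monoid"
    unfolding subobj_one by (rule subobj_in_carrier[OF gone_in_hom])
next
  fix U assume "U \<in> carrier subobj_monoid"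
  then obtain i Y f where h: "f \<in> Hom Y (gcomp A i)" "U = subobj i f" using carrier_subobj by metis
  show "\<one>\<^bsub>subobj_monoid\<^esub> \<otimes>\<^bsub>subobj_monoid\<^esub> U = U"
    unfolding h subobj_one subobj_monoid_mult[OF gone_in_hom h(1)] mult_map_one[OF h(1)]
    using ann_cmp_epi[OF h(1) iso_epi[OF lunitor_iso]] by (simp add: subobj_def)
qed

sublocale subobj: comm_monoid subobj_monoid
  by (rule comm_monoid_subobj)

lemma subobj_rank_eq:
  assumes f: "f \<in> Hom Y (gcomp A m)"
  shows "subobj_rank (subobj m f) = rank Y (gcomp A m) f"
  unfolding subobj_rank_def
proof (rule the_equality)
  fix r assume "\<exists>m' Y' f'. f' \<in> Hom Y' (gcomp A m') \<and> subobj m f = subobj m' f' \<and> r = rank Y' (gcomp A m') f'"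
  then obtain Y' f' where f': "f' \<in> Hom Y' (gcomp A m)" "ann m f = ann m f'" "r = rank Y' (gcomp A m) f'"
    by (auto simp: subobj_def)
  have "t \<cdot> f = 0 \<longleftrightarrow> t \<cdot> f' = 0" if "t \<in> Hom (gcomp A m) T" for T t
    using f'(2) that unfolding ann_def by blast
  then have "rank Y (gcomp A m) f \<le> rank Y' (gcomp A m) f'" "rank Y' (gcomp A m) f' \<le> rank Y (gcomp A m) f"
    using rank_le_dominated[OF f f'(1)] rank_le_dominated[OF f'(1) f] by blast+
  then show "r = rank Y (gcomp A m) f" using f'(3) by simp
qed (use f in blast)

text \<open>The spanning morphism is replaced by the inclusion of its image, whose dimension is the
  rank.\<close>

lemma carrier_mono:
  assumes "U \<in> carrier subobj_monoid"
  obtains m W f where "is_mono C W (gcomp A m) f" "U = subobj m f" "subobj_rank U = d W"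
proof -
  obtain m Y f where f: "f \<in> Hom Y (gcomp A m)" "U = subobj m f" using carrier_subobj[OF assms] by metis
  obtain W i e where i: "is_mono C W (gcomp A m) i" "is_epi C Y W e" "f = i \<cdot> e" "rank Y (gcomp A m) f = d W"
    using rank_image[OF f(1)] by blast
  have "U = subobj m i" unfolding f i(3) subobj_def using ann_cmp_epi[OF mono_in_hom[OF i(1)] i(2)] by simp
  then show ?thesis using that i subobj_rank_eq[OF f(1)] f(2) by auto
qed

lemma subobj_le_iff:
  "subobj_le (subobj i f) (subobj j g) \<longleftrightarrow> i = j \<and> ann j g \<subseteq> ann i f"
  by (auto simp: subobj_le_def subobj_def)

lemma subobj_mono_quotient:
  assumes f: "is_mono C W (gcomp A m) f" and f': "is_mono C W' (gcomp A m) f'" and le: "ann m f' \<subseteq> ann m f"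
  obtains i P p where "i \<in> Hom W W'" "f' \<cdot> i = f" "is_cokernel C W W' i P p" "d P = d W' - d W"
proof -
  have "t \<cdot> f = 0" if "t \<in> Hom (gcomp A m) T" "t \<cdot> f' = 0" for T t
    using le that unfolding ann_def by blast
  then obtain i where i: "is_mono C W W' i" "f' \<cdot> i = f"
    using mono_dominated_factor[OF f f'] by metis
  obtain P p where p: "is_cokernel C W W' i P p" using cokernels[OF mono_in_hom[OF i(1)]] by blast
  show ?thesis
    using that[OF mono_in_hom[OF i(1)] i(2) p] d_short_exact[OF mono_short_exact[OF i(1) p]] by simp
qed

text \<open>K stands in for F G' + F' G, so this sum is never constructed. Modulo K, the product
  morphism on F' \<otimes> G' vanishes on both mixed parts and factors through (F'/F) \<otimes>
  (G'/G), whose dimension is the product of the two rank differences; \<open>rank_le_factor\<close>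
  then applies.\<close>

lemma subobj_rank_square:
  assumes U: "F \<in> carrier subobj_monoid" "F' \<in> carrier subobj_monoid" "G \<in> carrier subobj_monoid"
      "G' \<in> carrier subobj_monoid" "K \<in> carrier subobj_monoid"
    and le: "subobj_le F F'" "subobj_le G G'"
      "subobj_le (F \<otimes>\<^bsub>subobj_monoid\<^esub> G') K" "subobj_le (F' \<otimes>\<^bsub>subobj_monoid\<^esub> G) K"
  shows "subobj_rank (F' \<otimes>\<^bsub>subobj_monoid\<^esub> G')
    \<le> subobj_rank K + (subobj_rank F' - subobj_rank F) * (subobj_rank G' - subobj_rank G)"
proof -
  obtain a W f where f: "is_mono C W (gcomp A a) f" "F = subobj a f" "subobj_rank F = d W"
    using carrier_mono[OF U(1)] by metis
  obtain W' f' where f': "is_mono C W' (gcomp A a) f'" "F' = subobj a f'" "subobj_rank F' = d W'"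
    using carrier_mono[OF U(2)] le(1) f(2) unfolding subobj_le_iff by (metis subobj_le_iff)
  obtain b V g where g: "is_mono C V (gcomp A b) g" "G = subobj b g" "subobj_rank G = d V"
    using carrier_mono[OF U(3)] by metis
  obtain V' g' where g': "is_mono C V' (gcomp A b) g'" "G' = subobj b g'" "subobj_rank G' = d V'"
    using carrier_mono[OF U(4)] le(2) g(2) unfolding subobj_le_iff by (metis subobj_le_iff)
  note fh = mono_in_hom[OF f(1)] and fh' = mono_in_hom[OF f'(1)]
    and gh = mono_in_hom[OF g(1)] and gh' = mono_in_hom[OF g'(1)]
  have FG': "F \<otimes>\<^bsub>subobj_monoid\<^esub> G' = subobj (a + b) (mult_map a b f g')"
    and F'G: "F' \<otimes>\<^bsub>subobj_monoid\<^esub> G = subobj (a + b) (mult_map a b f' g)"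
    and F'G': "F' \<otimes>\<^bsub>subobj_monoid\<^esub> G' = subobj (a + b) (mult_map a b f' g')"
    unfolding f f' g g' using subobj_monoid_mult fh fh' gh gh' by auto
  obtain Y k where k: "k \<in> Hom Y (gcomp A (a + b))" "K = subobj (a + b) k"
    using carrier_subobj[OF U(5)] le(3) FG' by (metis subobj_le_iff)
  have "ann a f' \<subseteq> ann a f" "ann b g' \<subseteq> ann b g"
    using le(1,2) f f' g g' by (simp_all add: subobj_le_iff)
  then obtain i P p j P' p' where
    i: "i \<in> Hom W W'" "f' \<cdot> i = f" "is_cokernel C W W' i P p" "d P = d W' - d W" and
    j: "j \<in> Hom V V'" "g' \<cdot> j = g" "is_cokernel C V V' j P' p'" "d P' = d V' - d V"
    using subobj_mono_quotient[OF f(1) f'(1)] subobj_mono_quotient[OF g(1) g'(1)] by metis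
  obtain Q c where c: "is_cokernel C Y (gcomp A (a + b)) k Q c" using cokernels[OF k(1)] by blast
  note ch = cokernel_in_hom(2)[OF c]
  have "(Q, c) \<in> ann (a + b) k" using cokernel_in_hom[OF c] by (simp add: ann_mem)
  then have "(Q, c) \<in> ann (a + b) (mult_map a b f g')" "(Q, c) \<in> ann (a + b) (mult_map a b f' g)"
    using le(3,4) unfolding FG' F'G k(2) subobj_le_iff by blast+
  then have z: "c \<cdot> mult_map a b f g' = 0" "c \<cdot> mult_map a b f' g = 0" by (simp_all add: ann_mem)
  note m = mult_map_in_hom[OF fh' gh']
  let ?s = "c \<cdot> mult_map a b f' g'"
  have s: "?s \<in> Hom (W' \<otimes>\<^sub>o V') Q" by (rule cmp_in_hom[OF m ch])
  have "?s \<cdot> (i \<otimes>\<^sub>m ident C V') = 0"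
    using cmp_assoc[OF tmor_id_in_hom[OF i(1)] m ch] mult_map_cmp[OF fh' gh' i(1) ident_in_hom]
      i(2) cmp_ident_right[OF gh'] z(1) by simp
  moreover have "?s \<cdot> (ident C W' \<otimes>\<^sub>m j) = 0"
    using cmp_assoc[OF id_tmor_in_hom[OF j(1)] m ch] mult_map_cmp[OF fh' gh' ident_in_hom j(1)]
      j(2) cmp_ident_right[OF fh'] z(2) by simp
  ultimately obtain v where v: "v \<in> Hom (P \<otimes>\<^sub>o P') Q" "?s = v \<cdot> (p \<otimes>\<^sub>m p')"
    using factor_through_quotients[OF i(3) j(3) s] by blast
  have "rank (W' \<otimes>\<^sub>o V') (gcomp A (a + b)) (mult_map a b f' g') \<le> rank Y (gcomp A (a + b)) k + d (P \<otimes>\<^sub>o P')"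
    by (rule rank_le_factor[OF m c tmor_in_hom[OF cokernel_in_hom(2)[OF i(3)] cokernel_in_hom(2)[OF j(3)]] v])
  then show ?thesis
    unfolding F'G' subobj_rank_eq[OF m] k(2) subobj_rank_eq[OF k(1)] f(3) f'(3) g(3) g'(3)
    using i(4) j(4) d_tensor by simp
qed

lemma subobj_mult_zero:
  assumes g: "g \<in> Hom Y (gcomp A j)"
  shows "subobj i 0 \<otimes>\<^bsub>subobj_monoid\<^esub> subobj j g = subobj (i + j) 0"
  using subobj_monoid_mult[OF zero_in_hom g, of i] tmor_zero_left[OF g] cmp_zero_right[OF gmul_in_hom]
  by (simp add: mult_map_def)

lemma subobj_zero_le: "subobj_le (subobj i 0) (subobj i f)"
  using cmp_zero_right by (auto simp: subobj_le_iff ann_def)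

lemma subobj_rank_zero: "subobj_rank (subobj i 0) = 0"
  using subobj_rank_eq[OF zero_in_hom, of i] rank_zero by metis

text \<open>The square inequality for 0 \<preceq> H and F \<preceq> G, with K = H F.\<close>

lemma subobj_rank_mult_diff:
  assumes H: "H \<in> carrier subobj_monoid" and F: "F \<in> carrier subobj_monoid" and G: "G \<in> carrier subobj_monoid"
    and le: "subobj_le F G"
  shows "subobj_rank (H \<otimes>\<^bsub>subobj_monoid\<^esub> G)
    \<le> subobj_rank (H \<otimes>\<^bsub>subobj_monoid\<^esub> F) + subobj_rank H * (subobj_rank G - subobj_rank F)"
proof -
  obtain i Y h where h: "h \<in> Hom Y (gcomp A i)" "H = subobj i h" using carrier_subobj[OF H] by metis
  obtain j Z f where f: "f \<in> Hom Z (gcomp A j)" "F = subobj j f" using carrier_subobj[OF F] by metis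
  obtain Z' g where g: "g \<in> Hom Z' (gcomp A j)" "G = subobj j g"
    using carrier_subobj[OF G] le f(2) by (metis subobj_le_iff)
  have "subobj_le (subobj i 0 \<otimes>\<^bsub>subobj_monoid\<^esub> G) (H \<otimes>\<^bsub>subobj_monoid\<^esub> F)"
    unfolding g h f subobj_mult_zero[OF g(1)] subobj_monoid_mult[OF h(1) f(1)] by (rule subobj_zero_le)
  moreover have "subobj_le (H \<otimes>\<^bsub>subobj_monoid\<^esub> F) (H \<otimes>\<^bsub>subobj_monoid\<^esub> F)" by (simp add: subobj_le_def)
  moreover have "subobj_le (subobj i 0) H" unfolding h(2) by (rule subobj_zero_le)
  ultimately show ?thesis
    using subobj_rank_square[OF subobj_in_carrier[OF zero_in_hom] H F G subobj.m_closed[OF H F] _ le]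
      subobj_rank_zero by simp
qed

lemma subobj_rank_nonneg: "U \<in> carrier subobj_monoid \<Longrightarrow> 0 \<le> subobj_rank U"
  using carrier_mono d_nonneg by metis

lemma ranked_subobj: "ranked_comm_monoid subobj_monoid subobj_le subobj_rank"
proof (unfold_locales, goal_cases)
  case (1 U)
  then show ?case by (simp add: subobj_le_def)
next
  case (2 U V W)
  obtain i Y f where f: "f \<in> Hom Y (gcomp A i)" "U = subobj i f" using carrier_subobj[OF 2(1)] by metis
  obtain Z g where g: "g \<in> Hom Z (gcomp A i)" "V = subobj i g"
    using carrier_subobj[OF 2(2)] 2(4) f(2) by (metis subobj_le_iff)
  obtain j Z' w where w: "w \<in> Hom Z' (gcomp A j)" "W = subobj j w" using carrier_subobj[OF 2(3)] by metis
  show ?case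
    using mult_map_mono_left[OF g(1) f(1) _ w(1)] 2(4)
    unfolding f g w subobj_monoid_mult[OF f(1) w(1)] subobj_monoid_mult[OF g(1) w(1)] subobj_le_iff by simp
next
  case (3 U)
  then show ?case by (rule subobj_rank_nonneg)
next
  case (4 U V)
  obtain i Y f where f: "f \<in> Hom Y (gcomp A i)" "U = subobj i f" using carrier_subobj[OF 4(1)] by metis
  obtain Z g where g: "g \<in> Hom Z (gcomp A i)" "V = subobj i g"
    using carrier_subobj[OF 4(2)] 4(3) f(2) by (metis subobj_le_iff)
  have "t \<cdot> f = 0" if "t \<in> Hom (gcomp A i) T" "t \<cdot> g = 0" for T t
    using 4(3) that unfolding f(2) g(2) subobj_le_iff ann_def by blast
  then show ?case
    unfolding f(2) g(2) subobj_rank_eq[OF f(1)] subobj_rank_eq[OF g(1)]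
    using rank_le_dominated[OF g(1) f(1)] by blast
next
  case 5
  then show ?case
    unfolding subobj_one subobj_rank_eq[OF gone_in_hom] using rank_le_source[OF gone_in_hom] d_unit by simp
next
  case (6 U V)
  \<comment> \<open>Submultiplicativity is \<open>subobj_rank_mult_diff\<close> for the zero
    subobject in the degree of V.\<close>
  obtain j Z f where f: "f \<in> Hom Z (gcomp A j)" "V = subobj j f" using carrier_subobj[OF 6(2)] by metis
  obtain i Y h where h: "h \<in> Hom Y (gcomp A i)" "U = subobj i h" using carrier_subobj[OF 6(1)] by metis
  have z: "subobj j 0 \<in> carrier subobj_monoid" by (rule subobj_in_carrier[OF zero_in_hom])
  have "U \<otimes>\<^bsub>subobj_monoid\<^esub> subobj j 0 = subobj (j + i) 0"
    using subobj.m_comm[OF 6(1) z] subobj_mult_zero[OF h(1)] h(2) by simp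
  moreover have "subobj_le (subobj j 0) V" unfolding f(2) by (rule subobj_zero_le)
  ultimately show ?case
    using subobj_rank_mult_diff[OF 6(1) z 6(2)] subobj_rank_zero by simp
next
  case (7 H F G)
  then show ?case by (rule subobj_rank_mult_diff)
next
  case (8 F F' G G' K)
  then show ?case by (rule subobj_rank_square)
qed

end

section \<open>Symmetric powers and the grading of tensor powers\<close>

context symmetric_tensor_category
begin

lemma adj_swap_in_hom: "adj_swap C X n i \<in> Hom (tpow C X n) (tpow C X n)"
proof (induction n)
  case 0
  then show ?case using ident_in_hom[of "unit_obj C"] by simp
next
  case (Suc n)
  show ?case
  proof (cases n)
    case 0
    then show ?thesis using ident_in_hom by simp
  next
    case (Suc k)
    have "ass_inv (tpow C X k) X X \<cdot> (ident C (tpow C X k) \<otimes>\<^sub>m braiding C X X) \<cdot> associator C (tpow C X k) X X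
        \<in> Hom (tpow C X k \<otimes>\<^sub>o X \<otimes>\<^sub>o X) (tpow C X k \<otimes>\<^sub>o X \<otimes>\<^sub>o X)"
      by (rule cmp_in_hom[OF cmp_in_hom[OF ass_cmp(1) id_tmor_in_hom[OF braiding_in_hom]] ass_cmp(2)])
    then show ?thesis using Suc Suc.IH tmor_id_in_hom by simp
  qed
qed

lemma sym_action_in_hom: "sym_action C X n \<sigma> f \<Longrightarrow> f \<in> Hom (tpow C X n) (tpow C X n)"
proof (induction rule: sym_action.induct)
  case 1
  show ?case by (rule ident_in_hom)
next
  case (2 \<sigma> f i)
  show ?case by (rule cmp_in_hom[OF 2(3) adj_swap_in_hom])
qed

text \<open>If g and h agree after q, both solve the universal problem posed by the invariant
  morphism \<open>g \<cdot> q\<close>.\<close>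

lemma sym_power_epi:
  assumes "is_sym_power C X n Q q"
  shows "is_epi C (tpow C X n) Q q"
proof -
  have q: "q \<in> Hom (tpow C X n) Q" "\<And>\<sigma> f. sym_action C X n \<sigma> f \<Longrightarrow> q \<cdot> f = q"
    and uni: "\<And>T t. t \<in> Hom (tpow C X n) T \<Longrightarrow> (\<And>\<sigma> f. sym_action C X n \<sigma> f \<Longrightarrow> t \<cdot> f = t) \<Longrightarrow>
      \<exists>!u. u \<in> Hom Q T \<and> u \<cdot> q = t"
    using assms unfolding is_sym_power_def by blast+
  have "g = h" if gh: "g \<in> Hom Q T" "h \<in> Hom Q T" "g \<cdot> q = h \<cdot> q" for T g h
  proof -
    have "(g \<cdot> q) \<cdot> f = g \<cdot> q" if "sym_action C X n \<sigma> f" for \<sigma> f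
      using cmp_assoc[OF sym_action_in_hom[OF that] q(1) gh(1)] q(2)[OF that] by simp
    then show ?thesis using uni[OF cmp_in_hom[OF q(1) gh(1)]] gh by metis
  qed
  then show ?thesis using q(1) unfolding is_epi_def by blast
qed

lemma tpow_degree_in_hom:
  assumes "\<And>d. e d \<in> Hom X X"
  shows "tpow_degree C X e n m \<in> Hom (tpow C X n) (tpow C X n)"
  using assms by (induction n arbitrary: m) (auto intro!: sum_in_hom tmor_in_hom ident_in_hom)

text \<open>Each of the n tensor factors has degree at least 1, so nothing is left in degrees below
  n.\<close>

lemma tpow_degree_eq_0:
  assumes e: "\<And>d. e d \<in> Hom X X" "e 0 = 0" and "m < n"
  shows "tpow_degree C X e n m = 0"
  using \<open>m < n\<close>
proof (induction n arbitrary: m)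
  case (Suc n)
  have "tpow_degree C X e n (m - d) \<otimes>\<^sub>m e d = 0" if "d \<le> m" for d
  proof (cases "d = 0")
    case True
    then show ?thesis using e tmor_zero_right[OF tpow_degree_in_hom] by simp
  next
    case False
    then have "m - d < n" using Suc.prems that by linarith
    then show ?thesis using Suc.IH tmor_zero_left[OF e(1)] by simp
  qed
  then show ?case by simp
qed simp

lemma tpow_degree_1:
  assumes e: "\<And>d. e d \<in> Hom X X"
  shows "tpow_degree C X e (Suc 0) m = ident C (unit_obj C) \<otimes>\<^sub>m e m"
proof -
  have "tpow_degree C X e (Suc 0) m = (\<Sum>d\<le>m. tpow_degree C X e 0 (m - d) \<otimes>\<^sub>m e d)" by simp
  also have "\<dots> = (\<Sum>d\<le>m. if d = m then ident C (unit_obj C) \<otimes>\<^sub>m e d else 0)"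
    using tmor_zero_left[OF e] by (intro sum.cong) auto
  finally show ?thesis by simp
qed

text \<open>The first tensor power is the unit tensored with X rather than X itself. Appending one
  letter therefore means absorbing this unit, and the triangle identifies the two ways of doing
  so.\<close>

lemma tpow_join_1: "tpow_join C X n (Suc 0) = ident C (tpow C X n) \<otimes>\<^sub>m lunitor C X"
proof -
  let ?T = "tpow C X n"
  have "ident C ?T \<otimes>\<^sub>m lunitor C X = (runitor C ?T \<otimes>\<^sub>m ident C X) \<cdot> ass_inv ?T (unit_obj C) X"
    by (rule cmp_eq_move_right[OF inverse_mor[OF associator_iso] id_tmor_in_hom[OF lun_cmp(1)] triangle])
  then show ?thesis by simp
qed

lemma positive_grading:
  assumes "is_positive_grading C X e"
  obtains I where "finite I" "0 \<notin> I" "\<And>d. e d \<in> Hom X X" "\<And>d. d \<notin> I \<Longrightarrow> e d = 0"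
proof -
  obtain I Xs inc prj where h: "is_direct_sum C I Xs X inc prj" "0 \<notin> I"
    "e = (\<lambda>d. if d \<in> I then inc d \<cdot> prj d else 0)"
    using assms by (auto simp: is_positive_grading_def)
  have "e d \<in> Hom X X" for d
  proof (cases "d \<in> I")
    case True
    then have "inc d \<in> Hom (Xs d) X" "prj d \<in> Hom X (Xs d)" using h(1) unfolding is_direct_sum_def by blast+
    then show ?thesis using True h(3) cmp_in_hom by simp
  qed (use h(3) in simp)
  then show ?thesis using that h by (auto simp: is_direct_sum_def)
qed

end

section \<open>Polynomial growth, coverings by subobjects, and generators\<close>

context graded_commutative_algebra
begin

text \<open>The induction follows a composition series of the source Y of a spanning morphism, not
  of the subobject. If Y / Y' = S is simple, then modulo the image of the restriction to Y' the
  morphism f factors through S, so the rank drops by at most d S \<le> R. The exponent k obtained is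
  the length of the series.\<close>

lemma poly_growth_subobj:
  assumes R: "1 \<le> R" "\<And>S. is_simple C S \<Longrightarrow> d S \<le> R"
  shows "poly_growth_monoid subobj_monoid subobj_le subobj_rank R"
proof -
  interpret ranked_comm_monoid subobj_monoid subobj_le subobj_rank by (rule ranked_subobj)
  have growth: "\<exists>k. \<forall>n::nat. subobj_rank (subobj m f [^]\<^bsub>subobj_monoid\<^esub> n) \<le> real (n + 1) ^ k * R ^ n"
    if "composition_series C Y Ss" "f \<in> Hom Y (gcomp A m)" for Y Ss f m
    using that
  proof (induction arbitrary: f rule: composition_series.induct)
    case (1 Z)
    then have "f = 0" by (auto simp: is_zero_obj_def)
    then have "subobj_rank (subobj m f) = 0" using subobj_rank_zero by simp
    then have "\<forall>n::nat. subobj_rank (subobj m f [^]\<^bsub>subobj_monoid\<^esub> n) \<le> real (n + 1) ^ 0 * R ^ n"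
      using zero_growth[OF subobj_in_carrier[OF 1(2)] _ R(1)] by blast
    then show ?case ..
  next
    case (2 Y' Ss S i Y g)
    note se = short_exact_in_hom[OF 2(3)]
    have fi: "f \<cdot> i \<in> Hom Y' (gcomp A m)" using se(1) 2(5) by (rule cmp_in_hom)
    obtain k where k: "\<And>n::nat. subobj_rank (subobj m (f \<cdot> i) [^]\<^bsub>subobj_monoid\<^esub> n) \<le> real (n + 1) ^ k * R ^ n"
      using 2(4)[OF fi] by blast
    have "t \<cdot> (f \<cdot> i) = 0" if "t \<in> Hom (gcomp A m) T" "t \<cdot> f = 0" for t T
      using cmp_assoc[OF se(1) 2(5) that(1)] that(2) cmp_zero_left[OF se(1)] by simp
    then have le: "subobj_le (subobj m (f \<cdot> i)) (subobj m f)"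
      unfolding subobj_le_iff ann_def by blast
    obtain Q c where c: "is_cokernel C Y' (gcomp A m) (f \<cdot> i) Q c" using cokernels[OF fi] by blast
    note ch = cokernel_in_hom[OF c]
    have z: "(c \<cdot> f) \<cdot> i = 0" using cmp_assoc[OF se(1) 2(5) ch(2)] ch(3) by simp
    have coker: "is_cokernel C Y' Y i S g" using 2(3) by (simp add: short_exact_def)
    obtain v where v: "v \<in> Hom S Q" "v \<cdot> g = c \<cdot> f"
      by (rule cokernelE[OF coker cmp_in_hom[OF 2(5) ch(2)] z])
    have "rank Y (gcomp A m) f \<le> rank Y' (gcomp A m) (f \<cdot> i) + d S"
      by (rule rank_le_factor[OF 2(5) c se(2) v(1) v(2)[symmetric]])
    then have "subobj_rank (subobj m f) \<le> subobj_rank (subobj m (f \<cdot> i)) + R"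
      using R(2)[OF 2(2)] subobj_rank_eq[OF 2(5)] subobj_rank_eq[OF fi] by simp
    then have "\<forall>n::nat. subobj_rank (subobj m f [^]\<^bsub>subobj_monoid\<^esub> n) \<le> real (n + 1) ^ Suc k * R ^ n"
      using poly_growth_step[OF subobj_in_carrier[OF fi] subobj_in_carrier[OF 2(5)] le _ R(1) k] by blast
    then show ?case ..
  qed
  show ?thesis
  proof (unfold_locales, goal_cases)
    case 1
    then show ?case by (rule R(1))
  next
    case (2 U)
    obtain m Y f where f: "f \<in> Hom Y (gcomp A m)" "U = subobj m f" using carrier_subobj[OF 2] by metis
    obtain Ss where "composition_series C Y Ss"
      using objects_finite_length by (auto simp: finite_length_def)
    then show ?case unfolding f(2) by (rule growth[OF _ f(1)])
  qed
qed

lemma carrier_mono_degree: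
  assumes "U \<in> carrier subobj_monoid" "fst U = m"
  obtains W f where "is_mono C W (gcomp A m) f" "U = subobj m f" "subobj_rank U = d W"
proof -
  obtain m' W f where f: "is_mono C W (gcomp A m') f" "U = subobj m' f" "subobj_rank U = d W"
    using carrier_mono[OF assms(1)] by blast
  then have "m' = m" using assms(2) by (simp add: subobj_def)
  then show ?thesis using that f by blast
qed

lemma carrier_subobj_degree:
  assumes "U \<in> carrier subobj_monoid" "fst U = m"
  obtains Y f where "f \<in> Hom Y (gcomp A m)" "U = subobj m f"
proof -
  obtain W f where "is_mono C W (gcomp A m) f" "U = subobj m f"
    using carrier_mono_degree[OF assms] by metis
  then show ?thesis using that[OF mono_in_hom] by metis
qed

text \<open>The hypothesis \<open>cover\<close> says that A_m is the sum of the given subobjects.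
  They are divided out one after another: c is the projection onto the quotient by those treated so
  far, and each new member lowers the dimension by at most its rank. Finally c annihilates nothing
  less than all of them, so c = 0 and the quotient is zero.\<close>

lemma d_le_cover:
  assumes fin: "finite \<U>" and U: "\<And>U. U \<in> \<U> \<Longrightarrow> U \<in> carrier subobj_monoid \<and> fst U = m"
    and cover: "\<And>T t. t \<in> Hom (gcomp A m) T \<Longrightarrow> (\<And>U. U \<in> \<U> \<Longrightarrow> (T, t) \<in> snd U) \<Longrightarrow> t = 0"
  shows "d (gcomp A m) \<le> (\<Sum>U\<in>\<U>. subobj_rank U)"
proof -
  let ?A = "gcomp A m"
  have "\<exists>Q c. is_epi C ?A Q c \<and> (\<forall>U\<in>\<U>. (Q, c) \<in> snd U) \<and> d ?A - d Q \<le> (\<Sum>U\<in>\<U>. subobj_rank U)"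
    using fin U
  proof (induction \<U> rule: finite_induct)
    case empty
    have "is_epi C ?A ?A (ident C ?A)"
      by (rule epiI[OF ident_in_hom]) (use cmp_ident_right in auto)
    then show ?case by auto
  next
    case (insert U \<U>)
    then obtain Q c where c: "is_epi C ?A Q c" "\<forall>U\<in>\<U>. (Q, c) \<in> snd U" "d ?A - d Q \<le> (\<Sum>U\<in>\<U>. subobj_rank U)"
      by auto
    note ch = epi_in_hom[OF c(1)]
    have U: "U \<in> carrier subobj_monoid" "fst U = m" using insert.prems by auto
    obtain W f where f: "is_mono C W ?A f" "U = subobj m f" "subobj_rank U = d W"
      using carrier_mono_degree[OF U] by blast
    note fh = mono_in_hom[OF f(1)]
    have cf: "c \<cdot> f \<in> Hom W Q" using fh ch by (rule cmp_in_hom)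
    obtain Q' r where r: "is_cokernel C W Q (c \<cdot> f) Q' r" using cokernels[OF cf] by blast
    note rh = cokernel_in_hom[OF r]
    have "is_epi C ?A Q' (r \<cdot> c)" by (rule epi_cmp[OF c(1) cokernel_epi[OF r]])
    moreover have "(Q', r \<cdot> c) \<in> snd U"
      unfolding f(2) subobj_def using cmp_in_hom[OF ch rh(2)] cmp_assoc[OF fh ch rh(2)] rh(3)
      by (simp add: ann_mem)
    moreover have "(Q', r \<cdot> c) \<in> snd V" if V: "V \<in> \<U>" for V
    proof -
      have V': "V \<in> carrier subobj_monoid" "fst V = m" using insert.prems V by auto
      obtain Y g where g: "g \<in> Hom Y ?A" "V = subobj m g"
        using carrier_subobj_degree[OF V'] by blast
      have "(Q, c) \<in> snd V" using c(2) V by blast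
      then have "c \<cdot> g = 0" unfolding g(2) subobj_def by (simp add: ann_mem)
      then show ?thesis
        unfolding g(2) subobj_def
        using cmp_in_hom[OF ch rh(2)] cmp_assoc[OF g(1) ch rh(2)] cmp_zero_right[OF rh(2)] by (simp add: ann_mem)
    qed
    moreover have "d ?A - d Q' \<le> (\<Sum>U\<in>insert U \<U>. subobj_rank U)"
      using rank_cokernel[OF r] rank_le_source[OF cf] c(3) f(3) insert.hyps by simp
    ultimately show ?case by blast
  qed
  then obtain Q c where c: "is_epi C ?A Q c" "\<forall>U\<in>\<U>. (Q, c) \<in> snd U" "d ?A - d Q \<le> (\<Sum>U\<in>\<U>. subobj_rank U)"
    by blast
  note ch = epi_in_hom[OF c(1)]
  have "c = 0" using cover[OF ch] c(2) by blast
  then have "ident C Q = 0"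
    using epi_eq_0[OF c(1) ident_in_hom] cmp_zero_right[OF ident_in_hom] by blast
  then have "d Q = 0" using id_zero_zero_obj d_zero_obj by blast
  then show ?thesis using c(3) by simp
qed

lemma fst_mult:
  assumes "U \<in> carrier subobj_monoid" "V \<in> carrier subobj_monoid"
  shows "fst (U \<otimes>\<^bsub>subobj_monoid\<^esub> V) = fst U + fst V"
proof -
  obtain i Y f where f: "f \<in> Hom Y (gcomp A i)" "U = subobj i f" using carrier_subobj[OF assms(1)] by metis
  obtain j Z g where g: "g \<in> Hom Z (gcomp A j)" "V = subobj j g" using carrier_subobj[OF assms(2)] by metis
  show ?thesis unfolding f g subobj_monoid_mult[OF f(1) g(1)] by (simp add: subobj_def)
qed

lemma fst_pow:
  "U \<in> carrier subobj_monoid \<Longrightarrow> fst (U [^]\<^bsub>subobj_monoid\<^esub> (k::nat)) = k * fst U"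
proof (induction k)
  case 0
  then show ?case by (simp add: subobj_one subobj_def)
next
  case (Suc k)
  then show ?case using fst_mult[of "U [^]\<^bsub>subobj_monoid\<^esub> k" U] by simp
qed

lemma fst_monomials:
  assumes "\<forall>(e, G)\<in>set gs. G \<in> carrier subobj_monoid \<and> fst G = e"
    and "U \<in> ranked_comm_monoid.monomials subobj_monoid gs m"
  shows "fst U = m"
proof -
  interpret ranked_comm_monoid subobj_monoid subobj_le subobj_rank by (rule ranked_subobj)
  from assms show ?thesis
  proof (induction gs arbitrary: m U)
    case Nil
    then show ?case by (auto simp: subobj_one subobj_def split: if_splits)
  next
    case (Cons g gs)
    obtain e G where g: "g = (e, G)" by (cases g)
    have G: "G \<in> carrier subobj_monoid" "fst G = e" and gs: "\<forall>(e, G)\<in>set gs. G \<in> carrier subobj_monoid \<and> fst G = e"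
      using Cons.prems g by auto
    obtain k V where k: "k * e \<le> m" "V \<in> monomials gs (m - k * e)" "U = G [^]\<^bsub>subobj_monoid\<^esub> k \<otimes>\<^bsub>subobj_monoid\<^esub> V"
      using Cons.prems(2) g by auto
    have "V \<in> carrier subobj_monoid" using monomials_carrier[of gs] gs k(2) by auto
    then show ?case unfolding k(3) using fst_mult fst_pow G k(1) Cons.IH[OF gs k(2)] by simp
  qed
qed

text \<open>The component of X in degree d supplies the letters \<open>\<gamma> d\<close>, and
  \<open>g n m\<close> is the morphism to A_m given by the words of length n and degree m. Words
  span because A is a quotient of the symmetric algebra. Splitting off the last letter
  (\<open>step\<close>) shows by induction on the length that whatever annihilates all monomials in
  the finitely many letters annihilates all words (\<open>words\<close>), and hence is 0
  (\<open>cover\<close>).\<close>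

lemma generators:
  assumes "is_finitely_generated C A"
  obtains gs where "\<forall>(e, G)\<in>set gs. G \<in> carrier subobj_monoid \<and> fst G = e \<and> 0 < e"
    "\<forall>m T. \<forall>t\<in>Hom (gcomp A m) T.
       (\<forall>U\<in>ranked_comm_monoid.monomials subobj_monoid gs m. (T, t) \<in> snd U) \<longrightarrow> t = 0"
proof -
  interpret ranked_comm_monoid subobj_monoid subobj_le subobj_rank by (rule ranked_subobj)
  obtain X e S \<phi> where gr: "is_positive_grading C X e" and S: "is_symmetric_algebra C X e S"
    and \<phi>: "is_graded_quotient_map C S A \<phi>"
    using assms by (auto simp: is_finitely_generated_def)
  obtain I where I: "finite I" "0 \<notin> I" "\<And>d. e d \<in> Hom X X" "\<And>d. d \<notin> I \<Longrightarrow> e d = 0"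
    using positive_grading[OF gr] by blast
  obtain Q q R a b inc prj where
    q: "\<forall>n. is_sym_power C X n (Q n) (q n)" and
    ab: "\<forall>n m. a n m \<in> Hom (R n m) (Q n) \<and> b n m \<in> Hom (Q n) (R n m) \<and>
           b n m \<cdot> a n m = ident C (R n m) \<and> a n m \<cdot> b n m \<cdot> q n = q n \<cdot> tpow_degree C X e n m" and
    ds: "\<forall>m. is_direct_sum C {..m} (\<lambda>n. R n m) (gcomp S m) (inc m) (prj m)" and
    gS: "\<forall>m l. gmul S m l \<in> Hom (gcomp S m \<otimes>\<^sub>o gcomp S l) (gcomp S (m + l))" and
    mS: "\<forall>m l. \<forall>n\<le>m. \<forall>p\<le>l.
           gmul S m l \<cdot> ((inc m n \<cdot> b n m \<cdot> q n) \<otimes>\<^sub>m (inc l p \<cdot> b p l \<cdot> q p))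
             = inc (m + l) (n + p) \<cdot> b (n + p) (m + l) \<cdot> q (n + p) \<cdot> tpow_join C X n p \<cdot>
                 (tpow_degree C X e n m \<otimes>\<^sub>m tpow_degree C X e p l)" and
    oS: "gone S = inc 0 0 \<cdot> b 0 0 \<cdot> q 0"
    using S unfolding is_symmetric_algebra_def by (elim exE conjE) (rule that, assumption+)
  note q = q[rule_format] and ds = ds[rule_format] and gS = gS[rule_format] and mS = mS[rule_format]
    and ab = ab[rule_format, THEN conjunct1] ab[rule_format, THEN conjunct2, THEN conjunct1]
      ab[rule_format, THEN conjunct2, THEN conjunct2, THEN conjunct1]
      ab[rule_format, THEN conjunct2, THEN conjunct2, THEN conjunct2]
  have \<phi>e: "\<And>i. is_epi C (gcomp S i) (gcomp A i) (\<phi> i)"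
    and \<phi>m: "\<And>i j. \<phi> (i + j) \<cdot> gmul S i j = gmul A i j \<cdot> (\<phi> i \<otimes>\<^sub>m \<phi> j)"
    and \<phi>1: "\<phi> 0 \<cdot> gone S = gone A"
    using \<phi> by (auto simp: is_graded_quotient_map_def)
  note \<phi>h = epi_in_hom[OF \<phi>e]
  have qe: "is_epi C (tpow C X n) (Q n) (q n)" for n by (rule sym_power_epi[OF q])
  note qh = epi_in_hom[OF qe]
  have inc: "inc m n \<in> Hom (R n m) (gcomp S m)" "prj m n \<in> Hom (gcomp S m) (R n m)" if "n \<le> m" for n m
    using ds[of m] that unfolding is_direct_sum_def by auto
  define D where "D n m = tpow_degree C X e n m" for n m
  have D: "D n m \<in> Hom (tpow C X n) (tpow C X n)" for n m
    unfolding D_def by (rule tpow_degree_in_hom[OF I(3)])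
  define s where "s n m = inc m n \<cdot> b n m \<cdot> q n" for n m
  have s: "s n m \<in> Hom (tpow C X n) (gcomp S m)" if "n \<le> m" for n m
    unfolding s_def by (rule cmp_in_hom[OF cmp_in_hom[OF qh ab(2)] inc(1)[OF that]])
  define g where "g n m = \<phi> m \<cdot> s n m" for n m
  have g: "g n m \<in> Hom (tpow C X n) (gcomp A m)" if "n \<le> m" for n m
    unfolding g_def by (rule cmp_in_hom[OF s[OF that] \<phi>h])
  \<comment> \<open>Since \<open>a n m\<close> is a section of \<open>b n m\<close>, passing to the
    degree m part absorbs the degree projector. D can therefore be inserted behind g at
    will.\<close>
  have bqD: "(b n m \<cdot> q n) \<cdot> D n m = b n m \<cdot> q n" for n m
  proof -
    have "(b n m \<cdot> q n) \<cdot> D n m = b n m \<cdot> (a n m \<cdot> (b n m \<cdot> q n))"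
      unfolding D_def ab(4) using cmp_assoc[OF D[unfolded D_def] qh ab(2)] by simp
    also have "\<dots> = (b n m \<cdot> a n m) \<cdot> (b n m \<cdot> q n)"
      using cmp_assoc[OF cmp_in_hom[OF qh ab(2)] ab(1) ab(2)] by simp
    finally show ?thesis using ab(3) cmp_ident_left[OF cmp_in_hom[OF qh ab(2)]] by simp
  qed
  have sD: "s n m \<cdot> D n m = s n m" if "n \<le> m" for n m
    unfolding s_def using cmp_assoc[OF D cmp_in_hom[OF qh ab(2)] inc(1)[OF that]] bqD by simp
  have gD: "g n m \<cdot> D n m = g n m" if "n \<le> m" for n m
    unfolding g_def using cmp_assoc[OF D s[OF that] \<phi>h] sD[OF that] by simp
  \<comment> \<open>A letter is a word of length 1. Its degree must be at least 1 for
    \<open>inc\<close> to be typed, which positivity of the grading guarantees.\<close>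
  define \<gamma> where "\<gamma> d = g (Suc 0) d" for d
  have \<gamma>: "\<gamma> d \<in> Hom (unit_obj C \<otimes>\<^sub>o X) (gcomp A d)" if "d \<in> I" for d
  proof -
    have "Suc 0 \<le> d" using I(2) that by (cases d) auto
    then show ?thesis using g[of "Suc 0" d] by (simp add: \<gamma>_def)
  qed
  define gs where "gs = map (\<lambda>d. (d, subobj d (\<gamma> d))) (sorted_list_of_set I)"
  have set_gs: "set gs = (\<lambda>d. (d, subobj d (\<gamma> d))) ` I" using I(1) by (simp add: gs_def)
  have gs: "\<forall>(e, G)\<in>set gs. G \<in> carrier subobj_monoid \<and> fst G = e \<and> 0 < e"
    unfolding set_gs using subobj_in_carrier[OF \<gamma>] I(2) by (auto simp: subobj_def intro!: gr0I)
  have gs1: "\<forall>(e, G)\<in>set gs. G \<in> carrier subobj_monoid \<and> fst G = e" using gs by auto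
  \<comment> \<open>The unitor factor compares the source of the product, where the last letter
    carries an extra unit, with the tensor power of length n + 1.\<close>
  have step: "g (Suc n) m \<cdot> (D n (m - d) \<otimes>\<^sub>m e d) \<cdot> (ident C (tpow C X n) \<otimes>\<^sub>m lunitor C X)
      = mult_map (m - d) d (g n (m - d)) (\<gamma> d)" if d: "0 < d" "d \<le> m" "n \<le> m - d" for n m d
  proof -
    have md: "m - d + d = m" using d by simp
    have nm: "Suc n \<le> m" "Suc 0 \<le> d" using d by auto
    note s1 = s[OF d(3)] and s2 = s[OF nm(2)]
    note t12 = tmor_in_hom[OF s1 s2]
    have "mult_map (m - d) d (g n (m - d)) (\<gamma> d) = gmul A (m - d) d \<cdot> ((\<phi> (m - d) \<otimes>\<^sub>m \<phi> d) \<cdot> (s n (m - d) \<otimes>\<^sub>m s (Suc 0) d))"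
      unfolding mult_map_def \<gamma>_def g_def tmor_cmp[OF s1 \<phi>h s2 \<phi>h] ..
    also have "\<dots> = (\<phi> (m - d + d) \<cdot> gmul S (m - d) d) \<cdot> (s n (m - d) \<otimes>\<^sub>m s (Suc 0) d)"
      unfolding \<phi>m by (rule cmp_assoc[OF t12 tmor_in_hom[OF \<phi>h \<phi>h] gmul_in_hom, symmetric])
    also have "\<dots> = \<phi> m \<cdot> (gmul S (m - d) d \<cdot> (s n (m - d) \<otimes>\<^sub>m s (Suc 0) d))"
      using cmp_assoc[OF t12 gS \<phi>h] md by simp
    also have "gmul S (m - d) d \<cdot> (s n (m - d) \<otimes>\<^sub>m s (Suc 0) d)
        = inc m (Suc n) \<cdot> b (Suc n) m \<cdot> q (Suc n) \<cdot> (tpow_join C X n (Suc 0) \<cdot> (D n (m - d) \<otimes>\<^sub>m D (Suc 0) d))"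
      unfolding s_def D_def using mS[OF d(3) nm(2)] md by simp
    also have "tpow_join C X n (Suc 0) \<cdot> (D n (m - d) \<otimes>\<^sub>m D (Suc 0) d)
        = (ident C (tpow C X n) \<otimes>\<^sub>m lunitor C X) \<cdot> (D n (m - d) \<otimes>\<^sub>m (ident C (unit_obj C) \<otimes>\<^sub>m e d))"
      unfolding tpow_join_1 D_def tpow_degree_1[of e X, OF I(3)] ..
    also have "\<dots> = (D n (m - d) \<otimes>\<^sub>m e d) \<cdot> (ident C (tpow C X n) \<otimes>\<^sub>m lunitor C X)"
      using tmor_cmp[OF D ident_in_hom id_tmor_in_hom[OF I(3)] lun_cmp(1)]
        tmor_cmp[OF ident_in_hom D lun_cmp(1) I(3)] lunitor_natural[OF I(3)]
        cmp_ident_left[OF D] cmp_ident_right[OF D] by metis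
    finally have eq: "mult_map (m - d) d (g n (m - d)) (\<gamma> d)
      = \<phi> m \<cdot> inc m (Suc n) \<cdot> b (Suc n) m \<cdot> q (Suc n) \<cdot>
        ((D n (m - d) \<otimes>\<^sub>m e d) \<cdot> (ident C (tpow C X n) \<otimes>\<^sub>m lunitor C X))" .
    have t: "(D n (m - d) \<otimes>\<^sub>m e d) \<cdot> (ident C (tpow C X n) \<otimes>\<^sub>m lunitor C X)
        \<in> Hom (tpow C X n \<otimes>\<^sub>o (unit_obj C \<otimes>\<^sub>o X)) (tpow C X (Suc n))"
      using cmp_in_hom[OF id_tmor_in_hom[OF lun_cmp(1)] tmor_in_hom[OF D I(3)]] by simp
    show ?thesis
      unfolding eq g_def[of "Suc n" m] s_def[of "Suc n" m]
      using cmp_assoc[OF t cmp_in_hom[OF cmp_in_hom[OF qh ab(2)] inc(1)[OF nm(1)]] \<phi>h]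
        cmp_assoc3[OF t qh ab(2) inc(1)[OF nm(1)]] by simp
  qed
  have words: "t \<cdot> g n m = 0"
    if "n \<le> m" "t \<in> Hom (gcomp A m) T" "\<And>U. U \<in> monomials gs m \<Longrightarrow> (T, t) \<in> snd U" for n m T t
    using that
  proof (induction n arbitrary: m T t)
    case 0
    show ?case
    proof (cases "m = 0")
      case True
      have "g 0 0 = gone A" unfolding g_def s_def using \<phi>1 oS by simp
      moreover have "(T, t) \<in> snd \<one>\<^bsub>subobj_monoid\<^esub>" using 0(3) one_in_monomials True by blast
      ultimately show ?thesis using True by (simp add: subobj_one subobj_def ann_mem)
    next
      case False
      \<comment> \<open>The empty word lives in degree 0 only.\<close>
      then have "D 0 m = 0" by (simp add: D_def)
      then have "g 0 m = 0" using gD[of 0 m] cmp_zero_right[OF g[of 0 m]] by simp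
      then show ?thesis using cmp_zero_right[OF 0(2)] by simp
    qed
  next
    case (Suc n)
    have "t \<cdot> g (Suc n) m \<cdot> (D n (m - d) \<otimes>\<^sub>m e d) = 0" if d: "d \<le> m" for d
    proof -
      \<comment> \<open>The last letter has degree d. Either X has no component there, or the
        remaining degree is too small for n letters of positive degree, or the induction hypothesis
        applies to the rest of the word.\<close>
      consider "d \<notin> I" | "m - d < n" | "d \<in> I" "n \<le> m - d" by linarith
      then show ?thesis
      proof cases
        case 1
        then show ?thesis
          using I(4) tmor_zero_right[OF D] cmp_zero_right[OF g[OF Suc.prems(1)]] cmp_zero_right[OF Suc.prems(2)]
          by simp
      next
        case 2
        have "e 0 = 0" using I(2,4) by blast
        then have "D n (m - d) = 0" unfolding D_def using tpow_degree_eq_0[of e X] I(3) 2 by blast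
        then show ?thesis
          using tmor_zero_left[OF I(3)] cmp_zero_right[OF g[OF Suc.prems(1)]] cmp_zero_right[OF Suc.prems(2)]
          by simp
      next
        case 3
        have d0: "0 < d" using 3 I(2) by (cases d) auto
        have md: "m - d + d = m" using d by simp
        have t: "t \<in> Hom (gcomp A (m - d + d)) T" using Suc.prems(2) md by simp
        \<comment> \<open>The last letter is moved into t. The resulting t' annihilates all
          monomials of degree m - d, since multiplying these by the letter gives monomials of degree
          m.\<close>
        obtain T' t' where t': "t' \<in> Hom (gcomp A (m - d)) T'"
          "\<And>Y f. f \<in> Hom Y (gcomp A (m - d)) \<Longrightarrow> t \<cdot> mult_map (m - d) d f (\<gamma> d) = 0 \<longleftrightarrow> t' \<cdot> f = 0"
          using mult_map_annihilator[OF t \<gamma>[OF 3(1)]] by metis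
        have "(T', t') \<in> snd V" if V: "V \<in> monomials gs (m - d)" for V
        proof -
          have "V \<otimes>\<^bsub>subobj_monoid\<^esub> subobj d (\<gamma> d) \<in> monomials gs (m - d + d)"
            by (rule monomials_mult[OF _ _ V]) (use gs set_gs 3 in auto)
          then have mem: "(T, t) \<in> snd (V \<otimes>\<^bsub>subobj_monoid\<^esub> subobj d (\<gamma> d))" using Suc.prems(3) md by simp
          have V': "V \<in> carrier subobj_monoid" "fst V = m - d"
            using monomials_carrier[of gs] fst_monomials[OF gs1 V] gs V by auto
          obtain Y f where f: "f \<in> Hom Y (gcomp A (m - d))" "V = subobj (m - d) f"
            using carrier_subobj_degree[OF V'] by blast
          have "t \<cdot> mult_map (m - d) d f (\<gamma> d) = 0"
            using mem unfolding f(2) subobj_monoid_mult[OF f(1) \<gamma>[OF 3(1)]]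
            by (simp add: subobj_def ann_mem)
          then show ?thesis unfolding f(2) subobj_def using t' f(1) by (simp add: ann_mem)
        qed
        then have "t' \<cdot> g n (m - d) = 0" using Suc.IH[OF 3(2) t'(1)] by blast
        then have "t \<cdot> mult_map (m - d) d (g n (m - d)) (\<gamma> d) = 0" using t'(2)[OF g[OF 3(2)]] by simp
        then have z: "t \<cdot> g (Suc n) m \<cdot> (D n (m - d) \<otimes>\<^sub>m e d) \<cdot> (ident C (tpow C X n) \<otimes>\<^sub>m lunitor C X) = 0"
          unfolding step[OF d0 d 3(2)] .
        have w: "g (Suc n) m \<in> Hom (tpow C X n \<otimes>\<^sub>o X) (gcomp A m)" using g[OF Suc.prems(1)] by simp
        note De = tmor_in_hom[OF D I(3), of n "m - d" d]
        have li: "is_iso C (tpow C X n \<otimes>\<^sub>o (unit_obj C \<otimes>\<^sub>o X)) (tpow C X n \<otimes>\<^sub>o X) (ident C (tpow C X n) \<otimes>\<^sub>m lunitor C X)"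
          unfolding is_iso_def using tmor_inverse[OF ident_inverse inverse_mor[OF lunitor_iso]] by blast
        have "(t \<cdot> g (Suc n) m \<cdot> (D n (m - d) \<otimes>\<^sub>m e d)) \<cdot> (ident C (tpow C X n) \<otimes>\<^sub>m lunitor C X) = 0"
          using z cmp_assoc3[OF id_tmor_in_hom[OF lun_cmp(1)] De w Suc.prems(2)] by simp
        then show ?thesis
          using epi_eq_0[OF iso_epi[OF li] cmp_in_hom[OF cmp_in_hom[OF De w] Suc.prems(2)]] by blast
      qed
    qed
    note z = this
    have w: "g (Suc n) m \<in> Hom (tpow C X n \<otimes>\<^sub>o X) (gcomp A m)" using g[OF Suc.prems(1)] by simp
    note tg = cmp_in_hom[OF w Suc.prems(2)]
    have Ds: "D (Suc n) m = (\<Sum>d\<le>m. D n (m - d) \<otimes>\<^sub>m e d)" by (simp add: D_def)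
    \<comment> \<open>The inserted projector is a sum over the degree of the last letter, and
      \<open>z\<close> kills every summand.\<close>
    have "t \<cdot> g (Suc n) m = (t \<cdot> g (Suc n) m) \<cdot> D (Suc n) m"
      using cmp_assoc[OF D g[OF Suc.prems(1)] Suc.prems(2)] gD[OF Suc.prems(1)] by simp
    also have "\<dots> = (\<Sum>d\<le>m. (t \<cdot> g (Suc n) m) \<cdot> (D n (m - d) \<otimes>\<^sub>m e d))"
      unfolding Ds by (rule cmp_sum_right[OF tg tmor_in_hom[OF D I(3)]])
    also have "\<dots> = 0"
      using z cmp_assoc[OF tmor_in_hom[OF D I(3)] w Suc.prems(2)] by (intro sum.neutral) simp
    finally show ?case .
  qed
  have cover: "t = 0" if t: "t \<in> Hom (gcomp A m) T" "\<And>U. U \<in> monomials gs m \<Longrightarrow> (T, t) \<in> snd U" for m T t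
  proof -
    note tp = cmp_in_hom[OF \<phi>h t(1)]
    \<comment> \<open>The summand \<open>R n m\<close> is a quotient of the n-th tensor power, so
      vanishing on it can be tested on words of length n.\<close>
    have "(t \<cdot> \<phi> m) \<cdot> inc m n = 0" if n: "n \<le> m" for n
    proof -
      note i = inc(1)[OF n]
      have be: "is_epi C (tpow C X n) (R n m) (b n m \<cdot> q n)"
        by (rule epi_cmp[OF qe section_epi[OF ab(1) ab(2) ab(3)]])
      have "((t \<cdot> \<phi> m) \<cdot> inc m n) \<cdot> (b n m \<cdot> q n) = t \<cdot> g n m"
        unfolding g_def s_def using cmp_assoc[OF epi_in_hom[OF be] i tp]
          cmp_assoc[OF cmp_in_hom[OF epi_in_hom[OF be] i] \<phi>h t(1)] by simp
      then show ?thesis using words[OF n t] epi_eq_0[OF be cmp_in_hom[OF i tp]] by simp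
    qed
    note z = this
    have "t \<cdot> \<phi> m = (t \<cdot> \<phi> m) \<cdot> (\<Sum>n\<le>m. inc m n \<cdot> prj m n)"
      using ds[of m] cmp_ident_right[OF tp] by (simp add: is_direct_sum_def)
    also have "\<dots> = (\<Sum>n\<le>m. (t \<cdot> \<phi> m) \<cdot> (inc m n \<cdot> prj m n))"
      by (rule cmp_sum_right[OF tp cmp_in_hom[OF inc(2) inc(1)]]) auto
    also have "\<dots> = 0"
    proof (intro sum.neutral ballI)
      fix n assume "n \<in> {..m}"
      then have n: "n \<le> m" by simp
      show "(t \<cdot> \<phi> m) \<cdot> (inc m n \<cdot> prj m n) = 0"
        using cmp_assoc[OF inc(2)[OF n] inc(1)[OF n] tp] z[OF n] cmp_zero_left[OF inc(2)[OF n]] by simp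
    qed
    finally show "t = 0" using epi_eq_0[OF \<phi>e t(1)] by blast
  qed
  show ?thesis by (rule that[OF gs]) (use cover in blast)
qed

lemma d_subexponential:
  assumes "is_finitely_generated C A" "1 < \<rho>"
  obtains c k where "\<And>m. d (gcomp A m) \<le> c * real (m + 1) ^ k * \<rho> ^ m"
proof -
  obtain R where R: "1 \<le> R" "\<And>S. is_simple C S \<Longrightarrow> d S \<le> R" using d_simple_upper by blast
  interpret poly_growth_monoid subobj_monoid subobj_le subobj_rank R by (rule poly_growth_subobj[OF R])
  obtain gs where gs: "\<forall>(e, G)\<in>set gs. G \<in> carrier subobj_monoid \<and> fst G = e \<and> 0 < e"
    and cover: "\<forall>m T. \<forall>t\<in>Hom (gcomp A m) T. (\<forall>U\<in>monomials gs m. (T, t) \<in> snd U) \<longrightarrow> t = 0"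
    by (rule generators[OF assms(1)])
  have gs': "\<forall>(e, G)\<in>set gs. G \<in> carrier subobj_monoid \<and> fst G = e"
    "\<forall>(e, G)\<in>set gs. G \<in> carrier subobj_monoid" "\<forall>(e, G)\<in>set gs. G \<in> carrier subobj_monoid \<and> 0 < e"
    using gs by auto
  obtain c k where ck: "\<And>m. (\<Sum>U\<in>monomials gs m. subobj_rank U) \<le> c * real (m + 1) ^ k * \<rho> ^ m"
    using subexponential_monomials[OF assms(2) gs'(3)] by blast
  have "d (gcomp A m) \<le> (\<Sum>U\<in>monomials gs m. subobj_rank U)" for m
  proof (rule d_le_cover[OF finite_monomials])
    show "U \<in> carrier subobj_monoid \<and> fst U = m" if "U \<in> monomials gs m" for U
      using fst_monomials[OF gs'(1) that] monomials_carrier[OF gs'(2)] that by blast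
  qed (use cover in blast)
  then have "d (gcomp A m) \<le> c * real (m + 1) ^ k * \<rho> ^ m" for m using ck[of m] by (rule order_trans)
  then show ?thesis by (rule that)
qed

end

section \<open>The radius of convergence\<close>

lemma summable_poly_geometric:
  fixes x :: real
  assumes "0 \<le> x" "x < 1"
  shows "summable (\<lambda>m. real (m + 1) ^ k * x ^ m)"
proof (rule summable_in_conv_radius)
  have "(\<lambda>m. real (Suc m) / real (Suc (Suc m))) \<longlonglongrightarrow> 1"
    using LIMSEQ_Suc[OF LIMSEQ_n_over_Suc_n[where 'a = real]] by simp
  then have "(\<lambda>m. (real (Suc m) / real (Suc (Suc m))) ^ k) \<longlonglongrightarrow> 1 ^ k" by (rule tendsto_power)
  then have "(\<lambda>m. norm (real (m + 1) ^ k) / norm (real (Suc m + 1) ^ k)) \<longlonglongrightarrow> 1"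
    by (simp add: power_divide)
  then have "conv_radius (\<lambda>m. real (m + 1) ^ k) = ereal 1"
    by (intro conv_radius_ratio_limit_nonzero) auto
  then show "ereal (norm x) < conv_radius (\<lambda>m. real (m + 1) ^ k)" using assms by simp
qed

lemma conv_radius_eq_1:
  fixes a :: "nat \<Rightarrow> real"
  assumes upper: "\<And>\<rho>. 1 < \<rho> \<Longrightarrow> \<exists>c k. \<forall>m. \<bar>a m\<bar> \<le> c * real (m + 1) ^ k * \<rho> ^ m"
    and lower: "0 < \<epsilon>" "\<And>m. a m \<noteq> 0 \<Longrightarrow> \<epsilon> \<le> \<bar>a m\<bar>" "infinite {m. a m \<noteq> 0}"
  shows "conv_radius a = 1"
proof (rule antisym)
  \<comment> \<open>At the point 1 infinitely many terms are at least \<epsilon> in absolute value,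
    so the series cannot converge absolutely there.\<close>
  have "\<not> summable (\<lambda>m. norm (a m * 1 ^ m))"
  proof
    assume "summable (\<lambda>m. norm (a m * 1 ^ m))"
    then have "(\<lambda>m. \<bar>a m\<bar>) \<longlonglongrightarrow> 0" using summable_LIMSEQ_zero by fastforce
    then have "\<forall>\<^sub>F m in sequentially. \<bar>a m\<bar> < \<epsilon>" using lower(1) by (rule order_tendstoD)
    then obtain N where N: "\<And>m. N \<le> m \<Longrightarrow> \<bar>a m\<bar> < \<epsilon>" by (auto simp: eventually_sequentially)
    obtain m where "N \<le> m" "a m \<noteq> 0" using lower(3) by (auto simp: infinite_nat_iff_unbounded_le)
    then show False using N lower(2) by fastforce
  qed
  then have "conv_radius a \<le> norm (1::real)" by (rule conv_radius_leI)
  then show "conv_radius a \<le> 1" by (simp add: one_ereal_def)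
next
  show "1 \<le> conv_radius a"
  proof (rule conv_radius_geI_ex')
    fix r :: real assume r: "0 < r" "ereal r < 1"
    then have r1: "r < 1" by (simp add: one_ereal_def)
    \<comment> \<open>The midpoint of 1 and 1/r: larger than 1, yet \<rho> r stays below 1.\<close>
    define \<rho> where "\<rho> = (1 + 1 / r) / 2"
    have \<rho>: "1 < \<rho>" "\<rho> * r < 1" using r(1) r1 by (auto simp: \<rho>_def field_simps)
    obtain c k where ck: "\<And>m. \<bar>a m\<bar> \<le> c * real (m + 1) ^ k * \<rho> ^ m" using upper[OF \<rho>(1)] by blast
    show "summable (\<lambda>m. a m * of_real r ^ m)"
    proof (rule summable_comparison_test')
      show "summable (\<lambda>m. c * (real (m + 1) ^ k * (\<rho> * r) ^ m))"
        using \<rho> r by (intro summable_mult summable_poly_geometric) auto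
      fix m :: nat
      have "norm (a m * of_real r ^ m) = \<bar>a m\<bar> * r ^ m" using r by (simp add: abs_mult)
      also have "\<dots> \<le> (c * real (m + 1) ^ k * \<rho> ^ m) * r ^ m" using ck r by (intro mult_right_mono) auto
      finally show "norm (a m * of_real r ^ m) \<le> c * (real (m + 1) ^ k * (\<rho> * r) ^ m)"
        by (simp add: power_mult_distrib mult_ac)
    qed
  qed
qed

lemma infinite_support_if_not_polynomial:
  assumes "\<nexists>p. f = fps_of_poly p"
  shows "infinite {m. fps_nth f m \<noteq> 0}"
proof
  assume "finite {m. fps_nth f m \<noteq> 0}"
  then obtain N where N: "\<And>m. fps_nth f m \<noteq> 0 \<Longrightarrow> m \<le> N" by (auto simp: finite_nat_set_iff_bounded_le)
  have "coeff (Abs_poly (fps_nth f)) = fps_nth f" by (rule coeff_Abs_poly[of N]) (use N in fastforce)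
  then have "f = fps_of_poly (Abs_poly (fps_nth f))" by (simp add: fps_eq_iff)
  then show False using assms by blast
qed

theorem corollary11p2:
  fixes C :: "('k::alg_closed_field, 'o, 'm::ab_group_add) moncat"
    and A :: "('o, 'm) graded_alg"
  assumes "symmetric_tensor_category C"
    and "finitely_many_simples C"
    and "is_commutative_graded_algebra C A"
    and "is_finitely_generated C A"
    and "is_connected C A"
  shows "(\<nexists>p. FP_series C A = fps_of_poly p) \<longrightarrow> fps_conv_radius (FP_series C A) = 1"
proof
  assume "\<nexists>p. FP_series C A = fps_of_poly p"
  then have inf: "infinite {m. FPdim C (gcomp A m) \<noteq> 0}"
    using infinite_support_if_not_polynomial by (fastforce simp: FP_series_def)
  interpret symmetric_tensor_category C by (rule assms(1))
  have "conv_radius (\<lambda>m. FPdim C (gcomp A m)) = 1"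
    using FPdim_dichotomy[OF assms(2)]
  proof
    assume "fp_dimension C (FPdim C)"
    then interpret graded_commutative_algebra C "FPdim C" A
      unfolding graded_commutative_algebra_def graded_commutative_algebra_axioms_def using assms(3) by blast
    obtain \<epsilon> where \<epsilon>: "0 < \<epsilon>" "\<And>X. FPdim C X \<noteq> 0 \<Longrightarrow> \<epsilon> \<le> FPdim C X" using d_lower by blast
    show ?thesis
    proof (rule conv_radius_eq_1[OF _ \<epsilon>(1) _ inf])
      show "\<exists>c k. \<forall>m. \<bar>FPdim C (gcomp A m)\<bar> \<le> c * real (m + 1) ^ k * \<rho> ^ m" if "1 < \<rho>" for \<rho>
        using d_subexponential[OF assms(4) that] d_nonneg by (metis abs_of_nonneg)
      show "\<epsilon> \<le> \<bar>FPdim C (gcomp A m)\<bar>" if "FPdim C (gcomp A m) \<noteq> 0" for m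
        using \<epsilon>(2)[OF that] by simp
    qed
  next
    text \<open>Without a Frobenius-Perron character \<open>FPdim\<close> would be a constant junk value.\<close>
    assume "\<exists>c. \<forall>X. FPdim C X = c"
    then obtain c where c: "\<And>X. FPdim C X = c" by blast
    have "c \<noteq> 0" using inf c by auto
    show ?thesis
    \<comment> \<open>The claim holds in this case as well: the series is the geometric series times
      c, so |c| serves both as the lower bound and as the constant of the upper bound, with
      polynomial degree 0.\<close>
    proof (rule conv_radius_eq_1[of _ "\<bar>c\<bar>", OF _ _ _ inf], goal_cases)
      case (1 \<rho>)
      have "\<bar>c\<bar> * 1 \<le> \<bar>c\<bar> * \<rho> ^ m" for m using 1 by (intro mult_left_mono one_le_power) auto
      then show ?case unfolding c by (intro exI[of _ "\<bar>c\<bar>"] exI[of _ 0]) simp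
    qed (use c \<open>c \<noteq> 0\<close> in auto)
  qed
  then show "fps_conv_radius (FP_series C A) = 1" by (simp add: fps_conv_radius_def FP_series_def)
qed

end
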